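(* For $K\ge1$, let $f\in\mathcal{S}_{H_2}\cap\mathcal{S}_H^0$ be a $K$-quasiconformal harmonic mapping from $\mathbb{D}$ onto a bounded Pommerenke interior domain $G$. If $G$ is a radial John disk, then $$\sup_{\zeta\in\mathbb{D}}\frac{1}{2\pi}\int_{\partial\mathbb{D}}\frac{\|D_f(\xi)\|}{\|D_f(\zeta)\|}\,\frac{1-|\zeta|^2}{|\xi-\zeta|^2}\,|d\xi|<\infty.$$
   Context: $\mathbb{D}=\{z\in\mathbb{C}:|z|<1\}$, $\mathbb{D}_r=\{z:|z|<r\}$. $\mathcal{S}_H$ is the family of sense-preserving harmonic univalent mappings $f=h+\overline{g}$ in $\mathbb{D}$, with $h,g$ analytic, $h(0)=g(0)=0$, $h'(0)=1$; $\mathcal{S}_H^0=\{f=h+\overline g\in\mathcal{S}_H:g'(0)=0\}$. $\mathcal{S}_{H_2}$ is the class of all $f=h+\overline g\in\mathcal{S}_H$ satisfying $$\sup_{z\in\mathbb{D}}\left|(1-|z|^2)\frac{h''(z)}{h'(z)}-2\overline z\right|<4.$$ Write $\|D_f\|=|f_z|+|f_{\overline z}|$. A sense-preserving homeomorphism $f$ of class $W^{1,2}_{loc}$ between domains is $K$-quasiconformal if $\|D_f(z)\|^2\le K\big||f_z|^2-|f_{\overline z}|^2\big|$. Pommerenke interior domain: let $f\in\mathcal{S}_H$ be $K$-quasiconformal with $f(\mathbb{D})=G$. For $0<r<1$ let $G_r=f(\mathbb{D}_r)$; for distinct $w_1,w_2\in f(\partial\mathbb{D}_r)$ let $\gamma_r[w_1,w_2]$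 be the smaller (shorter) subarc of $f(\partial\mathbb{D}_r)$ between $w_1$ and $w_2$, $\ell(\gamma_r[w_1,w_2])$ its length, and $d_{G_r}(w_1,w_2)=\inf_\Gamma\operatorname{diam}\Gamma$, where $\Gamma$ runs through all arcs from $w_1$ to $w_2$ that lie in $G_r$ except for their endpoints. $G$ is a Pommerenke interior domain (with respect to $f$) if $$\sup_{0<r<1}\ \sup_{w_1,w_2}\frac{\ell(\gamma_r[w_1,w_2])}{d_{G_r}(w_1,w_2)}<\infty,$$ and a bounded Pommerenke interior domain if in addition $G$ is bounded. Radial John disk: for a domain $G$, $d_G(w)$ is the Euclidean distance from $w$ to $\partial G$. For univalent $f$ on $\mathbb{D}$, a bounded simply connected domain $G=f(\mathbb{D})$ is a radial $c$-John disk ($c\ge1$) with John center $f(0)$ if for every $z\in\mathbb{D}$ the curve $\gamma=f([0,z])$, joining $w_1=f(z)$ to $f(0)$, is rectifiable and satisfies: for every $w\in\gamma$, the Euclidean length of the subarc $\gamma[w_1,w]$ of $\gamma$ between $w_1$ and $w$ is at most $c\,d_G(w)$. $G$ is a radial John disk if it is a radial $c$-John disk for some $c\ge1$. For $\xi\in\partial\mathbb{D}$, $\|D_f(\xi)\|$ denotes the radial limit $\lim_{r\to1^-}\|D_f(r\xi)\|$ (defined almost everywhere). *)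

theory Defs
  imports "HOL-Complex_Analysis.Complex_Analysis"
begin

subsection \<open>Wirtinger derivatives\<close>

definition wirtinger :: "(complex \<Rightarrow> complex) \<Rightarrow> complex \<Rightarrow> complex" where
  "wirtinger f z =
     (frechet_derivative f (at z) 1 - \<i> * frechet_derivative f (at z) \<i>) / 2"

definition wirtinger_bar :: "(complex \<Rightarrow> complex) \<Rightarrow> complex \<Rightarrow> complex" where
  "wirtinger_bar f z =
     (frechet_derivative f (at z) 1 + \<i> * frechet_derivative f (at z) \<i>) / 2"

definition normD :: "(complex \<Rightarrow> complex) \<Rightarrow> complex \<Rightarrow> real" where
  "normD f z = cmod (wirtinger f z) + cmod (wirtinger_bar f z)"

definition jacobian :: "(complex \<Rightarrow> complex) \<Rightarrow> complex \<Rightarrow> real" where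
  "jacobian f z = (cmod (wirtinger f z))\<^sup>2 - (cmod (wirtinger_bar f z))\<^sup>2"


subsection \<open>Classes of harmonic univalent mappings\<close>

text \<open>The normalisation at \<open>0\<close> makes the pair \<open>(h, g)\<close> unique on the disk, so the existential
  quantifiers over it in the class definitions below involve no choice.\<close>

definition harmonic_decomposition ::
    "(complex \<Rightarrow> complex) \<Rightarrow> (complex \<Rightarrow> complex) \<Rightarrow> (complex \<Rightarrow> complex) \<Rightarrow> bool" where
  "harmonic_decomposition f h g \<longleftrightarrow>
     h holomorphic_on ball 0 1 \<and> g holomorphic_on ball 0 1 \<and> h 0 = 0 \<and> g 0 = 0 \<and>
     (\<forall>z\<in>ball 0 1. f z = h z + cnj (g z))"

text \<open>A harmonic mapping is called sense-preserving if its Jacobian is positive; for univalent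
  harmonic mappings this agrees with the topological notion by Lewy's theorem.\<close>

definition S_H :: "(complex \<Rightarrow> complex) set" where
  "S_H = {f. inj_on f (ball 0 1) \<and> (\<forall>z\<in>ball 0 1. jacobian f z > 0) \<and>
             (\<exists>h g. harmonic_decomposition f h g \<and> deriv h 0 = 1)}"

definition S_H0 :: "(complex \<Rightarrow> complex) set" where
  "S_H0 = {f \<in> S_H. \<exists>h g. harmonic_decomposition f h g \<and> deriv g 0 = 0}"

definition S_H2 :: "(complex \<Rightarrow> complex) set" where
  "S_H2 = {f \<in> S_H. \<exists>h g. harmonic_decomposition f h g \<and>
     (SUP z\<in>ball 0 1. ennreal (cmod
        (of_real (1 - (cmod z)\<^sup>2) * (deriv (deriv h) z / deriv h z) - 2 * cnj z))) < 4}"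


subsection \<open>Quasiconformal mappings\<close>

text \<open>Weak derivatives are tested against \<open>C\<^sup>1\<close> functions of compact support; by mollification
  this is the same as testing against smooth ones.\<close>

definition test_function :: "complex set \<Rightarrow> (complex \<Rightarrow> real) \<Rightarrow> bool" where
  "test_function U \<phi> \<longleftrightarrow>
     (\<forall>z. \<phi> differentiable (at z)) \<and>
     (\<forall>v. continuous_on UNIV (\<lambda>z. frechet_derivative \<phi> (at z) v)) \<and>
     compact (closure {z. \<phi> z \<noteq> 0}) \<and> closure {z. \<phi> z \<noteq> 0} \<subseteq> U"

definition L2_loc :: "complex set \<Rightarrow> (complex \<Rightarrow> complex) \<Rightarrow> bool" where
  "L2_loc U u \<longleftrightarrow> set_borel_measurable lborel U u \<and>
     (\<forall>C. compact C \<and> C \<subseteq> U \<longrightarrow> set_integrable lborel C (\<lambda>z. (cmod (u z))\<^sup>2))"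

definition weak_derivative ::
    "complex set \<Rightarrow> (complex \<Rightarrow> complex) \<Rightarrow> complex \<Rightarrow> (complex \<Rightarrow> complex) \<Rightarrow> bool" where
  "weak_derivative U f v u \<longleftrightarrow>
     (\<forall>\<phi>. test_function U \<phi> \<longrightarrow>
        (LINT z:U|lborel. frechet_derivative \<phi> (at z) v *\<^sub>R f z)
          = - (LINT z:U|lborel. \<phi> z *\<^sub>R u z))"

definition W12_loc :: "complex set \<Rightarrow> (complex \<Rightarrow> complex) \<Rightarrow> bool" where
  "W12_loc U f \<longleftrightarrow> L2_loc U f \<and> (\<forall>v\<in>{1, \<i>}. \<exists>u. L2_loc U u \<and> weak_derivative U f v u)"

definition sense_preserving_homeomorphism :: "complex set \<Rightarrow> (complex \<Rightarrow> complex) \<Rightarrow> bool" where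
  "sense_preserving_homeomorphism U f \<longleftrightarrow>
     (\<exists>f'. homeomorphism U (f ` U) f f') \<and>
     (\<forall>z r. 0 < r \<and> cball z r \<subseteq> U \<longrightarrow> winding_number (f \<circ> circlepath z r) (f z) = 1)"

text \<open>A homeomorphism of class \<open>W\<^sup>1\<^sup>,\<^sup>2\<close> between plane domains is differentiable almost everywhere
  and its classical derivatives represent the weak ones, so the dilatation inequality can be
  expressed by classical derivatives at almost every point.\<close>

definition quasiconformal :: "real \<Rightarrow> complex set \<Rightarrow> (complex \<Rightarrow> complex) \<Rightarrow> bool" where
  "quasiconformal K U f \<longleftrightarrow>
     open U \<and> connected U \<and> open (f ` U) \<and>
     sense_preserving_homeomorphism U f \<and> W12_loc U f \<and>
     (AE z in lborel. z \<in> U \<longrightarrow>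
        f differentiable (at z) \<and> (normD f z)\<^sup>2 \<le> K * \<bar>jacobian f z\<bar>)"


subsection \<open>Pommerenke interior domains\<close>

definition curve_length :: "(real \<Rightarrow> complex) \<Rightarrow> real \<Rightarrow> real \<Rightarrow> ennreal" where
  "curve_length \<gamma> a b =
     (SUP ts\<in>{ts. sorted ts \<and> set ts \<subseteq> {a..b}}.
        ennreal (\<Sum>i<length ts - 1. dist (\<gamma> (ts ! i)) (\<gamma> (ts ! Suc i))))"

text \<open>For distinct \<open>w1\<close>, \<open>w2\<close> on the Jordan curve \<open>f ` sphere 0 r\<close>, the index set consists, up to
  translation by multiples of \<open>2 * pi\<close>, of exactly two pairs, one for each of the two subarcs
  between \<open>w1\<close> and \<open>w2\<close>; the infimum is the length of the shorter one.\<close>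

definition shorter_subarc_length ::
    "(complex \<Rightarrow> complex) \<Rightarrow> real \<Rightarrow> complex \<Rightarrow> complex \<Rightarrow> ennreal" where
  "shorter_subarc_length f r w1 w2 =
     (INF (s, t)\<in>{(s, t). s \<le> t \<and> t \<le> s + 2 * pi \<and> {f (rcis r s), f (rcis r t)} = {w1, w2}}.
        curve_length (\<lambda>\<theta>. f (rcis r \<theta>)) s t)"

definition diam_dist :: "complex set \<Rightarrow> complex \<Rightarrow> complex \<Rightarrow> ennreal" where
  "diam_dist G w1 w2 =
     (INF \<Gamma>\<in>{\<Gamma>. arc \<Gamma> \<and> pathstart \<Gamma> = w1 \<and> pathfinish \<Gamma> = w2 \<and> path_image \<Gamma> - {w1, w2} \<subseteq> G}.
        ennreal (diameter (path_image \<Gamma>)))"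

definition Pommerenke_interior_domain :: "(complex \<Rightarrow> complex) \<Rightarrow> complex set \<Rightarrow> bool" where
  "Pommerenke_interior_domain f G \<longleftrightarrow>
     f \<in> S_H \<and> (\<exists>K\<ge>1. quasiconformal K (ball 0 1) f) \<and> f ` ball 0 1 = G \<and>
     (SUP r\<in>{0<..<1}. SUP w1\<in>f ` sphere 0 r. SUP w2\<in>f ` sphere 0 r - {w1}.
        shorter_subarc_length f r w1 w2 / diam_dist (f ` ball 0 r) w1 w2) < \<infinity>"

definition bounded_Pommerenke_interior_domain ::
    "(complex \<Rightarrow> complex) \<Rightarrow> complex set \<Rightarrow> bool" where
  "bounded_Pommerenke_interior_domain f G \<longleftrightarrow> Pommerenke_interior_domain f G \<and> bounded G"


subsection \<open>Radial John disks\<close>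

text \<open>The curve \<open>f([0,z])\<close> is parametrised by \<open>t \<mapsto> f (t z)\<close> on \<open>[0,1]\<close>; its subarc between \<open>f z\<close>
  and the point \<open>f (t z)\<close> corresponds to the parameter interval \<open>[t,1]\<close>.\<close>

definition radial_c_John_disk :: "real \<Rightarrow> (complex \<Rightarrow> complex) \<Rightarrow> complex set \<Rightarrow> bool" where
  "radial_c_John_disk c f G \<longleftrightarrow>
     c \<ge> 1 \<and> inj_on f (ball 0 1) \<and> f ` ball 0 1 = G \<and>
     open G \<and> bounded G \<and> simply_connected G \<and>
     (\<forall>z\<in>ball 0 1.
        curve_length (\<lambda>t. f (of_real t * z)) 0 1 < \<infinity> \<and>
        (\<forall>t\<in>{0..1}. curve_length (\<lambda>t. f (of_real t * z)) t 1
                      \<le> ennreal (c * infdist (f (of_real t * z)) (frontier G))))"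

definition radial_John_disk :: "(complex \<Rightarrow> complex) \<Rightarrow> complex set \<Rightarrow> bool" where
  "radial_John_disk f G \<longleftrightarrow> (\<exists>c. radial_c_John_disk c f G)"


subsection \<open>Boundary values\<close>

definition normD_boundary :: "(complex \<Rightarrow> complex) \<Rightarrow> complex \<Rightarrow> real" where
  "normD_boundary f \<xi> = Lim (at_left 1) (\<lambda>r. normD f (of_real r * \<xi>))"

end

theory Submission
  imports Defs
begin

text \<open>
  Write \<open>f = h + cnj g\<close> and \<open>h' = exp L\<close>; by quasiconformality \<open>normD f\<close> is comparable to
  \<open>E = \<bar>h'\<bar>\<close>, and the bound defining \<open>S_H2\<close> controls \<open>deriv L\<close>.

  A length-area estimate on a polar box at distance \<open>d\<close> from the circle bounds the distance of
  \<open>f z\<close> to the boundary of the image by a multiple of \<open>d * E z\<close>, where \<open>d = 1 - \<bar>z\<bar>\<close>. With the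
  radial John condition the whole box, up to the unit circle, is mapped into a disk of radius
  \<open>O(d * E z)\<close>, so two points of \<open>\<bar>w\<bar> = r\<close> at angular distance \<open>2 * d\<close> have images that are joined by
  a crosscut of that diameter, and the Pommerenke condition bounds the shorter image arc. Jensen's
  inequality for the harmonic function \<open>ln E\<close> shows that the complementary arc is never short, hence
  the integral of \<open>E\<close> over an arc of half-length \<open>d\<close> is \<open>O(d * E z)\<close> in every case.

  The strict bound \<open>\<alpha> < 2\<close> gives \<open>E ((1 - 2^j d) \<xi>) \<le> 8 * 2^(j (\<alpha> - 1)) * E ((1 - d) \<xi>)\<close>, so that
  summing the arc bounds against the Poisson kernel over dyadic arcs yields a convergent geometric
  series. Finally \<open>exp (L / 2)\<close> and \<open>g' / exp (L / 2)\<close> belong to the Hardy space \<open>H\<^sup>2\<close>; Fatou's theorem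
  provides the radial limits and Fatou's lemma transfers the bound to the boundary.
\<close>

subsection \<open>The area of an injective image\<close>

text \<open>All estimates are made on circles of radius \<open>r < 1\<close> with constants
  independent of \<open>r\<close>: the Pommerenke condition speaks about these circles, and nothing
  is known at first about boundary values. The strict bound in \<open>S_H2\<close> is decisive: at
  scale \<open>2^j * d\<close> the Poisson kernel has size \<open>4^(-j) / d\<close>, the arc
  integral contributes \<open>2^j * d\<close>, and passing from scale \<open>d\<close> to scale
  \<open>2^j * d\<close> costs \<open>2^(j * (\<alpha> - 1))\<close>; the product
  \<open>2^(j * (\<alpha> - 2))\<close> is summable because \<alpha> < 2. The Pommerenke condition
  does not tell which of the two arcs is the shorter one. If the arc near \<open>z\<close> is the
  longer one, the lower bound on its complement keeps \<open>d * E z\<close> away from 0, and the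
  bound on the total length is then good enough. The Hardy exponent is 2 because the circle means of
  \<open>E\<close> are bounded, \<open>h'\<close> has the square root \<open>exp (L / 2)\<close>,
  and square means are accessible to Parseval's identity; \<open>g'\<close> may have zeros, so it is
  divided by the root of \<open>h'\<close> instead of being given a root of its own.\<close>

no_notation fps_nth (infixl "$" 75)

text \<open>Mediates between two settings: Fubini's theorem is used on
  \<open>real \<times> real\<close>, while \<open>has_measure_differentiable_image\<close> is about
  \<open>real^2\<close>. Both measures give a box the product of its side lengths.\<close>

lemma lborel_pair_eq_distr_vec2:
  "(lborel :: (real \<times> real) measure) = distr (lborel :: (real^2) measure) borel (\<lambda>v. (v$1, v$2))"
proof (rule lborel_eqI)
  fix l u :: "real \<times> real"
  assume le: "\<And>b. b \<in> Basis \<Longrightarrow> l \<bullet> b \<le> u \<bullet> b"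
  let ?v = "\<lambda>p::real\<times>real. vector [fst p, snd p] :: real^2"
  have meas: "(\<lambda>v::real^2. (v$1, v$2)) \<in> borel_measurable lborel"
    unfolding measurable_lborel2 by (intro borel_measurable_continuous_onI continuous_intros)
  have eq: "(\<lambda>v::real^2. (v$1, v$2)) -` box l u = box (?v l) (?v u)"
    by (cases l; cases u) (auto simp: box_def Basis_prod_def Basis_vec_def inner_axis' inner_axis forall_2)
  have 1: "l \<bullet> (1,0) \<le> u \<bullet> (1,0)" and 2: "l \<bullet> (0,1) \<le> u \<bullet> (0,1)"
    by (auto intro!: le simp: Basis_prod_def)
  have "emeasure (distr lborel borel (\<lambda>v::real^2. (v$1, v$2))) (box l u) = emeasure lborel (box (?v l) (?v u))"
    using meas by (subst emeasure_distr) (auto simp: eq)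
  also have "\<dots> = (\<Prod>b\<in>Basis. (?v u - ?v l) \<bullet> b)"
  proof (subst emeasure_lborel_box)
    fix b :: "real^2" assume "b \<in> Basis"
    then obtain i where "b = axis i 1" by (auto simp: Basis_vec_def)
    then show "?v l \<bullet> b \<le> ?v u \<bullet> b"
      using 1 2 exhaust_2[of i] by (auto simp: inner_axis inner_prod_def)
  qed simp
  also have "(\<Prod>b\<in>Basis. (?v u - ?v l) \<bullet> b) = (fst u - fst l) * (snd u - snd l)"
  proof -
    have B: "(Basis :: (real^2) set) = {axis 1 1, axis 2 1}"
      by (auto simp: Basis_vec_def UNIV_2)
    have "(axis 1 1 :: real^2) \<noteq> axis 2 1" by (simp add: axis_eq_axis)
    then show ?thesis unfolding B by (simp add: inner_axis)
  qed
  also have "\<dots> = (\<Prod>b\<in>Basis. (u - l) \<bullet> b)"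
    by (simp add: Basis_prod_def prod.union_disjoint inner_prod_def)
  finally show "emeasure (distr lborel borel (\<lambda>v::real^2. (v$1, v$2))) (box l u) =
                 ennreal (\<Prod>b\<in>Basis. (u - l) \<bullet> b)" .
qed simp

lemma nn_integral_Jacobian_le:
  fixes F :: "real \<times> real \<Rightarrow> complex"
  assumes S: "open S"
    and der: "\<And>x. x \<in> S \<Longrightarrow> (F has_derivative F' x) (at x)"
    and inj: "inj_on F S"
    and sub: "F ` S \<subseteq> cball c R"
    and meas: "(\<lambda>x. indicator S x * ennreal \<bar>Im (cnj (F' x (1,0)) * F' x (0,1))\<bar>) \<in> borel_measurable borel"
  shows "(\<integral>\<^sup>+x. indicator S x * ennreal \<bar>Im (cnj (F' x (1,0)) * F' x (0,1))\<bar> \<partial>lborel) \<le> ennreal (4 * R\<^sup>2)"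
proof (cases "S = {}")
  case True
  then show ?thesis by simp
next
  case False
  then have R: "R \<ge> 0" using sub by (force simp: dist_norm intro: order_trans[OF norm_ge_zero])
  define \<phi> where "\<phi> = (\<lambda>v::real^2. (v$1, v$2))"
  define \<psi> where "\<psi> = (\<lambda>z. vector [Re z, Im z] :: real^2)"
  define J where "J = (\<lambda>x. \<bar>Im (cnj (F' x (1,0)) * F' x (0,1))\<bar>)"
  define T where "T = \<phi> -` S"
  have contphi: "continuous_on UNIV \<phi>" unfolding \<phi>_def by (intro continuous_intros)
  have blphi: "bounded_linear \<phi>"
    unfolding \<phi>_def by (intro bounded_linear_Pair bounded_linear_vec_nth)
  have psi: "\<psi> z = Re z *\<^sub>R axis 1 1 + Im z *\<^sub>R axis 2 1" for z
    by (auto simp: \<psi>_def vec_eq_iff forall_2 axis_def)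
  have blpsi: "bounded_linear \<psi>"
    unfolding psi[abs_def]
    by (intro bounded_linear_add bounded_linear_scaleR_const bounded_linear_Re bounded_linear_Im)
  have T: "open T" unfolding T_def using contphi S by (simp add: open_vimage)
  define G where "G = \<psi> \<circ> F \<circ> \<phi>"
  define G' where "G' = (\<lambda>v. \<psi> \<circ> F' (\<phi> v) \<circ> \<phi>)"
  have derG: "(G has_derivative G' v) (at v within T)" if "v \<in> T" for v
  proof -
    have "(F has_derivative F' (\<phi> v)) (at (\<phi> v))" using der that by (auto simp: T_def)
    then have "(F \<circ> \<phi> has_derivative F' (\<phi> v) \<circ> \<phi>) (at v)"
      by (rule diff_chain_at[OF bounded_linear_imp_has_derivative[OF blphi]])
    then have "(\<psi> \<circ> (F \<circ> \<phi>) has_derivative \<psi> \<circ> (F' (\<phi> v) \<circ> \<phi>)) (at v)"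
      by (rule diff_chain_at[OF _ bounded_linear_imp_has_derivative[OF blpsi]])
    then show ?thesis by (auto simp: G_def G'_def o_assoc intro: has_derivative_at_withinI)
  qed
  have injpsi: "inj \<psi>"
    by (auto simp: inj_def \<psi>_def vec_eq_iff forall_2 complex_eq_iff)
  have injphi: "inj \<phi>"
    by (auto simp: inj_def \<phi>_def vec_eq_iff forall_2)
  have injG: "inj_on G T"
    using inj injpsi injphi by (auto simp: G_def T_def inj_on_def)
  have contG: "continuous_on T G"
    using derG by (meson has_derivative_continuous_on)
  \<comment> \<open>Openness makes the image measurable and boundedness makes its measure finite;
    the change of variables formula turns this into integrability of the determinant.\<close>
  have "open (G ` T)"
    by (rule invariance_of_domain[OF contG T injG])
  have sub': "G ` T \<subseteq> cbox (vector [Re c - R, Im c - R]) (vector [Re c + R, Im c + R])"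
  proof
    fix y assume "y \<in> G ` T"
    then obtain v where v: "v \<in> T" "y = \<psi> (F (\<phi> v))" by (auto simp: G_def)
    then have "dist c (F (\<phi> v)) \<le> R" using sub by (auto simp: T_def)
    then have "\<bar>Re (F (\<phi> v) - c)\<bar> \<le> R" "\<bar>Im (F (\<phi> v) - c)\<bar> \<le> R"
      using abs_Re_le_cmod[of "F (\<phi> v) - c"] abs_Im_le_cmod[of "F (\<phi> v) - c"]
      by (auto simp: dist_norm norm_minus_commute)
    then show "y \<in> cbox (vector [Re c - R, Im c - R]) (vector [Re c + R, Im c + R])"
      by (auto simp: v \<psi>_def mem_box_cart forall_2)
  qed
  have lm: "G ` T \<in> lmeasurable"
    using \<open>open (G ` T)\<close> sub' by (meson bounded_cbox bounded_subset lmeasurable_open)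
  have Tm: "T \<in> sets lebesgue" using T by (simp add: borel_open sets_completionI_sets)
  have hi: "((\<lambda>x. \<bar>det (matrix (G' x))\<bar>) has_integral measure lebesgue (G ` T)) T"
    using has_measure_differentiable_image[OF Tm derG injG] lm by blast
  have detG: "\<bar>det (matrix (G' v))\<bar> = J (\<phi> v)" if "v \<in> T" for v
    by (simp add: det_2 matrix_def G'_def J_def \<psi>_def \<phi>_def axis_def algebra_simps)
  have hi': "((\<lambda>v. J (\<phi> v)) has_integral measure lebesgue (G ` T)) T"
    using hi detG by (simp cong: has_integral_cong)
  have "(\<integral>\<^sup>+x. indicator S x * ennreal (J x) \<partial>lborel) = (\<integral>\<^sup>+v. indicator S (\<phi> v) * ennreal (J (\<phi> v)) \<partial>lborel)"
    unfolding lborel_pair_eq_distr_vec2 \<phi>_def[symmetric]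
    by (subst nn_integral_distr)
       (use meas contphi in \<open>auto simp: J_def intro!: borel_measurable_continuous_onI\<close>)
  also have "\<dots> = (\<integral>\<^sup>+v. indicator T v * ennreal (J (\<phi> v)) \<partial>lborel)"
    by (simp add: T_def indicator_def)
  also have "\<dots> = (\<integral>\<^sup>+v. ennreal (indicator T v * J (\<phi> v)) \<partial>lborel)"
    by (simp add: ennreal_mult' ennreal_indicator)
  also have "\<dots> = ennreal (measure lebesgue (G ` T))"
    by (rule nn_integral_has_integral_lebesgue[OF _ hi']) (simp add: J_def)
  also have "\<dots> \<le> ennreal (measure lebesgue (cbox (vector [Re c - R, Im c - R]) (vector [Re c + R, Im c + R] :: real^2)))"
    using sub' lm by (intro ennreal_leI measure_mono_fmeasurable) auto
  also have "measure lebesgue (cbox (vector [Re c - R, Im c - R]) (vector [Re c + R, Im c + R] :: real^2)) = 4 * R\<^sup>2"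
    using R by (subst measure_completion, simp, subst content_cbox_cart) (auto simp: forall_2 UNIV_2 power2_eq_square interval_ne_empty_cart algebra_simps)
  finally show ?thesis by (simp add: J_def)
qed

subsection \<open>Fatou's theorem for the Hardy space\<close>

text \<open>On the unit circle \<open>dw = 2 * pi * \<i> * w dx\<close>, so division by
  \<open>\<i> * w\<close> turns a contour integral into one with respect to arc length.\<close>

lemma integral_circlepath_real_eq_contour_integral:
  fixes P :: "complex \<Rightarrow> real"
  shows "contour_integral (circlepath 0 1) (\<lambda>w. of_real (P w) / (\<i> * w)) =
         integral {0..1} (\<lambda>x. of_real (2 * pi * P (circlepath 0 1 x)))"
proof -
  have ne: "circlepath 0 1 x \<noteq> 0" for x
    by (simp add: circlepath_def part_circlepath_def)
  show ?thesis
    unfolding contour_integral_integral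
  proof (rule integral_cong)
    fix x :: real assume "x \<in> {0..1}"
    then have "vector_derivative (circlepath 0 1) (at x) = 2 * pi * \<i> * circlepath 0 1 x"
      by (subst vector_derivative_circlepath) (auto simp: circlepath_def part_circlepath_def linepath_def mult_ac)
    then show "complex_of_real (P (circlepath 0 1 x)) / (\<i> * circlepath 0 1 x) *
         vector_derivative (circlepath 0 1) (at x) =
         complex_of_real (2 * pi * P (circlepath 0 1 x))"
      using ne[of x] by (simp add: field_simps)
  qed
qed

text \<open>For \<open>cmod w = 1\<close> one has
  \<open>(cmod (w - z))^2 * w = (w - z) * (1 - cnj z * w)\<close>. The kernel times
  \<open>dw / (\<i> * w)\<close> is therefore a Cauchy integrand for a function holomorphic in the
  disk, which is evaluated at \<open>z\<close>.\<close>

lemma has_integral_Poisson_kernel_circlepath: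
  assumes z: "cmod z < 1"
  shows "((\<lambda>x. (1 - (cmod z)\<^sup>2) / (cmod (circlepath 0 1 x - z))\<^sup>2) has_integral 1) {0..1}"
proof -
  define P where "P = (\<lambda>w. (1 - (cmod z)\<^sup>2) / (cmod (w - z))\<^sup>2)"
  have ne: "w \<noteq> z" "1 - cnj z * w \<noteq> 0" if "cmod w = 1" for w
  proof -
    show "w \<noteq> z" using that z by auto
    have "cmod (cnj z * w) < 1" using z that by (simp add: norm_mult)
    then show "1 - cnj z * w \<noteq> 0" by auto
  qed
  have eq: "of_real (P w) / (\<i> * w) = ((1 - (cmod z)\<^sup>2) / (\<i> * (1 - cnj z * w))) / (w - z)" if "cmod w = 1" for w
  proof -
    have w1: "w * cnj w = 1" using that by (simp add: complex_norm_square[symmetric])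
    have w0: "w \<noteq> 0" using that by auto
    have "complex_of_real ((cmod (w - z))\<^sup>2) * w = (w - z) * (cnj w * w - cnj z * w)"
      unfolding complex_norm_square by (simp add: algebra_simps)
    also have "\<dots> = (w - z) * (1 - cnj z * w)" using w1 by (simp add: mult.commute)
    finally have *: "complex_of_real ((cmod (w - z))\<^sup>2) * w = (w - z) * (1 - cnj z * w)" .
    have "of_real (P w) / (\<i> * w) = of_real (1 - (cmod z)\<^sup>2) / (\<i> * (complex_of_real ((cmod (w - z))\<^sup>2) * w))"
      by (simp add: P_def)
    then show ?thesis unfolding * by (simp add: field_simps)
  qed
  have hol: "(\<lambda>w. (1 - (cmod z)\<^sup>2) / (\<i> * (1 - cnj z * w))) holomorphic_on ball 0 1"
    and cont: "continuous_on (cball 0 1) (\<lambda>w. (1 - (cmod z)\<^sup>2) / (\<i> * (1 - cnj z * w)))"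
  proof -
    have nz: "1 - cnj z * w \<noteq> 0" if "cmod w \<le> 1" for w
    proof -
      have "cmod (cnj z * w) < 1"
        using z that by (simp add: norm_mult) (metis mult_left_le norm_ge_zero order_le_less_trans)
      then show ?thesis by auto
    qed
    show "(\<lambda>w. (1 - (cmod z)\<^sup>2) / (\<i> * (1 - cnj z * w))) holomorphic_on ball 0 1"
      using nz by (intro holomorphic_intros) auto
    show "continuous_on (cball 0 1) (\<lambda>w. (1 - (cmod z)\<^sup>2) / (\<i> * (1 - cnj z * w)))"
      using nz by (intro continuous_intros) auto
  qed
  have "((\<lambda>w. ((1 - (cmod z)\<^sup>2) / (\<i> * (1 - cnj z * w))) / (w - z)) has_contour_integral
           2 * of_real pi * \<i> * ((1 - (cmod z)\<^sup>2) / (\<i> * (1 - cnj z * z)))) (circlepath 0 1)"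
    by (rule Cauchy_integral_circlepath[OF cont hol]) (use z in auto)
  moreover have "2 * of_real pi * \<i> * ((1 - (cmod z)\<^sup>2) / (\<i> * (1 - cnj z * z))) = 2 * of_real pi"
  proof -
    have *: "cnj z * z = of_real ((cmod z)\<^sup>2)" unfolding complex_norm_square by (rule mult.commute)
    have "(cmod z)\<^sup>2 < 1" using z by (simp add: abs_square_less_1)
    then have "1 - complex_of_real ((cmod z)\<^sup>2) \<noteq> 0"
      by (metis eq_iff_diff_eq_0 less_irrefl of_real_eq_1_iff)
    then show ?thesis unfolding * by simp
  qed
  ultimately have "((\<lambda>w. ((1 - (cmod z)\<^sup>2) / (\<i> * (1 - cnj z * w))) / (w - z)) has_contour_integral
           2 * of_real pi) (circlepath 0 1)" by metis
  then have "((\<lambda>w. of_real (P w) / (\<i> * w)) has_contour_integral 2 * of_real pi) (circlepath 0 1)"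
    by (rule has_contour_integral_eq) (simp add: eq)
  then have ci: "integral {0..1} (\<lambda>x. complex_of_real (2 * pi * P (circlepath 0 1 x))) = 2 * of_real pi"
    unfolding integral_circlepath_real_eq_contour_integral[of P, symmetric] by (rule contour_integral_unique)
  have contP: "continuous_on {0..1} (\<lambda>x. 2 * pi * P (circlepath 0 1 x))"
    unfolding P_def
  proof (intro continuous_intros path_circlepath[unfolded path_def] ballI)
    fix x :: real assume "x \<in> {0..1}"
    have "cmod (circlepath 0 1 x) = 1" by (simp add: circlepath_def part_circlepath_def)
    then show "(cmod (circlepath 0 1 x - z))\<^sup>2 \<noteq> 0" using ne(1) by simp
  qed
  then have int: "(\<lambda>x. 2 * pi * P (circlepath 0 1 x)) integrable_on {0..1}"
    by (rule integrable_continuous_interval)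
  have "integral {0..1} (\<lambda>x. complex_of_real (2 * pi * P (circlepath 0 1 x))) =
        of_real (integral {0..1} (\<lambda>x. 2 * pi * P (circlepath 0 1 x)))"
    using integral_linear[OF int bounded_linear_of_real] by (simp only: o_def)
  with ci have "integral {0..1} (\<lambda>x. 2 * pi * P (circlepath 0 1 x)) = 2 * pi"
    by (simp del: of_real_mult add: of_real_eq_iff[where 'a=complex, symmetric]) simp
  then have "((\<lambda>x. 2 * pi * P (circlepath 0 1 x)) has_integral 2 * pi) {0..1}"
    using int by (simp add: has_integral_integral)
  then have "((\<lambda>x. (1 / (2 * pi)) * (2 * pi * P (circlepath 0 1 x))) has_integral (1 / (2 * pi)) * (2 * pi)) {0..1}"
    by (rule has_integral_mult_right)
  then show ?thesis by (simp add: P_def)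
qed

text \<open>In Cauchy's formula for \<open>deriv H (r \<xi>)\<close> the kernel \<open>1 / (w - r \<xi>)\<^sup>2\<close> may be replaced by
  \<open>1 / (w - r \<xi>)\<^sup>2 - 1 / (r w - \<xi>)\<^sup>2\<close>. For a function that is
  \<open>O(\<bar>w - \<xi>\<bar>)\<close> on the circle the modified integrand, unlike the original one, is dominated by the
  Poisson kernel.\<close>

lemma radial_limit_deriv_of_tangential_deriv:
  fixes H :: "complex \<Rightarrow> complex"
  assumes cont: "continuous_on (cball 0 1) H" and hol: "H holomorphic_on ball 0 1"
    and \<xi>: "cmod \<xi> = 1"
    and tan: "\<And>\<epsilon>. \<epsilon> > 0 \<Longrightarrow> \<exists>d>0. \<forall>w. cmod w = 1 \<and> cmod (w - \<xi>) < d \<longrightarrow> cmod (H w - H \<xi> - l * (w - \<xi>)) \<le> \<epsilon> * cmod (w - \<xi>)"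
  shows "((\<lambda>r. deriv H (of_real r * \<xi>)) \<longlongrightarrow> l) (at_left 1)"
proof -
  define R where "R = (\<lambda>w. H w - H \<xi> - l * (w - \<xi>))"
  have contR: "continuous_on (cball 0 1) R" unfolding R_def by (intro continuous_intros cont)
  have holR: "R holomorphic_on ball 0 1" unfolding R_def by (intro holomorphic_intros hol)
  have "compact (R ` cball 0 1)" by (intro compact_continuous_image contR compact_cball)
  then obtain M where M: "\<And>w. cmod w \<le> 1 \<Longrightarrow> cmod (R w) \<le> M"
    by (metis compact_imp_bounded bounded_iff image_eqI mem_cball_0)
  have M0: "M \<ge> 0" by (rule order_trans[OF norm_ge_zero M[of 0]]) simp
  have main: "cmod (deriv H (of_real r * \<xi>) - l) \<le> 8 * \<epsilon> + (1 - r\<^sup>2) * (64 * M / d ^ 4)"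
    if r: "0 < r" "r < 1" and e: "\<epsilon> > 0" and d: "d > 0"
      and near: "\<And>w. cmod w = 1 \<Longrightarrow> cmod (w - \<xi>) < d \<Longrightarrow> cmod (R w) \<le> \<epsilon> * cmod (w - \<xi>)" for r \<epsilon> d
  proof -
    define z where "z = of_real r * \<xi>"
    have zr: "cmod z = r" using r \<xi> by (simp add: z_def norm_mult)
    have nz: "of_real r * w - \<xi> \<noteq> 0" if "cmod w \<le> 1" for w
    proof -
      have "cmod (of_real r * w) < 1" using that r
        by (simp add: norm_mult) (meson mult_left_le norm_ge_zero le_less_trans less_imp_le)
      then show ?thesis using \<xi> by auto
    qed
    \<comment> \<open>As \<open>(w - z)^2\<close> vanishes to second order at \<open>z\<close>,
      \<open>Q\<close> and \<open>R\<close> have the same derivative there. The correcting factor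
      has its pole at \<open>\<xi> / r\<close>, outside the closed disk.\<close>
    define Q where "Q = (\<lambda>w. R w * (1 - (w - z)\<^sup>2 / (of_real r * w - \<xi>)\<^sup>2))"
    have contQ: "continuous_on (cball 0 1) Q"
      unfolding Q_def using nz by (intro continuous_intros contR) auto
    have holQ: "Q holomorphic_on ball 0 1"
      unfolding Q_def using nz by (intro holomorphic_intros holR) auto
    have zin: "z \<in> ball 0 1" using zr r by simp
    have derR: "(R has_field_derivative (deriv H z - l)) (at z)"
    proof -
      have "(H has_field_derivative deriv H z) (at z)"
        using hol zin by (meson holomorphic_derivI open_ball)
      then show ?thesis unfolding R_def by (auto intro!: derivative_eq_intros)
    qed
    have derQ: "(Q has_field_derivative (deriv H z - l)) (at z)"
      unfolding Q_def
      by (rule derivative_eq_intros derR refl | use nz[of z] zr r in \<open>simp; fail\<close>)+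
    have "contour_integral (circlepath 0 1) (\<lambda>w. Q w / (w - z)\<^sup>2) = 2 * pi * \<i> * (deriv H z - l)"
      using Cauchy_contour_integral_circlepath_2[OF contQ holQ zin] derQ DERIV_imp_deriv by metis
    then have ceq: "2 * pi * \<i> * (deriv H z - l) =
        integral {0..1} (\<lambda>x. Q (circlepath 0 1 x) / (circlepath 0 1 x - z)\<^sup>2 * vector_derivative (circlepath 0 1) (at x))"
      by (simp add: contour_integral_integral)
    \<comment> \<open>Both kernels have modulus \<open>1 / D^2\<close> on the circle, and their
      difference carries the factor \<open>(1 - r^2) * (w + \<xi>) * (w - \<xi>)\<close>. Near \<xi>
      the smallness of \<open>R\<close> gives a second factor \<open>cmod (w - \<xi>)\<close>, and
      \<open>cmod (w - \<xi>) \<le> 2 * D\<close> leaves the Poisson kernel. Away from \<xi> one has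
      \<open>D \<ge> d / 2\<close>, whence \<open>64 = 4 * 2^4\<close>.\<close>
    have ptw: "cmod (Q w / (w - z)\<^sup>2) \<le> 8 * \<epsilon> * ((1 - (cmod z)\<^sup>2) / (cmod (w - z))\<^sup>2) + (1 - r\<^sup>2) * (64 * M / d ^ 4)"
      if w: "cmod w = 1" for w
    proof -
      have wz: "w \<noteq> z" using w zr r by auto
      define D where "D = cmod (w - z)"
      have D0: "D > 0" using wz by (simp add: D_def)
      have wne: "of_real r * w - \<xi> \<noteq> 0" using nz w by simp
      have nrm: "cmod (of_real r * w - \<xi>) = D"
      proof -
        have "(cmod (of_real r * w - \<xi>))\<^sup>2 = (cmod (w - z))\<^sup>2"
        proof -
          have "complex_of_real ((cmod (of_real r * w - \<xi>))\<^sup>2) = r\<^sup>2 * (w * cnj w) - r * w * cnj \<xi> - r * \<xi> * cnj w + \<xi> * cnj \<xi>"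
            unfolding complex_norm_square by (simp add: algebra_simps power2_eq_square)
          also have "\<dots> = (w * cnj w) - r * w * cnj \<xi> - r * \<xi> * cnj w + r\<^sup>2 * (\<xi> * cnj \<xi>)"
            using w \<xi> by (simp add: complex_norm_square[symmetric])
          also have "\<dots> = complex_of_real ((cmod (w - z))\<^sup>2)"
            unfolding complex_norm_square by (simp add: z_def algebra_simps power2_eq_square)
          finally show ?thesis using of_real_eq_iff by blast
        qed
        then show ?thesis by (simp add: D_def)
      qed
      have "Q w / (w - z)\<^sup>2 = R w * (((of_real r * w - \<xi>)\<^sup>2 - (w - z)\<^sup>2) / ((w - z)\<^sup>2 * (of_real r * w - \<xi>)\<^sup>2))"
        using wz wne by (simp add: Q_def field_simps)
      also have "(of_real r * w - \<xi>)\<^sup>2 - (w - z)\<^sup>2 = of_real (r\<^sup>2 - 1) * ((w + \<xi>) * (w - \<xi>))"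
        by (simp add: z_def power2_eq_square algebra_simps)
      finally have "cmod (Q w / (w - z)\<^sup>2) = cmod (R w) * (\<bar>r\<^sup>2 - 1\<bar> * (cmod (w + \<xi>) * cmod (w - \<xi>)) / (D\<^sup>2 * D\<^sup>2))"
        by (simp only: norm_mult norm_divide norm_power nrm D_def[symmetric] norm_of_real)
      also have "\<bar>r\<^sup>2 - 1\<bar> = 1 - r\<^sup>2" using r by (simp add: abs_square_le_1)
      finally have n1: "cmod (Q w / (w - z)\<^sup>2) = cmod (R w) * ((1 - r\<^sup>2) * (cmod (w + \<xi>) * cmod (w - \<xi>)) / (D\<^sup>2 * D\<^sup>2))" .
      have r2: "1 - r\<^sup>2 > 0" using r by (simp add: power_less_one_iff abs_square_less_1)
      have c1: "cmod (w + \<xi>) \<le> 2" using norm_triangle_ineq[of w \<xi>] w \<xi> by simp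
      have c2: "cmod (w - \<xi>) \<le> 2 * D"
      proof -
        have "cmod (w - \<xi>) \<le> cmod (w - z) + cmod (z - \<xi>)" by (metis diff_add_cancel add_diff_eq norm_triangle_ineq)
        moreover have "cmod (z - \<xi>) = 1 - r"
        proof -
          have "z - \<xi> = of_real (r - 1) * \<xi>" by (simp add: z_def algebra_simps)
          then have "cmod (z - \<xi>) = \<bar>r - 1\<bar> * cmod \<xi>" by (simp only: norm_mult norm_of_real)
          then show ?thesis using \<xi> r by simp
        qed
        moreover have "1 - r \<le> D" using norm_triangle_ineq2[of w z] w zr by (simp add: D_def)
        ultimately show ?thesis by (simp add: D_def)
      qed
      have n2: "cmod (Q w / (w - z)\<^sup>2) \<le> cmod (R w) * ((1 - r\<^sup>2) * (2 * cmod (w - \<xi>)) / (D\<^sup>2 * D\<^sup>2))"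
        unfolding n1 using r2 c1 D0 by (intro mult_left_mono divide_right_mono mult_right_mono) auto
      show ?thesis
      proof (cases "cmod (w - \<xi>) < d")
        case True
        have "cmod (R w) * ((1 - r\<^sup>2) * (2 * cmod (w - \<xi>)) / (D\<^sup>2 * D\<^sup>2)) \<le>
              (\<epsilon> * cmod (w - \<xi>)) * ((1 - r\<^sup>2) * (2 * cmod (w - \<xi>)) / (D\<^sup>2 * D\<^sup>2))"
          using near[OF w True] r2 D0 by (intro mult_right_mono) auto
        also have "\<dots> = 2 * \<epsilon> * (1 - r\<^sup>2) / (D\<^sup>2 * D\<^sup>2) * (cmod (w - \<xi>))\<^sup>2"
          by (simp add: power2_eq_square)
        also have "\<dots> \<le> 2 * \<epsilon> * (1 - r\<^sup>2) / (D\<^sup>2 * D\<^sup>2) * (2 * D)\<^sup>2"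
          using c2 r2 e D0 by (intro mult_left_mono power_mono) auto
        also have "\<dots> = 8 * \<epsilon> * ((1 - (cmod z)\<^sup>2) / (cmod (w - z))\<^sup>2)"
          using D0 zr by (simp add: D_def[symmetric] field_simps power2_eq_square)
        finally show ?thesis using n2 r2 M0 d
          by (smt (verit) divide_nonneg_nonneg mult_nonneg_nonneg zero_le_power)
      next
        case False
        then have dD: "d / 2 \<le> D" using c2 by simp
        have "cmod (w - \<xi>) \<le> 2" using norm_triangle_ineq4[of w \<xi>] w \<xi> by simp
        then have "cmod (R w) * ((1 - r\<^sup>2) * (2 * cmod (w - \<xi>)) / (D\<^sup>2 * D\<^sup>2)) \<le> M * ((1 - r\<^sup>2) * (2 * 2) / ((d/2)\<^sup>2 * (d/2)\<^sup>2))"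
          using M[of w] w r2 d dD M0
          by (intro mult_mono frac_le mult_left_mono power_mono) auto
        also have "\<dots> = (1 - r\<^sup>2) * (64 * M / d ^ 4)"
          using d by (simp add: field_simps power2_eq_square eval_nat_numeral)
        finally show ?thesis using n2 r2 e zr r
          by (smt (verit) divide_nonneg_nonneg mult_nonneg_nonneg zero_le_power2)
      qed
    qed
    define B where "B = (\<lambda>x. 2 * pi * (8 * \<epsilon> * ((1 - (cmod z)\<^sup>2) / (cmod (circlepath 0 1 x - z))\<^sup>2) + (1 - r\<^sup>2) * (64 * M / d ^ 4)))"
    have Bint: "(B has_integral (2 * pi * (8 * \<epsilon> * 1 + (1 - 0) * ((1 - r\<^sup>2) * (64 * M / d ^ 4))))) {0..1}"
      unfolding B_def
      apply (intro has_integral_mult_right has_integral_add has_integral_Poisson_kernel_circlepath)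
      subgoal using zr r by simp
      subgoal using has_integral_const_real[of "(1 - r\<^sup>2) * (64 * M / d ^ 4)" 0 1] by simp
      done
    have "cmod (2 * pi * \<i> * (deriv H z - l)) \<le> integral {0..1} B"
      unfolding ceq
    proof (rule integral_norm_bound_integral)
      have "(\<lambda>w. Q w / (w - z)\<^sup>2) contour_integrable_on circlepath 0 1"
        using zr r by (intro contour_integrable_continuous_circlepath continuous_intros continuous_on_subset[OF contQ]) auto
      then show "(\<lambda>x. Q (circlepath 0 1 x) / (circlepath 0 1 x - z)\<^sup>2 * vector_derivative (circlepath 0 1) (at x)) integrable_on {0..1}"
        unfolding contour_integrable_on .
      show "B integrable_on {0..1}" using Bint by blast
      fix x :: real assume x: "x \<in> {0..1}"
      have vd: "vector_derivative (circlepath 0 1) (at x) = 2 * pi * \<i> * circlepath 0 1 x"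
        using x by (subst vector_derivative_circlepath) (auto simp: circlepath_def part_circlepath_def linepath_def mult_ac)
      have c1: "cmod (circlepath 0 1 x) = 1"
        by (simp add: circlepath_def part_circlepath_def)
      show "cmod (Q (circlepath 0 1 x) / (circlepath 0 1 x - z)\<^sup>2 * vector_derivative (circlepath 0 1) (at x)) \<le> B x"
        unfolding vd norm_mult c1 B_def using ptw[OF c1] by (simp add: norm_mult)
    qed
    also have "integral {0..1} B = 2 * pi * (8 * \<epsilon> + (1 - r\<^sup>2) * (64 * M / d ^ 4))"
      using Bint by (simp add: integral_unique)
    finally show ?thesis by (simp add: norm_mult z_def)
  qed
  show ?thesis
  proof (rule tendstoI)
    fix e :: real assume "e > 0"
    define \<epsilon> where "\<epsilon> = e / 32"
    have e0: "\<epsilon> > 0" using \<open>e > 0\<close> by (simp add: \<epsilon>_def)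
    obtain d where d: "d > 0" "\<And>w. cmod w = 1 \<Longrightarrow> cmod (w - \<xi>) < d \<Longrightarrow> cmod (R w) \<le> \<epsilon> * cmod (w - \<xi>)"
      using tan[OF e0] unfolding R_def by blast
    have "((\<lambda>r. 8 * \<epsilon> + (1 - r\<^sup>2) * (64 * M / d ^ 4)) \<longlongrightarrow> 8 * \<epsilon> + (1 - 1\<^sup>2) * (64 * M / d ^ 4)) (at_left (1::real))"
      by (intro tendsto_intros)
    then have "eventually (\<lambda>r. 8 * \<epsilon> + (1 - r\<^sup>2) * (64 * M / d ^ 4) < e) (at_left (1::real))"
      by (rule order_tendstoD) (use \<open>e > 0\<close> in \<open>simp add: \<epsilon>_def\<close>)
    moreover have "eventually (\<lambda>r. 0 < r \<and> r < 1) (at_left (1::real))"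
      by (rule eventually_at_leftI[of 0]) auto
    ultimately show "eventually (\<lambda>r. dist (deriv H (of_real r * \<xi>)) l < e) (at_left (1::real))"
    proof eventually_elim
      case (elim r)
      then show ?case using main[of r \<epsilon> d] e0 d by (auto simp: dist_norm)
    qed
  qed
qed

section \<open>Parseval's identity on circles and square summable Taylor coefficients\<close>

lemma has_integral_cis_int:
  "((\<lambda>t. cis (of_int k * t)) has_integral (if k = 0 then 2 * pi else 0)) {0..2*pi}"
proof (cases "k = 0")
  case True
  then show ?thesis using has_integral_const_real[of "1::complex" 0 "2*pi"] by (simp add: scaleR_conv_of_real)
next
  case False
  have "((\<lambda>t. cis (of_int k * t)) has_integral cis (of_int k * (2*pi)) / (\<i> * of_int k) - cis (of_int k * 0) / (\<i> * of_int k)) {0..2*pi}"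
  proof (rule fundamental_theorem_of_calculus)
    fix t :: real
    show "((\<lambda>t. cis (of_int k * t) / (\<i> * of_int k)) has_vector_derivative cis (of_int k * t)) (at t within {0..2*pi})"
    proof -
      have "((\<lambda>z. exp (\<i> * of_int k * z) / (\<i> * of_int k)) has_field_derivative exp (\<i> * of_int k * of_real t)) (at (of_real t))"
        using False by (auto intro!: derivative_eq_intros)
      from has_vector_derivative_real_field[OF this] show ?thesis
        by (simp add: cis_conv_exp mult.assoc)
    qed
  qed simp
  moreover have "cis (of_int k * (2*pi)) = 1"
    using cis_multiple_2pi[of "of_int k"] by (simp add: mult_ac)
  ultimately show ?thesis using False by simp
qed

text \<open>When the square is expanded, orthogonality of the functions \<open>cis (n * t)\<close>
  leaves only the diagonal terms.\<close>

lemma has_integral_norm_trig_sum: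
  fixes c :: "nat \<Rightarrow> complex"
  assumes "finite A"
  shows "((\<lambda>t. (cmod (\<Sum>n\<in>A. c n * cis (real n * t)))\<^sup>2) has_integral 2 * pi * (\<Sum>n\<in>A. (cmod (c n))\<^sup>2)) {0..2*pi}"
proof -
  have eq: "complex_of_real ((cmod (\<Sum>n\<in>A. c n * cis (real n * t)))\<^sup>2) =
     (\<Sum>n\<in>A. \<Sum>m\<in>A. (c n * cnj (c m)) * cis (of_int (int n - int m) * t))" for t
    unfolding complex_norm_square cnj_sum sum_product
    by (intro sum.cong refl) (simp add: cis_cnj cis_mult algebra_simps)
  have hi: "((\<lambda>t. (\<Sum>n\<in>A. \<Sum>m\<in>A. (c n * cnj (c m)) * cis (of_int (int n - int m) * t))) has_integral
      (\<Sum>n\<in>A. \<Sum>m\<in>A. (c n * cnj (c m)) * (if int n - int m = 0 then 2 * pi else 0))) {0..2*pi}"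
    by (intro has_integral_sum has_integral_mult_right has_integral_cis_int assms)
  have "(\<Sum>n\<in>A. \<Sum>m\<in>A. (c n * cnj (c m)) * (if int n - int m = 0 then 2 * pi else 0)) =
        (\<Sum>n\<in>A. \<Sum>m\<in>A. if m = n then of_real (2 * pi * (cmod (c n))\<^sup>2) else 0)"
    by (intro sum.cong refl) (auto simp: complex_norm_square[symmetric] simp del: of_real_power)
  also have "\<dots> = of_real (2 * pi * (\<Sum>n\<in>A. (cmod (c n))\<^sup>2))"
    using assms by (simp add: sum_distrib_left)
  finally have "((\<lambda>t. complex_of_real ((cmod (\<Sum>n\<in>A. c n * cis (real n * t)))\<^sup>2)) has_integral of_real (2 * pi * (\<Sum>n\<in>A. (cmod (c n))\<^sup>2))) {0..2*pi}"
    using hi unfolding eq by simp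
  from has_integral_linear[OF this bounded_linear_Re] show ?thesis
    by (simp add: o_def)
qed

text \<open>On a fixed circle the power series converges uniformly, so the square integrals of its
  partial sums converge to that of \<open>F\<close>, and from \<open>N\<close> on they dominate the
  first \<open>N\<close> terms. The limit \<open>r \<longrightarrow> 1\<close> is taken only in a
  finite sum.\<close>

lemma power_series_coeff_square_sum_le:
  fixes F :: "complex \<Rightarrow> complex"
  assumes F: "\<And>z. cmod z < 1 \<Longrightarrow> (\<lambda>n. a n * z ^ n) sums F z"
    and bound: "\<And>r. 0 < r \<Longrightarrow> r < 1 \<Longrightarrow> integral {0..2*pi} (\<lambda>t. (cmod (F (rcis r t)))\<^sup>2) \<le> C"
    and intF: "\<And>r. 0 < r \<Longrightarrow> r < 1 \<Longrightarrow> continuous_on {0..2*pi} (\<lambda>t. F (rcis r t))"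
  shows "(\<Sum>n<N. (cmod (a n))\<^sup>2) \<le> C / (2 * pi)"
proof -
  have le: "(\<Sum>n<N. (cmod (a n * of_real r ^ n))\<^sup>2) \<le> C / (2 * pi)" if r: "0 < r" "r < 1" for r :: real
  proof -
    define c where "c = (\<lambda>n. a n * of_real r ^ n)"
    define S where "S = (\<lambda>m t. \<Sum>n<m. c n * cis (real n * t))"
    have c_rcis: "c n * cis (real n * t) = a n * rcis r t ^ n" for n t
      by (simp add: c_def rcis_def power_mult_distrib Complex.DeMoivre)
    have sc: "summable (\<lambda>n. cmod (c n))"
    proof -
      have "summable (\<lambda>n. cmod (a n * of_real r ^ n))"
      proof (rule powser_insidea)
        show "summable (\<lambda>n. a n * of_real ((r + 1) / 2) ^ n)"
          using F[of "of_real ((r+1)/2)"] r by (auto simp: sums_iff)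
        show "cmod (of_real r) < cmod (of_real ((r + 1) / 2))" using r by simp
      qed
      then show ?thesis by (simp add: c_def)
    qed
    have "uniform_limit {0..2*pi} S (\<lambda>t. F (rcis r t)) sequentially"
    proof -
      have "uniform_limit {0..2*pi} (\<lambda>m t. \<Sum>n<m. c n * cis (real n * t)) (\<lambda>t. \<Sum>n. c n * cis (real n * t)) sequentially"
        by (rule Weierstrass_m_test[OF _ sc]) (simp add: norm_mult)
      moreover have "(\<Sum>n. c n * cis (real n * t)) = F (rcis r t)" for t
        using F[of "rcis r t"] r unfolding c_rcis by (simp add: sums_iff)
      ultimately show ?thesis by (simp add: S_def)
    qed
    then have ul: "uniform_limit {0..2*pi} (\<lambda>m t. (cmod (S m t))\<^sup>2) (\<lambda>t. (cmod (F (rcis r t)))\<^sup>2) sequentially"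
    proof -
      assume ul: "uniform_limit {0..2*pi} S (\<lambda>t. F (rcis r t)) sequentially"
      have bF: "bounded ((\<lambda>t. F (rcis r t)) ` {0..2*pi})"
        using intF[OF r] by (intro compact_imp_bounded compact_continuous_image) auto
      have "uniform_limit {0..2*pi} (\<lambda>m t. cmod (S m t)) (\<lambda>t. cmod (F (rcis r t))) sequentially"
        using ul by (rule uniform_limit_norm)
      moreover have "bounded ((\<lambda>t. cmod (F (rcis r t))) ` {0..2*pi})"
        using bF by (auto simp: bounded_iff)
      ultimately show ?thesis
        unfolding power2_eq_square by (intro uniform_lim_mult) auto
    qed
    have lim: "(\<lambda>m. integral {0..2*pi} (\<lambda>t. (cmod (S m t))\<^sup>2)) \<longlonglongrightarrow> integral {0..2*pi} (\<lambda>t. (cmod (F (rcis r t)))\<^sup>2)"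
    proof -
      have "continuous_on (cbox 0 (2*pi)) (\<lambda>t. (cmod (S m t))\<^sup>2)" for m
        unfolding S_def by (intro continuous_intros)
      then obtain I J where
        I: "\<And>m. ((\<lambda>t. (cmod (S m t))\<^sup>2) has_integral I m) (cbox 0 (2*pi))" and
        J: "((\<lambda>t. (cmod (F (rcis r t)))\<^sup>2) has_integral J) (cbox 0 (2*pi))" and IJ: "I \<longlonglongrightarrow> J"
        using uniform_limit_integral_cbox[OF ul[folded cbox_interval]] by (metis sequentially_bot)
      have "I = (\<lambda>m. integral (cbox 0 (2*pi)) (\<lambda>t. (cmod (S m t))\<^sup>2))"
        using integral_unique[OF I] by (intro ext) simp
      then show ?thesis
        using IJ integral_unique[OF J] by (simp add: cbox_interval)
    qed
    have "2 * pi * (\<Sum>n<N. (cmod (c n))\<^sup>2) \<le> integral {0..2*pi} (\<lambda>t. (cmod (F (rcis r t)))\<^sup>2)"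
    proof (rule tendsto_lowerbound[OF lim])
      show "eventually (\<lambda>m. 2 * pi * (\<Sum>n<N. (cmod (c n))\<^sup>2) \<le> integral {0..2*pi} (\<lambda>t. (cmod (S m t))\<^sup>2)) sequentially"
      proof (rule eventually_sequentiallyI[of N])
        fix m assume "N \<le> m"
        then have "(\<Sum>n<N. (cmod (c n))\<^sup>2) \<le> (\<Sum>n<m. (cmod (c n))\<^sup>2)" by (intro sum_mono2) auto
        then show "2 * pi * (\<Sum>n<N. (cmod (c n))\<^sup>2) \<le> integral {0..2*pi} (\<lambda>t. (cmod (S m t))\<^sup>2)"
          using integral_unique[OF has_integral_norm_trig_sum[of "{..<m}" c]] by (simp add: S_def)
      qed
    qed simp
    with bound[OF r] show ?thesis by (simp add: c_def field_simps)
  qed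
  have "((\<lambda>r. \<Sum>n<N. (cmod (a n * of_real r ^ n))\<^sup>2) \<longlongrightarrow> (\<Sum>n<N. (cmod (a n * of_real 1 ^ n))\<^sup>2)) (at_left (1::real))"
    by (intro tendsto_intros)
  moreover have "eventually (\<lambda>r. (\<Sum>n<N. (cmod (a n * of_real r ^ n))\<^sup>2) \<le> C / (2 * pi)) (at_left (1::real))"
    by (rule eventually_at_leftI[of 0]) (use le in auto)
  ultimately have "(\<Sum>n<N. (cmod (a n * of_real 1 ^ n))\<^sup>2) \<le> C / (2 * pi)"
    by (rule tendsto_upperbound) simp
  then show ?thesis by simp
qed

section \<open>Almost everywhere differentiation of indefinite integrals\<close>

lemma has_vector_derivative_cis: "(cis has_vector_derivative \<i> * cis t) (at t)"
proof -
  have "((\<lambda>z. exp (\<i> * z)) has_field_derivative \<i> * exp (\<i> * of_real t)) (at (of_real t))"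
    by (auto intro!: derivative_eq_intros)
  from has_vector_derivative_real_field[OF this] show ?thesis by (simp add: cis_conv_exp[abs_def])
qed

lemma has_vector_derivative_two_sided_limit:
  fixes h :: "real \<Rightarrow> 'a::real_normed_vector"
  assumes "\<And>e. e > 0 \<Longrightarrow> \<exists>d>0. \<forall>s. 0 < s \<and> s < d \<longrightarrow> norm (h (t + s) - h t - s *\<^sub>R v) \<le> e * s"
    and "\<And>e. e > 0 \<Longrightarrow> \<exists>d>0. \<forall>s. 0 < s \<and> s < d \<longrightarrow> norm (h t - h (t - s) - s *\<^sub>R v) \<le> e * s"
  shows "(h has_vector_derivative v) (at t)"
  unfolding has_vector_derivative_def has_derivative_at_alt
proof (intro conjI allI impI bounded_linear_scaleR_left)
  fix e :: real assume e: "e > 0"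
  obtain d1 where d1: "d1 > 0" "\<And>s. 0 < s \<Longrightarrow> s < d1 \<Longrightarrow> norm (h (t + s) - h t - s *\<^sub>R v) \<le> e * s"
    using assms(1)[OF e] by blast
  obtain d2 where d2: "d2 > 0" "\<And>s. 0 < s \<Longrightarrow> s < d2 \<Longrightarrow> norm (h t - h (t - s) - s *\<^sub>R v) \<le> e * s"
    using assms(2)[OF e] by blast
  have "norm (h y - h t - (y - t) *\<^sub>R v) \<le> e * norm (y - t)" if y: "norm (y - t) < min d1 d2" for y
  proof -
    consider "y = t" | "y > t" | "y < t" by linarith
    then show ?thesis
    proof cases
      case 1 then show ?thesis by simp
    next
      case 2
      then show ?thesis using d1(2)[of "y - t"] y by simp
    next
      case 3
      have "norm (h y - h t - (y - t) *\<^sub>R v) = norm (h t - h y - (t - y) *\<^sub>R v)"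
        by (subst norm_minus_cancel[symmetric]) (simp add: algebra_simps)
      then show ?thesis using d2(2)[of "t - y"] y 3 by simp
    qed
  qed
  then show "\<exists>d>0. \<forall>y. norm (y - t) < d \<longrightarrow> norm (h y - h t - (y - t) *\<^sub>R v) \<le> e * norm (y - t)"
    using d1(1) d2(1) by (intro exI[of _ "min d1 d2"]) auto
qed

text \<open>Lebesgue's differentiation theorem in the form
  \<open>integrable_ccontinuous_explicit\<close> averages over intervals to the right of a point.
  Averages to the left come from applying it to the reflected function
  \<open>u (- x)\<close>.\<close>

lemma indefinite_integral_has_vector_derivative_AE:
  fixes u h :: "real \<Rightarrow> complex"
  assumes int: "\<And>a b. u integrable_on {a..b}"
    and h: "\<And>a b. A \<le> a \<Longrightarrow> a \<le> b \<Longrightarrow> b \<le> B \<Longrightarrow> h b - h a = integral {a..b} u"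
  shows "AE t in lborel. A < t \<and> t < B \<longrightarrow> (h has_vector_derivative u t) (at t)"
proof -
  obtain N1 where N1: "negligible N1" and
    l1: "\<And>x e. x \<notin> N1 \<Longrightarrow> 0 < e \<Longrightarrow> \<exists>d>0. \<forall>s. 0 < s \<and> s < d \<longrightarrow> norm (integral (cbox x (x + s *\<^sub>R One)) u /\<^sub>R s ^ DIM(real) - u x) < e"
    using integrable_ccontinuous_explicit[where f=u] int by (metis cbox_interval)
  have int': "(\<lambda>x. u (- x)) integrable_on {a..b}" for a b
    using int[of "-b" "-a"] Henstock_Kurzweil_Integration.integrable_reflect_real[where f=u and a="-b" and b="-a"] by (simp only: minus_minus)
  obtain N2 where N2: "negligible N2" and
    l2: "\<And>x e. x \<notin> N2 \<Longrightarrow> 0 < e \<Longrightarrow> \<exists>d>0. \<forall>s. 0 < s \<and> s < d \<longrightarrow> norm (integral (cbox x (x + s *\<^sub>R One)) (\<lambda>x. u (-x)) /\<^sub>R s ^ DIM(real) - u (-x)) < e"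
    using integrable_ccontinuous_explicit[where f="\<lambda>x. u (-x)"] int' by (metis cbox_interval)
  have scal: "norm (X - s *\<^sub>R v) \<le> e * s" if "norm (X /\<^sub>R s - v) < e" "s > 0" for X v :: complex and s e :: real
  proof -
    have "X - s *\<^sub>R v = s *\<^sub>R (X /\<^sub>R s - v)" using that by (simp add: scaleR_diff_right)
    then have "norm (X - s *\<^sub>R v) = s * norm (X /\<^sub>R s - v)" using that by simp
    then show ?thesis using that by (simp add: mult.commute[of e])
  qed
  have der: "(h has_vector_derivative u t) (at t)" if t: "A < t" "t < B" "t \<notin> N1" "-t \<notin> N2" for t
  proof (rule has_vector_derivative_two_sided_limit)
    fix e :: real assume e: "e > 0"
    obtain d where d: "d > 0" "\<And>s. 0 < s \<Longrightarrow> s < d \<Longrightarrow> norm (integral {t..t+s} u /\<^sub>R s - u t) < e"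
      using l1[OF t(3) e] by (auto simp: cbox_interval)
    show "\<exists>d>0. \<forall>s. 0 < s \<and> s < d \<longrightarrow> norm (h (t + s) - h t - s *\<^sub>R u t) \<le> e * s"
    proof (intro exI[of _ "min d (B - t)"] conjI allI impI)
      fix s assume s: "0 < s \<and> s < min d (B - t)"
      have "h (t + s) - h t = integral {t..t+s} u" using s t by (intro h) auto
      then show "norm (h (t + s) - h t - s *\<^sub>R u t) \<le> e * s" using d(2)[of s] s scal by simp
    qed (use d t in auto)
  next
    fix e :: real assume e: "e > 0"
    obtain d where d: "d > 0" "\<And>s. 0 < s \<Longrightarrow> s < d \<Longrightarrow> norm (integral {-t..-t+s} (\<lambda>x. u (-x)) /\<^sub>R s - u t) < e"
      using l2[OF t(4) e] by (auto simp: cbox_interval)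
    show "\<exists>d>0. \<forall>s. 0 < s \<and> s < d \<longrightarrow> norm (h t - h (t - s) - s *\<^sub>R u t) \<le> e * s"
    proof (intro exI[of _ "min d (t - A)"] conjI allI impI)
      fix s assume s: "0 < s \<and> s < min d (t - A)"
      have "h t - h (t - s) = integral {t-s..t} u" using s t by (intro h) auto
      also have "\<dots> = integral {-t..-t+s} (\<lambda>x. u (-x))"
        using Henstock_Kurzweil_Integration.integral_reflect_real[where f=u and a="t - s" and b=t] by simp
      finally show "norm (h t - h (t - s) - s *\<^sub>R u t) \<le> e * s" using d(2)[of s] s scal by simp
    qed (use d t in auto)
  qed
  have "negligible (N1 \<union> uminus ` N2)"
    using N1 N2
    by (intro negligible_Un negligible_differentiable_image_negligible) (auto intro!: derivative_intros)
  then have "AE t in lebesgue. t \<notin> N1 \<union> uminus ` N2"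
    unfolding negligible_iff_null_sets by (rule AE_not_in)
  then have "AE t in lborel. t \<notin> N1 \<union> uminus ` N2" by (simp add: AE_completion_iff)
  then show ?thesis
    by (rule eventually_mono) (use der in force)
qed

lemma has_vector_derivative_imp_le:
  assumes "(h has_vector_derivative v) (at t)" and "e > 0"
  shows "\<exists>d>0. \<forall>s. \<bar>s - t\<bar> < d \<longrightarrow> norm (h s - h t - (s - t) *\<^sub>R v) \<le> e * \<bar>s - t\<bar>"
proof -
  have "\<forall>e>0. \<exists>d>0. \<forall>s. norm (s - t) < d \<longrightarrow> norm (h s - h t - (s - t) *\<^sub>R v) \<le> e * norm (s - t)"
    using assms(1) unfolding has_vector_derivative_def has_derivative_at_alt by (rule conjunct2)
  then show ?thesis using assms(2) by simp
qed

text \<open>The antiderivative \<open>H\<close> of an \<open>H\<^sup>2\<close> function \<open>F\<close> is continuous on the closed disk and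
  absolutely continuous on the circle (a subsequence of the partial sums of \<open>F\<close> converges in \<open>L\<^sup>1\<close>),
  hence tangentially differentiable almost everywhere.\<close>

lemma H2_radial_limits_AE:
  fixes F :: "complex \<Rightarrow> complex"
  assumes hol: "F holomorphic_on ball 0 1"
    and bound: "\<And>r. 0 < r \<Longrightarrow> r < 1 \<Longrightarrow> integral {0..2*pi} (\<lambda>t. (cmod (F (rcis r t)))\<^sup>2) \<le> C"
  shows "AE t in lborel. t \<in> {0..2*pi} \<longrightarrow> (\<exists>l. ((\<lambda>r. F (of_real r * cis t)) \<longlongrightarrow> l) (at_left 1))"
proof -
  define a where "a = (\<lambda>n. (deriv ^^ n) F 0 / fact n)"
  have Fs: "(\<lambda>n. a n * z ^ n) sums F z" if "cmod z < 1" for z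
    using holomorphic_power_series[OF hol, of z] that by (simp add: a_def)
  have contF: "continuous_on {0..2*pi} (\<lambda>t. F (rcis r t))" if "0 < r" "r < 1" for r
    by (rule continuous_on_compose2[OF holomorphic_on_imp_continuous_on[OF hol]])
       (use that in \<open>auto simp: rcis_def norm_mult intro!: continuous_intros\<close>)
  have coeff: "(\<Sum>n<N. (cmod (a n))\<^sup>2) \<le> C / (2 * pi)" for N
    by (rule power_series_coeff_square_sum_le[OF Fs bound contF])
  have sum2: "summable (\<lambda>n. (cmod (a n))\<^sup>2)"
    by (rule summableI_nonneg_bounded[OF _ coeff]) simp
  define c where "c = (\<lambda>n. if n = 0 then 0 else a (n - 1) / of_nat n)"
  \<comment> \<open>From \<open>2 * x * y \<le> x^2 + y^2\<close> with
    \<open>y = 1 / (n + 1)\<close>. Absolute summability makes the antiderivative \<open>H\<close>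
    continuous up to the circle.\<close>
  have csum: "summable (\<lambda>n. cmod (c n))"
  proof -
    have "summable (\<lambda>n. 1 / real (Suc n) ^ 2)"
      using inverse_squares_sums by (simp add: sums_iff add.commute)
    then have "summable (\<lambda>n. ((cmod (a n))\<^sup>2 + 1 / real (Suc n) ^ 2) / 2)"
      by (intro summable_divide summable_add sum2)
    then have "summable (\<lambda>n. cmod (c (Suc n)))"
    proof (rule summable_comparison_test'[of _ 0])
      fix n :: nat
      have "2 * (cmod (a n) * (1 / real (Suc n))) \<le> (cmod (a n))\<^sup>2 + (1 / real (Suc n))\<^sup>2"
        using sum_squares_bound[of "cmod (a n)" "1 / real (Suc n)"] by (simp only: mult.assoc)
      then show "norm (cmod (c (Suc n))) \<le> ((cmod (a n))\<^sup>2 + 1 / real (Suc n) ^ 2) / 2"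
        by (simp add: c_def norm_divide power_divide mult_ac del: of_nat_Suc)
    qed
    then show ?thesis by (subst summable_Suc_iff[symmetric])
  qed
  define H where "H = (\<lambda>z. \<Sum>n. c n * z ^ n)"
  have Hsums: "(\<lambda>n. c n * z ^ n) sums H z" if "cmod z \<le> 1" for z
  proof -
    have "summable (\<lambda>n. c n * z ^ n)"
    proof (rule summable_comparison_test'[OF csum, of 0])
      fix n show "cmod (c n * z ^ n) \<le> cmod (c n)"
        using that by (simp add: norm_mult norm_power mult_left_le power_le_one)
    qed
    then show ?thesis by (simp add: H_def summable_sums)
  qed
  have contH: "continuous_on (cball 0 1) H"
  proof -
    have "uniform_limit (cball 0 1) (\<lambda>m z. \<Sum>n<m. c n * z ^ n) H sequentially"
      unfolding H_def
    proof (rule Weierstrass_m_test[OF _ csum])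
      fix n and z :: complex assume "z \<in> cball 0 1"
      then show "cmod (c n * z ^ n) \<le> cmod (c n)"
        by (simp add: norm_mult norm_power mult_left_le power_le_one)
    qed
    then show ?thesis
      by (rule uniform_limit_theorem[rotated]) (auto intro!: always_eventually continuous_intros)
  qed
  have derH: "(H has_field_derivative F z) (at z)" if "cmod z < 1" for z
  proof -
    have "DERIV (\<lambda>x. \<Sum>n. c n * x ^ n) z :> (\<Sum>n. diffs c n * z ^ n)"
    proof (rule termdiffs_strong[of _ 1])
      show "summable (\<lambda>n. c n * 1 ^ n)" using csum by (simp add: summable_norm_cancel)
    qed (use that in simp)
    moreover have "diffs c n = a n" for n
      by (simp add: diffs_def c_def del: of_nat_Suc)
    ultimately show ?thesis
      using Fs[OF that] by (simp add: H_def[symmetric] sums_iff)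
  qed
  have holH: "H holomorphic_on ball 0 1"
    unfolding holomorphic_on_open[OF open_ball]
  proof
    fix x :: complex assume "x \<in> ball 0 1"
    then show "\<exists>f'. (H has_field_derivative f') (at x)" using derH[of x] by auto
  qed
  have dH: "deriv H z = F z" if "cmod z < 1" for z
    using derH[OF that] by (rule DERIV_imp_deriv)
  define T where "T = (\<lambda>N t. \<Sum>n<N. a n * cis (real n * t))"
  \<comment> \<open>The derivative of \<open>H (cis t)\<close> is formally
    \<open>\<i> * cis t * F (cis t)\<close>. Its truncation to \<open>N\<close> terms has as exact
    primitive the partial sum of \<open>H\<close> with \<open>Suc N\<close> terms, since integration
    shifts the index by one.\<close>
  define V where "V = (\<lambda>N t. \<i> * cis t * T N t)"
  have contV: "continuous_on A (V N)" for A N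
    unfolding V_def T_def by (intro continuous_intros)
  have intV: "integral {x..y} (V N) = (\<Sum>n<Suc N. c n * cis y ^ n) - (\<Sum>n<Suc N. c n * cis x ^ n)" if "x \<le> y" for x y N
  proof (rule integral_unique, rule fundamental_theorem_of_calculus[OF that])
    fix t
    have *: "((\<lambda>z. \<Sum>n<Suc N. c n * (exp (\<i> * z)) ^ n) has_field_derivative V N t) (at (of_real t))"
    proof -
      have "((\<lambda>z. \<Sum>n<Suc N. c n * (exp (\<i> * z)) ^ n) has_field_derivative
          (\<Sum>n<Suc N. c n * (of_nat n * exp (\<i> * of_real t) ^ (n - 1) * (exp (\<i> * of_real t) * \<i>)))) (at (of_real t))"
        by (auto intro!: derivative_eq_intros sum.cong)
      also have "(\<Sum>n<Suc N. c n * (of_nat n * exp (\<i> * of_real t) ^ (n - 1) * (exp (\<i> * of_real t) * \<i>))) =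
                 (\<Sum>n<N. c (Suc n) * (of_nat (Suc n) * exp (\<i> * of_real t) ^ n * (exp (\<i> * of_real t) * \<i>)))"
        by (subst sum.lessThan_Suc_shift) simp
      also have "\<dots> = V N t"
        unfolding V_def T_def sum_distrib_left
        by (intro sum.cong refl) (simp add: c_def Complex.DeMoivre[symmetric] cis_conv_exp[symmetric] del: of_nat_Suc)
      finally show ?thesis .
    qed
    show "((\<lambda>x. \<Sum>n<Suc N. c n * cis x ^ n) has_vector_derivative V N t) (at t within {x..y})"
      using has_vector_derivative_real_field[OF *] by (simp add: cis_conv_exp)
  qed
  \<comment> \<open>Blocks of coefficients with square sum at most \<open>4^(-j)\<close> give
    \<open>L^1\<close> norms of order \<open>2^(-j)\<close>, a summable sequence.\<close>
  have "\<exists>N. \<forall>m\<ge>N. \<forall>n\<ge>m. (\<Sum>i\<in>{m..<n}. (cmod (a i))\<^sup>2) \<le> (1/4) ^ j" for j :: nat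
  proof -
    obtain N where N: "\<And>m n. m \<ge> N \<Longrightarrow> norm (\<Sum>i\<in>{m..<n}. (cmod (a i))\<^sup>2) < (1/4) ^ j"
      using sum2 unfolding summable_Cauchy by (metis zero_less_divide_1_iff zero_less_numeral zero_less_power)
    have "(\<Sum>i\<in>{m..<n}. (cmod (a i))\<^sup>2) \<le> (1/4) ^ j" if "m \<ge> N" for m n
    proof -
      have "(\<Sum>i\<in>{m..<n}. (cmod (a i))\<^sup>2) \<le> norm (\<Sum>i\<in>{m..<n}. (cmod (a i))\<^sup>2)"
        unfolding real_norm_def by (rule abs_ge_self)
      also have "\<dots> < (1/4) ^ j" by (rule N[OF that])
      finally show ?thesis by simp
    qed
    then show ?thesis by blast
  qed
  then obtain M where M: "\<And>j m n. M j \<le> m \<Longrightarrow> m \<le> n \<Longrightarrow> (\<Sum>i\<in>{m..<n}. (cmod (a i))\<^sup>2) \<le> (1/4) ^ j"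
    by metis
  \<comment> \<open>Summation makes \<open>N\<close> monotone, at least \<open>M j\<close>, and
    divergent, all at once.\<close>
  define N where "N = (\<lambda>j. \<Sum>i\<le>j. Suc (M i))"
  have NM: "M j \<le> N j" for j
  proof -
    have "Suc (M j) \<le> N j" unfolding N_def by (rule member_le_sum) auto
    then show ?thesis by simp
  qed
  have Nmono: "N j \<le> N (Suc j)" for j by (simp add: N_def)
  have Nlim: "filterlim N at_top sequentially"
  proof (rule filterlim_at_top_mono[OF filterlim_ident])
    show "eventually (\<lambda>j. j \<le> N j) sequentially"
    proof (rule always_eventually, rule allI)
      fix j
      have "(\<Sum>i\<le>j. 1) \<le> N j" unfolding N_def by (rule sum_mono) simp
      then show "j \<le> N j" by simp
    qed
  qed
  define E where "E = (\<lambda>j t. indicator {0..2*pi} t *\<^sub>R (V (N (Suc j)) t - V (N j) t))"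
  have E_norm: "integral {0..2*pi} (\<lambda>t. cmod (V (N (Suc j)) t - V (N j) t)) \<le> 2 * pi * (1/2)^j" for j
  proof -
    have diff: "T (N (Suc j)) t - T (N j) t = (\<Sum>n\<in>{N j..<N (Suc j)}. a n * cis (real n * t))" for t
      unfolding T_def using Nmono[of j]
      by (simp add: lessThan_atLeast0 sum_diff_nat_ivl)
    let ?D = "\<lambda>t. cmod (\<Sum>n\<in>{N j..<N (Suc j)}. a n * cis (real n * t))"
    have cm: "cmod (V (N (Suc j)) t - V (N j) t) = ?D t" for t
      unfolding diff[symmetric] V_def by (simp add: right_diff_distrib[symmetric] norm_mult)
    have hi: "((\<lambda>t. (?D t)\<^sup>2) has_integral 2 * pi * (\<Sum>n\<in>{N j..<N (Suc j)}. (cmod (a n))\<^sup>2)) {0..2*pi}"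
      by (rule has_integral_norm_trig_sum) simp
    have "integral {0..2*pi} ?D \<le> integral {0..2*pi} (\<lambda>t. (2^j * (?D t)\<^sup>2 + (1/2)^j) / 2)"
    proof (rule integral_le)
      show "?D integrable_on {0..2*pi}" by (intro integrable_continuous_interval continuous_intros)
      show "(\<lambda>t. (2^j * (?D t)\<^sup>2 + (1/2)^j) / 2) integrable_on {0..2*pi}"
        by (intro integrable_continuous_interval continuous_intros) auto
      fix t
      \<comment> \<open>A pointwise substitute for the Cauchy-Schwarz inequality; the weight
        \<open>2^j\<close> balances the square integral, which is at most
        \<open>2 * pi * 4^(-j)\<close>.\<close>
      define x where "x = ?D t"
      have "0 \<le> 2^j * (x - (1/2)^j)\<^sup>2" by simp
      also have "\<dots> = 2^j * x\<^sup>2 - 2 * x + (1/2)^j"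
        by (simp add: power2_eq_square algebra_simps power_divide)
      finally show "?D t \<le> (2^j * (?D t)\<^sup>2 + (1/2)^j) / 2" unfolding x_def by simp
    qed
    also have "\<dots> = (2^j * (2 * pi * (\<Sum>n\<in>{N j..<N (Suc j)}. (cmod (a n))\<^sup>2)) + 2 * pi * (1/2)^j) / 2"
    proof (rule integral_unique)
      have "((\<lambda>t. (1/2)^j) has_integral 2 * pi * (1/2)^j) {0..2*pi}"
        using has_integral_const_real[of "(1/2)^j :: real" 0 "2*pi"] by simp
      then show "((\<lambda>t. (2^j * (?D t)\<^sup>2 + (1/2)^j) / 2) has_integral
         (2^j * (2 * pi * (\<Sum>n\<in>{N j..<N (Suc j)}. (cmod (a n))\<^sup>2)) + 2 * pi * (1/2)^j) / 2) {0..2*pi}"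
        by (intro has_integral_divide has_integral_add has_integral_mult_right hi)
    qed
    also have "\<dots> \<le> (2^j * (2 * pi * (1/4)^j) + 2 * pi * (1/2)^j) / 2"
      using M[OF NM Nmono, of j] by (intro divide_right_mono add_right_mono mult_left_mono) auto
    also have "2^j * (2 * pi * (1/4)^j) = 2 * pi * (1/2 :: real)^j"
      by (simp add: power_mult_distrib[symmetric] power_divide field_simps)
    finally show ?thesis by (simp add: cm)
  qed
  have E_int: "integrable lborel (E j)" for j
  proof -
    have "set_integrable lborel {0..2*pi} (\<lambda>t. V (N (Suc j)) t - V (N j) t)"
      by (intro borel_integrable_atLeastAtMost' continuous_intros contV)
    then show ?thesis by (simp add: E_def set_integrable_def)
  qed
  have E_L1: "(\<integral>t. norm (E j t) \<partial>lborel) \<le> 2 * pi * (1/2)^j" for j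
  proof -
    have si: "set_integrable lborel {0..2*pi} (\<lambda>t. cmod (V (N (Suc j)) t - V (N j) t))"
      by (intro borel_integrable_atLeastAtMost' continuous_intros contV)
    have "(\<integral>t. norm (E j t) \<partial>lborel) = (LINT t:{0..2*pi}|lborel. cmod (V (N (Suc j)) t - V (N j) t))"
      by (simp add: E_def set_lebesgue_integral_def)
    also have "\<dots> = integral {0..2*pi} (\<lambda>t. cmod (V (N (Suc j)) t - V (N j) t))"
      using set_borel_integral_eq_integral(2)[OF si] .
    finally show ?thesis using E_norm by simp
  qed
  have geo: "summable (\<lambda>j. 2 * pi * (1/2)^j :: real)"
    by (intro summable_mult summable_geometric) simp
  have sL1: "summable (\<lambda>j. \<integral>t. norm (E j t) \<partial>lborel)"
    by (rule summable_comparison_test'[OF geo, of 0]) (use E_L1 in auto)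
  have AEs: "AE t in lborel. summable (\<lambda>j. norm (E j t))"
  proof -
    have "(\<integral>\<^sup>+t. (\<Sum>j. ennreal (norm (E j t))) \<partial>lborel) = (\<Sum>j. \<integral>\<^sup>+t. ennreal (norm (E j t)) \<partial>lborel)"
      using E_int by (intro nn_integral_suminf) auto
    also have "\<dots> = (\<Sum>j. ennreal (\<integral>t. norm (E j t) \<partial>lborel))"
      using E_int by (intro suminf_cong nn_integral_eq_integral) auto
    also have "\<dots> < \<infinity>"
      using sL1 by (subst suminf_ennreal2) auto
    finally have "AE t in lborel. (\<Sum>j. ennreal (norm (E j t))) \<noteq> \<infinity>"
      using E_int by (intro nn_integral_PInf_AE) auto
    then show ?thesis
      by (rule eventually_mono) (rule summable_suminf_not_top, auto)
  qed
  \<comment> \<open>The series telescopes: \<open>u\<close> is the limit of \<open>V (N j)\<close>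
    on \<open>{0..2*pi}\<close>, almost everywhere and in \<open>L^1\<close>. It plays the role of
    the density of \<open>H\<close> along the circle.\<close>
  define u where "u = (\<lambda>t. indicator {0..2*pi} t *\<^sub>R V (N 0) t + (\<Sum>j. E j t))"
  have V0int: "integrable lborel (\<lambda>t. indicator {0..2*pi} t *\<^sub>R V (N 0) t)"
    using borel_integrable_atLeastAtMost'[OF contV, of 0 "2*pi" "N 0"] by (simp add: set_integrable_def)
  have suint: "integrable lborel (\<lambda>t. \<Sum>j. E j t)"
    by (rule integrable_suminf[OF E_int AEs sL1])
  have uint: "integrable lborel u"
    unfolding u_def by (intro Bochner_Integration.integrable_add V0int suint)
  have u_on: "u integrable_on {x..y}" for x y
  proof -
    have "set_integrable lborel {x..y} u"
      unfolding set_integrable_def using uint by (intro integrable_mult_indicator) auto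
    then show ?thesis by (rule set_borel_integral_eq_integral(1))
  qed
  have u_eq: "H (cis y) - H (cis x) = integral {x..y} u" if xy: "0 \<le> x" "x \<le> y" "y \<le> 2 * pi" for x y
  proof -
    have setint: "set_integrable lborel {x..y} w" if "integrable lborel w" for w :: "real \<Rightarrow> complex"
      unfolding set_integrable_def using that by (intro integrable_mult_indicator) auto
    have lint: "(LINT t:{x..y}|lborel. w t) = integral {x..y} w" if "integrable lborel w" for w :: "real \<Rightarrow> complex"
      by (rule set_borel_integral_eq_integral(2)[OF setint[OF that]])
    have Ei: "integral {x..y} (E j) = integral {x..y} (V (N (Suc j))) - integral {x..y} (V (N j))" for j
    proof -
      have "integral {x..y} (E j) = integral {x..y} (\<lambda>t. V (N (Suc j)) t - V (N j) t)"
        by (rule integral_cong) (use xy in \<open>auto simp: E_def\<close>)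
      also have "\<dots> = integral {x..y} (V (N (Suc j))) - integral {x..y} (V (N j))"
        by (intro integral_diff integrable_continuous_interval contV)
      finally show ?thesis .
    qed
    have "(\<lambda>j. \<integral>t. indicator {x..y} t *\<^sub>R E j t \<partial>lborel) sums (\<integral>t. (\<Sum>j. indicator {x..y} t *\<^sub>R E j t) \<partial>lborel)"
    proof (rule sums_integral)
      show "integrable lborel (\<lambda>t. indicator {x..y} t *\<^sub>R E j t)" for j
        using setint[OF E_int] by (simp add: set_integrable_def)
      show "AE t in lborel. summable (\<lambda>j. norm (indicator {x..y} t *\<^sub>R E j t))"
        using AEs by eventually_elim (auto simp: indicator_def)
      show "summable (\<lambda>j. \<integral>t. norm (indicator {x..y} t *\<^sub>R E j t) \<partial>lborel)"
      proof (rule summable_comparison_test'[OF sL1, of 0])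
        fix j
        have "(\<integral>t. norm (indicator {x..y} t *\<^sub>R E j t) \<partial>lborel) \<le> (\<integral>t. norm (E j t) \<partial>lborel)"
          using setint[OF E_int, of j] E_int[of j]
          by (intro integral_mono integrable_norm) (auto simp: set_integrable_def indicator_def)
        then show "norm (\<integral>t. norm (indicator {x..y} t *\<^sub>R E j t) \<partial>lborel) \<le> (\<integral>t. norm (E j t) \<partial>lborel)" by simp
      qed
    qed
    moreover have "(\<integral>t. indicator {x..y} t *\<^sub>R E j t \<partial>lborel) = integral {x..y} (V (N (Suc j))) - integral {x..y} (V (N j))" for j
      using lint[OF E_int[of j]] Ei by (simp add: set_lebesgue_integral_def)
    moreover have "(\<integral>t. (\<Sum>j. indicator {x..y} t *\<^sub>R E j t) \<partial>lborel) = integral {x..y} (\<lambda>t. \<Sum>j. E j t)"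
    proof -
      have "(\<Sum>j. indicator {x..y} t *\<^sub>R E j t) = indicator {x..y} t *\<^sub>R (\<Sum>j. E j t)" for t
        by (simp add: indicator_def)
      then show ?thesis using lint[OF suint] by (simp add: set_lebesgue_integral_def)
    qed
    ultimately have s1: "(\<lambda>j. integral {x..y} (V (N (Suc j))) - integral {x..y} (V (N j))) sums integral {x..y} (\<lambda>t. \<Sum>j. E j t)"
      by simp
    have lim: "(\<lambda>j. integral {x..y} (V (N j))) \<longlonglongrightarrow> H (cis y) - H (cis x)"
    proof -
      have "(\<lambda>j. (\<Sum>n<j. c n * cis s ^ n)) \<longlonglongrightarrow> H (cis s)" for s
        using Hsums[of "cis s"] by (simp add: sums_def)
      then have "(\<lambda>j. (\<Sum>n<Suc (N j). c n * cis s ^ n)) \<longlonglongrightarrow> H (cis s)" for s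
        by (rule filterlim_compose) (rule filterlim_compose[OF filterlim_Suc Nlim])
      then show ?thesis unfolding intV[OF xy(2)] by (intro tendsto_diff)
    qed
    have "(\<lambda>j. integral {x..y} (V (N (Suc j))) - integral {x..y} (V (N j))) sums (H (cis y) - H (cis x) - integral {x..y} (V (N 0)))"
      by (rule telescope_sums[OF lim])
    with s1 have "integral {x..y} (\<lambda>t. \<Sum>j. E j t) = H (cis y) - H (cis x) - integral {x..y} (V (N 0))"
      using sums_unique2 by blast
    moreover have "integral {x..y} u = integral {x..y} (\<lambda>t. indicator {0..2*pi} t *\<^sub>R V (N 0) t) + integral {x..y} (\<lambda>t. \<Sum>j. E j t)"
      unfolding u_def
      by (intro Henstock_Kurzweil_Integration.integral_add set_borel_integral_eq_integral(1) setint V0int suint)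
    moreover have "integral {x..y} (\<lambda>t. indicator {0..2*pi} t *\<^sub>R V (N 0) t) = integral {x..y} (V (N 0))"
      by (rule integral_cong) (use xy in auto)
    ultimately show ?thesis by simp
  qed
  have "AE t in lborel. 0 < t \<and> t < 2*pi \<longrightarrow> ((\<lambda>t. H (cis t)) has_vector_derivative u t) (at t)"
    by (rule indefinite_integral_has_vector_derivative_AE[OF u_on u_eq])
  moreover have "AE t in lborel. t \<noteq> 0 \<and> t \<noteq> 2 * (pi::real)"
    using AE_lborel_singleton[of "0::real"] AE_lborel_singleton[of "2*pi"] by eventually_elim auto
  ultimately show ?thesis
  proof eventually_elim
    case (elim t)
    show ?case
    proof
      assume t: "t \<in> {0..2*pi}"
      with elim have der: "((\<lambda>t. H (cis t)) has_vector_derivative u t) (at t)" by auto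
      \<comment> \<open>By the chain rule, this is the derivative of \<open>H\<close> along the
        circle with respect to the point \<open>cis t\<close> instead of the angle; subtracting
        \<open>l * cis s\<close> makes the angular derivative vanish.\<close>
      define l where "l = u t / (\<i> * cis t)"
      have "((\<lambda>s. H (cis s) - l * cis s) has_vector_derivative (u t - l * (\<i> * cis t))) (at t)"
        by (intro has_vector_derivative_diff has_vector_derivative_mult_right der has_vector_derivative_cis)
      then have d0: "((\<lambda>s. H (cis s) - l * cis s) has_vector_derivative 0) (at t)"
        by (simp add: l_def)
      have "((\<lambda>r. deriv H (of_real r * cis t)) \<longlongrightarrow> l) (at_left 1)"
      proof (rule radial_limit_deriv_of_tangential_deriv[OF contH holH])
        fix \<epsilon> :: real assume e: "\<epsilon> > 0"
        obtain d1 where d1: "d1 > 0" "\<And>s. \<bar>s - t\<bar> < d1 \<Longrightarrow> cmod ((H (cis s) - l * cis s) - (H (cis t) - l * cis t)) \<le> \<epsilon> / 2 * \<bar>s - t\<bar>"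
          using has_vector_derivative_imp_le[OF d0 half_gt_zero[OF e]]
          unfolding scaleR_zero_right diff_zero by blast
        obtain d2 where d2: "d2 > 0" "\<And>s. \<bar>s - t\<bar> < d2 \<Longrightarrow> cmod (cis s - cis t - (s - t) *\<^sub>R (\<i> * cis t)) \<le> 1 / 2 * \<bar>s - t\<bar>"
          using has_vector_derivative_imp_le[OF has_vector_derivative_cis half_gt_zero[OF zero_less_one]] by blast
        \<comment> \<open>Angle and chord are comparable near \<open>t\<close>, so an error small
          relative to the angle is small relative to \<open>cmod (w - cis t)\<close>. Continuity of
          \<open>Arg\<close> at 1 makes the angle small when the chord is.\<close>
        have s2: "\<bar>s - t\<bar> \<le> 2 * cmod (cis s - cis t)" if "\<bar>s - t\<bar> < d2" for s
        proof -
          have "\<bar>s - t\<bar> = cmod ((s - t) *\<^sub>R (\<i> * cis t))" by (simp add: norm_mult)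
          also have "\<dots> \<le> cmod (cis s - cis t) + cmod (cis s - cis t - (s - t) *\<^sub>R (\<i> * cis t))"
            by (metis add_diff_cancel_left' diff_add_cancel norm_triangle_sub norm_minus_commute add.commute)
          finally show ?thesis using d2(2)[OF that] by simp
        qed
        have "isCont Arg 1" by (rule continuous_at_Arg) (auto simp: complex_nonpos_Reals_iff)
        then obtain d3 where d3: "d3 > 0" "\<And>w. cmod (w - 1) < d3 \<Longrightarrow> \<bar>Arg w\<bar> < min d1 d2"
          unfolding continuous_at_eps_delta using d1(1) d2(1)
          by (auto dest!: spec[of _ "min d1 d2"] simp: dist_norm)
        show "\<exists>d>0. \<forall>w. cmod w = 1 \<and> cmod (w - cis t) < d \<longrightarrow> cmod (H w - H (cis t) - l * (w - cis t)) \<le> \<epsilon> * cmod (w - cis t)"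
        proof (intro exI[of _ d3] conjI allI impI d3(1))
          fix w assume w: "cmod w = 1 \<and> cmod (w - cis t) < d3"
          define \<sigma> where "\<sigma> = Arg (w / cis t)"
          have wc: "w = cis (t + \<sigma>)"
          proof -
            have "cis \<sigma> = w / cis t" unfolding \<sigma>_def using w
              by (subst cis_Arg) (auto simp: sgn_div_norm norm_divide)
            then show ?thesis by (simp add: cis_mult[symmetric] field_simps)
          qed
          have "w / cis t - 1 = (w - cis t) / cis t" by (simp add: field_simps)
          then have "cmod (w / cis t - 1) = cmod (w - cis t)" by (simp add: norm_divide)
          then have sm: "\<bar>\<sigma>\<bar> < min d1 d2" using d3(2) w by (simp add: \<sigma>_def)
          have eq: "H w - H (cis t) - l * (w - cis t) = (H w - l * w) - (H (cis t) - l * cis t)"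
            by (simp add: algebra_simps)
          have "\<bar>t + \<sigma> - t\<bar> < d1" using sm by simp
          from d1(2)[OF this] have "cmod (H w - H (cis t) - l * (w - cis t)) \<le> \<epsilon> / 2 * \<bar>\<sigma>\<bar>"
            unfolding eq by (simp only: wc[symmetric] add_diff_cancel_left')
          also have "\<dots> \<le> \<epsilon> / 2 * (2 * cmod (w - cis t))"
            using s2[of "t + \<sigma>"] sm wc e by (intro mult_left_mono) auto
          finally show "cmod (H w - H (cis t) - l * (w - cis t)) \<le> \<epsilon> * cmod (w - cis t)" by simp
        qed
      qed simp
      moreover have "eventually (\<lambda>r. deriv H (of_real r * cis t) = F (of_real r * cis t)) (at_left 1)"
        by (rule eventually_at_leftI[of 0]) (auto intro!: dH simp: norm_mult)
      ultimately have "((\<lambda>r. F (of_real r * cis t)) \<longlongrightarrow> l) (at_left 1)"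
        by (rule Lim_transform_eventually)
      then show "\<exists>l. ((\<lambda>r. F (of_real r * cis t)) \<longlongrightarrow> l) (at_left 1)" by blast
    qed
  qed
qed

subsection \<open>Growth of the derivative\<close>

text \<open>The set of violations is open, and a nonempty open set has positive measure. This
  upgrades the dilatation inequality from almost every point to every point.\<close>

lemma AE_lborel_imp_everywhere:
  fixes p q :: "complex \<Rightarrow> real"
  assumes "open U" "continuous_on U p" "continuous_on U q"
    and ae: "AE z in lborel. z \<in> U \<longrightarrow> p z \<le> q z" and z: "z \<in> U"
  shows "p z \<le> q z"
proof (rule ccontr)
  assume n: "\<not> p z \<le> q z"
  define W where "W = {x \<in> U. q x - p x \<in> {..<0}}"
  have "open W" unfolding W_def Collect_conj_eq Collect_mem_eq
    using continuous_open_preimage[of U "\<lambda>x. q x - p x" "{..<0}"] assms(1-3)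
    by (auto intro!: continuous_intros simp: vimage_def Int_def)
  moreover have "z \<in> W" using n z by (simp add: W_def)
  ultimately obtain e where e: "e > 0" "ball z e \<subseteq> W" by (meson openE)
  have "AE x in lborel. x \<notin> ball z e"
    using ae by eventually_elim (use e in \<open>force simp: W_def\<close>)
  then have "ball z e \<in> null_sets lborel"
    using AE_iff_null_sets[of "ball z e" lborel] by simp
  then have "emeasure lborel (ball z e) = 0" by auto
  then show False using e(1) emeasure_lborel_ball_finite[of z e] content_ball_pos[OF e(1), of z]
    by (simp add: measure_def)
qed

text \<open>A segment from \<open>w\<close> to a point outside \<open>G\<close> meets the frontier.
  If the frontier is empty, \<open>infdist\<close> is 0 and the ball is empty.\<close>

lemma ball_infdist_frontier_subset:
  fixes w :: "'a::euclidean_space"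
  assumes "w \<in> G"
  shows "ball w (infdist w (frontier G)) \<subseteq> G"
proof
  fix p assume p: "p \<in> ball w (infdist w (frontier G))"
  show "p \<in> G"
  proof (rule ccontr)
    assume "p \<notin> G"
    have "connected (closed_segment w p)" by simp
    then have "closed_segment w p \<inter> frontier G \<noteq> {}"
      by (rule connected_Int_frontier) (use assms \<open>p \<notin> G\<close> in auto)
    then obtain q where q: "q \<in> closed_segment w p" "q \<in> frontier G" by auto
    then have "infdist w (frontier G) \<le> dist w q" by (intro infdist_le)
    also have "\<dots> \<le> dist w p" using q(1) by (metis dist_commute dist_in_closed_segment(1))
    finally show False using p by simp
  qed
qed

text \<open>Collects the analytic data: a logarithm \<open>L\<close> of \<open>h'\<close>, whose
  derivative is \<open>h'' / h'\<close>, the dilatation inequality at every point, and the bound of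
  \<open>S_H2\<close>. The number \<alpha> stands for half the supremum, so that
  \<open>\<alpha> < 2\<close> expresses the strict bound 4 uniformly in \<open>z\<close>.\<close>

locale qc_harmonic =
  fixes f h g L :: "complex \<Rightarrow> complex" and K \<alpha> :: real
  assumes hol_h: "h holomorphic_on ball 0 1"
    and hol_g: "g holomorphic_on ball 0 1"
    and hol_L: "L holomorphic_on ball 0 1"
    and f_eq: "\<And>z. z \<in> ball 0 1 \<Longrightarrow> f z = h z + cnj (g z)"
    and h'_eq: "\<And>z. z \<in> ball 0 1 \<Longrightarrow> deriv h z = exp (L z)"
    and K: "K \<ge> 1"
    and qc: "\<And>z. z \<in> ball 0 1 \<Longrightarrow> (cmod (deriv h z) + cmod (deriv g z))\<^sup>2 \<le> K * ((cmod (deriv h z))\<^sup>2 - (cmod (deriv g z))\<^sup>2)"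
    and \<alpha>: "0 \<le> \<alpha>" "\<alpha> < 2"
    and preschwarzian: "\<And>z. z \<in> ball 0 1 \<Longrightarrow> cmod (of_real (1 - (cmod z)\<^sup>2) * deriv L z - 2 * cnj z) \<le> 2 * \<alpha>"
    and inj: "inj_on f (ball 0 1)"
begin

definition E :: "complex \<Rightarrow> real" where "E z = exp (Re (L z))"

abbreviation arc_int :: "real \<Rightarrow> real \<Rightarrow> real \<Rightarrow> real" where
  "arc_int r a b \<equiv> integral {a..b} (\<lambda>y. E (rcis r y))"

lemma E_pos: "E z > 0" by (simp add: E_def)

lemma norm_h': "z \<in> ball 0 1 \<Longrightarrow> cmod (deriv h z) = E z"
  by (simp add: h'_eq E_def)

lemma norm_g': assumes z: "z \<in> ball 0 1" shows "cmod (deriv g z) < E z"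
proof -
  have "0 < E z + cmod (deriv g z)" using E_pos[of z] norm_ge_zero[of "deriv g z"] by linarith
  then have "0 < (E z + cmod (deriv g z))\<^sup>2" by simp
  also have "\<dots> \<le> K * ((E z)\<^sup>2 - (cmod (deriv g z))\<^sup>2)" using qc[OF z] by (simp add: norm_h'[OF z])
  finally have "(cmod (deriv g z))\<^sup>2 < (E z)\<^sup>2" using K by (simp add: zero_less_mult_iff)
  then show ?thesis using E_pos[of z] by (simp add: power2_less_imp_less)
qed

text \<open>Cancel \<open>\<bar>h'\<bar> + \<bar>g'\<bar>\<close> in the dilatation inequality. This
  bounds the least stretching of \<open>f\<close> from below by \<open>E / K\<close>, as needed for
  lower bounds of lengths.\<close>

lemma norm_diff_le:
  assumes z: "z \<in> ball 0 1"
  shows "E z \<le> K * (E z - cmod (deriv g z))"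
proof -
  let ?p = "E z" and ?q = "cmod (deriv g z)"
  have pos: "0 < ?p + ?q" using E_pos[of z] norm_ge_zero[of "deriv g z"] by linarith
  have "(?p + ?q) * (?p + ?q) \<le> (?p + ?q) * (K * (?p - ?q))"
    using qc[OF z] by (simp add: norm_h'[OF z] power2_eq_square algebra_simps)
  then have "?p + ?q \<le> K * (?p - ?q)" using pos by (simp add: mult_le_cancel_left_pos)
  then show ?thesis using norm_ge_zero[of "deriv g z"] by linarith
qed

text \<open>The 6 is \<open>2 * \<alpha> + 2 * cmod z < 4 + 2\<close>, and
  \<open>1 - (cmod z)^2\<close> dominates \<open>1 - cmod z\<close>.\<close>

lemma norm_deriv_L_le:
  assumes z: "z \<in> ball 0 1"
  shows "cmod (deriv L z) \<le> 6 / (1 - cmod z)"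
proof -
  have c: "cmod z < 1" using z by simp
  have s: "(cmod z)\<^sup>2 < 1" using c by (simp add: abs_square_less_1)
  have "cmod (of_real (1 - (cmod z)\<^sup>2) * deriv L z) \<le> cmod (of_real (1 - (cmod z)\<^sup>2) * deriv L z - 2 * cnj z) + cmod (2 * cnj z)"
    using norm_triangle_sub[of "of_real (1 - (cmod z)\<^sup>2) * deriv L z" "2 * cnj z"] by linarith
  also have "\<dots> \<le> 6"
    using preschwarzian[OF z] \<alpha> c by (simp add: norm_mult)
  also have "cmod (of_real (1 - (cmod z)\<^sup>2) * deriv L z) = (1 - (cmod z)\<^sup>2) * cmod (deriv L z)"
    unfolding norm_mult norm_of_real using s by simp
  also have "1 - (cmod z)\<^sup>2 = (1 - cmod z) * (1 + cmod z)" by (simp add: power2_eq_square algebra_simps)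
  finally have "(1 - cmod z) * (1 + cmod z) * cmod (deriv L z) \<le> 6" .
  moreover have "(1 - cmod z) * 1 * cmod (deriv L z) \<le> (1 - cmod z) * (1 + cmod z) * cmod (deriv L z)"
    using c by (intro mult_right_mono mult_left_mono) auto
  ultimately show ?thesis using c by (simp add: field_simps)
qed

lemma L_Lipschitz:
  assumes "0 \<le> \<rho>" "\<rho> < 1" "cmod z \<le> \<rho>" "cmod w \<le> \<rho>"
  shows "cmod (L z - L w) \<le> 6 / (1 - \<rho>) * cmod (z - w)"
proof (rule field_differentiable_bound[of "cball 0 \<rho>"])
  show "(L has_field_derivative deriv L x) (at x within cball 0 \<rho>)" if "x \<in> cball 0 \<rho>" for x
    using hol_L that assms by (auto intro!: holomorphic_derivI[where S="ball 0 1"])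
  show "cmod (deriv L x) \<le> 6 / (1 - \<rho>)" if "x \<in> cball 0 \<rho>" for x
  proof -
    have "cmod (deriv L x) \<le> 6 / (1 - cmod x)" using that assms by (intro norm_deriv_L_le) auto
    also have "\<dots> \<le> 6 / (1 - \<rho>)" using that assms by (intro divide_left_mono mult_pos_pos) auto
    finally show ?thesis .
  qed
qed (use assms in auto)

text \<open>A Harnack inequality: \<open>ln E\<close> is Lipschitz on each smaller disk, with a
  constant inversely proportional to the distance from the circle.\<close>

lemma E_le_exp:
  assumes "0 \<le> \<rho>" "\<rho> < 1" "cmod z \<le> \<rho>" "cmod w \<le> \<rho>" "6 / (1 - \<rho>) * cmod (z - w) \<le> A"
  shows "E w \<le> exp A * E z"
proof -
  have "Re (L w) - Re (L z) \<le> cmod (L z - L w)"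
    using abs_Re_le_cmod[of "L z - L w"] by simp
  also have "\<dots> \<le> A" using L_Lipschitz[OF assms(1-4)] assms(5) by linarith
  finally have "Re (L w) \<le> A + Re (L z)" by simp
  then show ?thesis unfolding E_def exp_add[symmetric] by simp
qed

text \<open>Both \<open>\<bar>h'\<bar>\<close> and \<open>\<bar>g'\<bar>\<close> are at most
  \<open>E\<close>, which varies by at most the factor \<open>exp A\<close> along the segment; the 2
  counts the two summands of \<open>f\<close>.\<close>

lemma f_Lipschitz:
  assumes "0 \<le> \<rho>" "\<rho> < 1" "cmod z \<le> \<rho>" "cmod w \<le> \<rho>" "6 / (1 - \<rho>) * cmod (w - z) \<le> A"
  shows "cmod (f w - f z) \<le> 2 * exp A * E z * cmod (w - z)"
proof -
  let ?S = "closed_segment z w"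
  have sub: "cmod x \<le> \<rho>" "cmod (x - z) \<le> cmod (w - z)" if "x \<in> ?S" for x
  proof -
    have "?S \<subseteq> cball 0 \<rho>" using assms by (intro closed_segment_subset) auto
    then show "cmod x \<le> \<rho>" using that by auto
    show "cmod (x - z) \<le> cmod (w - z)" using segment_bound(1)[OF that] .
  qed
  have Eb: "E x \<le> exp A * E z" if "x \<in> ?S" for x
  proof (rule E_le_exp[OF assms(1-3) sub(1)[OF that]])
    have "6 / (1 - \<rho>) * cmod (z - x) \<le> 6 / (1 - \<rho>) * cmod (w - z)"
      using sub(2)[OF that] assms by (intro mult_left_mono) (auto simp: norm_minus_commute)
    then show "6 / (1 - \<rho>) * cmod (z - x) \<le> A" using assms(5) by linarith
  qed
  have inb: "x \<in> ball 0 1" if "x \<in> ?S" for x using sub(1)[OF that] assms by auto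
  have h: "cmod (h w - h z) \<le> exp A * E z * cmod (w - z)"
  proof (rule field_differentiable_bound[of ?S])
    show "(h has_field_derivative deriv h x) (at x within ?S)" if "x \<in> ?S" for x
      using hol_h inb[OF that] by (auto intro!: holomorphic_derivI[where S="ball 0 1"])
    show "cmod (deriv h x) \<le> exp A * E z" if "x \<in> ?S" for x
      using Eb[OF that] norm_h'[OF inb[OF that]] by simp
  qed auto
  have g: "cmod (g w - g z) \<le> exp A * E z * cmod (w - z)"
  proof (rule field_differentiable_bound[of ?S])
    show "(g has_field_derivative deriv g x) (at x within ?S)" if "x \<in> ?S" for x
      using hol_g inb[OF that] by (auto intro!: holomorphic_derivI[where S="ball 0 1"])
    show "cmod (deriv g x) \<le> exp A * E z" if "x \<in> ?S" for x
      using Eb[OF that] norm_g'[OF inb[OF that]] by simp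
  qed auto
  have "f w - f z = (h w - h z) + cnj (g w - g z)"
    using f_eq[OF inb[of w]] f_eq[OF inb[of z]] by simp
  then have "cmod (f w - f z) \<le> cmod (h w - h z) + cmod (g w - g z)"
    by (metis norm_triangle_ineq complex_mod_cnj)
  with h g show ?thesis by simp
qed

lemma continuous_on_L_rcis: "0 \<le> r \<Longrightarrow> r < 1 \<Longrightarrow> continuous_on A (\<lambda>y. L (rcis r y))"
  by (rule continuous_on_compose2[OF holomorphic_on_imp_continuous_on[OF hol_L]])
     (auto simp: rcis_def norm_mult intro!: continuous_intros)

lemma continuous_on_E_rcis: "0 \<le> r \<Longrightarrow> r < 1 \<Longrightarrow> continuous_on A (\<lambda>y. E (rcis r y))"
  unfolding E_def by (intro continuous_intros continuous_on_L_rcis)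

lemma E_rcis_integrable: "0 \<le> r \<Longrightarrow> r < 1 \<Longrightarrow> (\<lambda>y. E (rcis r y)) integrable_on {a..b}"
  by (intro integrable_continuous_interval continuous_on_E_rcis)

text \<open>The bound on \<open>deriv L\<close> gives \<open>Re (\<xi> * deriv L z) \<ge> (2 * x - 2
  * \<alpha>) / (1 - x^2)\<close> at \<open>z = x * \<xi>\<close>. By partial fractions the right
  side is \<open>(1 - \<alpha>) / (1 - x) - (1 + \<alpha>) / (1 + x)\<close>; subtracting its
  primitive from \<open>ln E\<close> leaves the nondecreasing function \<psi>. The factor
  \<open>8 = 2^3\<close> bounds \<open>((1 + r2) / (1 + r1)) powr (1 + \<alpha>)\<close>.\<close>

lemma E_radial_growth:
  assumes \<xi>: "cmod \<xi> = 1" and r: "0 \<le> r1" "r1 \<le> r2" "r2 < 1"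
  shows "E (of_real r1 * \<xi>) \<le> 8 * ((1 - r1) / (1 - r2)) powr (\<alpha> - 1) * E (of_real r2 * \<xi>)"
proof -
  define \<psi> where "\<psi> = (\<lambda>\<rho>. Re (L (of_real \<rho> * \<xi>)) + (1 - \<alpha>) * ln (1 - \<rho>) + (1 + \<alpha>) * ln (1 + \<rho>))"
  have "\<psi> r1 \<le> \<psi> r2"
  proof (rule DERIV_nonneg_imp_nondecreasing[OF r(2)])
    fix x assume x: "r1 \<le> x" "x \<le> r2"
    then have x01: "0 \<le> x" "x < 1" using r by auto
    define z where "z = of_real x * \<xi>"
    have cz: "cmod z = x" using x01 \<xi> by (simp add: z_def norm_mult)
    have zb: "z \<in> ball 0 1" using cz x01 by simp
    have dL: "((\<lambda>\<rho>. L (of_real \<rho> * \<xi>)) has_vector_derivative \<xi> * deriv L z) (at x)"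
    proof -
      have "(L has_field_derivative deriv L z) (at z)"
        using hol_L zb by (auto intro!: holomorphic_derivI[where S="ball 0 1"])
      then have "((\<lambda>u. L (u * \<xi>)) has_field_derivative deriv L z * \<xi>) (at (of_real x))"
        unfolding z_def by (intro DERIV_chain2[where f=L]) (auto intro!: derivative_eq_intros)
      from has_vector_derivative_real_field[OF this] show ?thesis by (simp add: mult.commute)
    qed
    have dR: "((\<lambda>\<rho>. Re (L (of_real \<rho> * \<xi>))) has_real_derivative Re (\<xi> * deriv L z)) (at x)"
      using bounded_linear.has_vector_derivative[OF bounded_linear_Re dL]
      by (simp add: has_real_derivative_iff_has_vector_derivative)
    have d: "(\<psi> has_real_derivative (Re (\<xi> * deriv L z) - (1 - \<alpha>) / (1 - x) + (1 + \<alpha>) / (1 + x))) (at x)"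
    proof -
      have d1: "((\<lambda>\<rho>. ln (1 - \<rho>)) has_real_derivative - 1 / (1 - x)) (at x)"
        and d2: "((\<lambda>\<rho>. ln (1 + \<rho>)) has_real_derivative 1 / (1 + x)) (at x)"
        using x01 by (auto intro!: derivative_eq_intros)
      show ?thesis
        using DERIV_add[OF DERIV_add[OF dR DERIV_cmult[OF d1, of "1 - \<alpha>"]] DERIV_cmult[OF d2, of "1 + \<alpha>"]]
        unfolding \<psi>_def by (rule DERIV_cong) (simp add: divide_inverse)
    qed
    have x2: "1 - x\<^sup>2 > 0" using x01 by (simp add: abs_square_less_1)
    have "\<bar>Re (\<xi> * (of_real (1 - (cmod z)\<^sup>2) * deriv L z - 2 * cnj z))\<bar> \<le> 2 * \<alpha>"
      using preschwarzian[OF zb] abs_Re_le_cmod[of "\<xi> * (of_real (1 - (cmod z)\<^sup>2) * deriv L z - 2 * cnj z)"] \<xi>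
      by (simp add: norm_mult)
    moreover have "\<xi> * (of_real (1 - (cmod z)\<^sup>2) * deriv L z - 2 * cnj z) = of_real (1 - x\<^sup>2) * (\<xi> * deriv L z) - of_real (2 * x)"
    proof -
      have "\<xi> * cnj \<xi> = 1" using \<xi> by (simp add: complex_norm_square[symmetric])
      then show ?thesis unfolding cz by (simp add: z_def algebra_simps)
    qed
    ultimately have "\<bar>(1 - x\<^sup>2) * Re (\<xi> * deriv L z) - 2 * x\<bar> \<le> 2 * \<alpha>"
      by (simp del: of_real_mult of_real_diff of_real_power)
    then have "0 \<le> (1 - x\<^sup>2) * Re (\<xi> * deriv L z) - 2 * x + 2 * \<alpha>" by linarith
    also have "\<dots> = (1 - x\<^sup>2) * (Re (\<xi> * deriv L z) - (1 - \<alpha>) / (1 - x) + (1 + \<alpha>) / (1 + x))"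
    proof -
      have "(1 - x\<^sup>2) / (1 - x) = 1 + x" "(1 - x\<^sup>2) / (1 + x) = 1 - x"
        using x01 by (simp_all add: field_simps power2_eq_square)
      then have "(1 - x\<^sup>2) * ((1 - \<alpha>) / (1 - x)) = (1 - \<alpha>) * (1 + x)" "(1 - x\<^sup>2) * ((1 + \<alpha>) / (1 + x)) = (1 + \<alpha>) * (1 - x)"
        by (metis mult.commute times_divide_eq_left times_divide_eq_right)+
      then show ?thesis by (simp add: algebra_simps)
    qed
    finally have "0 \<le> Re (\<xi> * deriv L z) - (1 - \<alpha>) / (1 - x) + (1 + \<alpha>) / (1 + x)"
      using x2 by (simp add: zero_le_mult_iff)
    with d show "\<exists>y. (\<psi> has_real_derivative y) (at x) \<and> 0 \<le> y" by blast
  qed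
  then have "Re (L (of_real r1 * \<xi>)) \<le> Re (L (of_real r2 * \<xi>)) + (\<alpha> - 1) * ln ((1 - r1) / (1 - r2)) + (1 + \<alpha>) * (ln (1 + r2) - ln (1 + r1))"
    using r by (simp add: \<psi>_def ln_div algebra_simps)
  also have "(1 + \<alpha>) * (ln (1 + r2) - ln (1 + r1)) \<le> 3 * ln 2"
  proof (rule mult_mono)
    have "ln (1 + r2) \<le> ln 2" "0 \<le> ln (1 + r1)" using r by auto
    then show "ln (1 + r2) - ln (1 + r1) \<le> ln 2" by linarith
    show "0 \<le> ln (1 + r2) - ln (1 + r1)" using r by simp
  qed (use \<alpha> in auto)
  finally have "E (of_real r1 * \<xi>) \<le> exp (Re (L (of_real r2 * \<xi>)) + (\<alpha> - 1) * ln ((1 - r1) / (1 - r2)) + 3 * ln 2)"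
    unfolding E_def by simp
  also have "\<dots> = 8 * ((1 - r1) / (1 - r2)) powr (\<alpha> - 1) * E (of_real r2 * \<xi>)"
  proof -
    have "exp (3 * ln 2) = (2::real) powr 3" by (simp add: powr_def)
    also have "\<dots> = 8" by simp
    finally show ?thesis using r by (simp add: exp_add E_def powr_def)
  qed
  finally show ?thesis .
qed

end

subsection \<open>Length and area in polar coordinates\<close>

lemma norm_cis_minus_scaled_cis:
  "(cmod (cis y - rcis \<rho> y0))\<^sup>2 = (1 - \<rho>)\<^sup>2 + 4 * \<rho> * (sin ((y - y0) / 2))\<^sup>2"
proof -
  have "(cmod (cis y - rcis \<rho> y0))\<^sup>2 = (cos y - \<rho> * cos y0)\<^sup>2 + (sin y - \<rho> * sin y0)\<^sup>2"
    by (simp add: cmod_power2)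
  also have "\<dots> = ((cos y)\<^sup>2 + (sin y)\<^sup>2) + \<rho>\<^sup>2 * ((cos y0)\<^sup>2 + (sin y0)\<^sup>2) - 2 * \<rho> * (cos y * cos y0 + sin y * sin y0)"
    by algebra
  also have "\<dots> = 1 + \<rho>\<^sup>2 - 2 * \<rho> * cos (y - y0)" by (simp add: cos_diff)
  also have "cos (y - y0) = 1 - 2 * (sin ((y - y0) / 2))\<^sup>2"
  proof -
    have "2 * ((y - y0) / 2) = y - y0" by simp
    then show ?thesis using cos_double_sin[of "(y - y0) / 2"] by metis
  qed
  finally show ?thesis by (simp add: power2_eq_square algebra_simps)
qed

lemma norm_cis_diff_le: "cmod (cis x - cis y) \<le> \<bar>x - y\<bar>"
proof -
  have "(cmod (cis x - cis y))\<^sup>2 = (2 * sin ((x - y) / 2))\<^sup>2"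
    using norm_cis_minus_scaled_cis[of x 1 y] by (simp add: rcis_def power_mult_distrib)
  moreover have "\<bar>2 * sin ((x - y) / 2)\<bar> \<le> \<bar>x - y\<bar>"
    using abs_sin_x_le_abs_x[of "(x - y) / 2"] by simp
  ultimately have "\<bar>cmod (cis x - cis y)\<bar> \<le> \<bar>x - y\<bar>"
    by (simp only: abs_le_square_iff)
  then show ?thesis by simp
qed

lemma norm_rcis_diff_le: "cmod (rcis a x - rcis b y) \<le> \<bar>a - b\<bar> + \<bar>b\<bar> * \<bar>x - y\<bar>"
proof -
  have "rcis a x - rcis b y = of_real (a - b) * cis x + of_real b * (cis x - cis y)"
    by (simp add: rcis_def algebra_simps)
  then have "cmod (rcis a x - rcis b y) \<le> cmod (of_real (a - b) * cis x) + cmod (of_real b * (cis x - cis y))"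
    by (metis norm_triangle_ineq)
  also have "\<dots> \<le> \<bar>a - b\<bar> + \<bar>b\<bar> * \<bar>x - y\<bar>"
    unfolding norm_mult norm_of_real using mult_left_mono[OF norm_cis_diff_le abs_ge_zero] by simp
  finally show ?thesis .
qed

lemma rcis_eq_imp:
  assumes "0 < r" "rcis r x = rcis r y"
  shows "\<exists>n::int. x = y + 2 * pi * n"
proof -
  have "cis x = cis y" using assms by (simp add: rcis_def)
  then have "sin x = sin y \<and> cos x = cos y" by (simp add: complex_eq_iff)
  then show ?thesis using sin_cos_eq_iff by metis
qed

lemma rcis_inj:
  assumes "0 < r" "rcis r x = rcis r y" "\<bar>x - y\<bar> < 2 * pi"
  shows "x = y"
proof -
  obtain n :: int where n: "x = y + 2 * pi * n" using rcis_eq_imp[OF assms(1,2)] by blast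
  with assms(3) have "\<bar>real_of_int n\<bar> < 1" by (simp add: abs_mult)
  then have "n = 0" by linarith
  then show ?thesis using n by simp
qed

lemma continuous_on_deriv_compose:
  assumes "u holomorphic_on S" "open S" "continuous_on A p" "p ` A \<subseteq> S"
  shows "continuous_on A (\<lambda>x. deriv u (p x))"
  using assms by (intro continuous_on_compose2[of S "deriv u" A p] holomorphic_on_imp_continuous_on holomorphic_deriv)

text \<open>Up to the first time the curve reaches distance \<open>B\<close> from \<open>w\<close>
  it stays in that disk and travels at least \<open>B - A\<close>. Restricting the integral to this
  part makes it accessible to an area bound for the disk.\<close>

lemma nn_integral_speed_until_exit_ge:
  fixes u u' :: "real \<Rightarrow> complex"
  assumes der: "\<And>r. r \<in> {r0..r1} \<Longrightarrow> (u has_vector_derivative u' r) (at r)"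
    and cont: "continuous_on {r0..r1} u'"
    and r01: "r0 \<le> r1" and A: "cmod (u r0 - w) \<le> A" and B: "B \<le> cmod (u r1 - w)" "A < B"
  shows "ennreal (B - A) \<le> (\<integral>\<^sup>+r. indicator {r. r0 < r \<and> r < r1 \<and> cmod (u r - w) < B} r * ennreal (cmod (u' r)) \<partial>lborel)"
proof -
  have contg: "continuous_on {r0..r1} u"
    using der by (meson continuous_at_imp_continuous_on has_vector_derivative_continuous)
  define S where "S = {r \<in> {r0..r1}. cmod (u r - w) \<in> {B..}}"
  have "closed S" unfolding S_def
    by (rule continuous_closed_preimage[unfolded vimage_def Int_def, simplified]) (auto intro!: continuous_intros contg)
  moreover have "r1 \<in> S" using r01 B by (simp add: S_def)
  moreover have bdd: "bdd_below S" by (rule bdd_belowI[of _ r0]) (simp add: S_def)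
  ultimately have IS: "Inf S \<in> S" by (intro closed_contains_Inf) auto
  define r where "r = Inf S"
  have r: "r0 \<le> r" "r \<le> r1" "B \<le> cmod (u r - w)" using IS by (auto simp: S_def r_def)
  have less: "cmod (u x - w) < B" if "r0 \<le> x" "x < r" for x
  proof (rule ccontr)
    assume "\<not> ?thesis"
    then have "x \<in> S" using that r by (auto simp: S_def)
    then have "r \<le> x" unfolding r_def using bdd by (rule cInf_lower)
    then show False using that by simp
  qed
  have ftc: "(u' has_integral (u r - u r0)) {r0..r}"
    using r by (intro fundamental_theorem_of_calculus) (auto intro!: has_vector_derivative_at_within[OF der])
  have intn: "(\<lambda>x. cmod (u' x)) integrable_on {r0..r}"
    using r by (intro integrable_continuous_interval continuous_intros continuous_on_subset[OF cont]) auto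
  have "B - A \<le> cmod (u r - u r0)"
    using r(3) A norm_triangle_ineq[of "u r - u r0" "u r0 - w"] by simp
  also have "\<dots> \<le> integral {r0..r} (\<lambda>x. cmod (u' x))"
    using integral_norm_bound_integral[OF has_integral_integrable[OF ftc] intn] integral_unique[OF ftc] by auto
  finally have "ennreal (B - A) \<le> ennreal (integral {r0..r} (\<lambda>x. cmod (u' x)))" by (rule ennreal_leI)
  also have "\<dots> = (\<integral>\<^sup>+x. ennreal (indicator {r0..r} x * cmod (u' x)) \<partial>lborel)"
    by (rule nn_integral_has_integral_lebesgue[symmetric]) (use intn in auto)
  also have "\<dots> \<le> (\<integral>\<^sup>+x. indicator {r. r0 < r \<and> r < r1 \<and> cmod (u r - w) < B} x * ennreal (cmod (u' x)) \<partial>lborel)"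
  proof (rule nn_integral_mono_AE)
    show "AE x in lborel. ennreal (indicator {r0..r} x * cmod (u' x)) \<le>
        indicator {r. r0 < r \<and> r < r1 \<and> cmod (u r - w) < B} x * ennreal (cmod (u' x))"
      using AE_lborel_singleton[of r0] AE_lborel_singleton[of r]
    proof eventually_elim
      case (elim x)
      then show ?case using less[of x] r by (auto simp: indicator_def)
    qed
  qed
  finally show ?thesis .
qed

section \<open>The mapping in polar coordinates and its distance to the boundary\<close>

context qc_harmonic
begin

text \<open>The radial and the angular velocity are its values at \<open>(1,0)\<close> and
  \<open>(0,1)\<close>; their cross product is
  \<open>r * (\<bar>h'\<bar>^2 - \<bar>g'\<bar>^2)\<close>.\<close>

lemma has_derivative_polar:
  assumes r: "0 < r" "r < 1"
  shows "((\<lambda>p. f (rcis (fst p) (snd p))) has_derivative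
     (\<lambda>v. deriv h (rcis r y) * (of_real (fst v) * cis y + of_real r * (of_real (snd v) * (\<i> * cis y)))
        + cnj (deriv g (rcis r y) * (of_real (fst v) * cis y + of_real r * (of_real (snd v) * (\<i> * cis y)))))) (at (r, y))"
proof -
  have dc: "(cis has_derivative (\<lambda>v. of_real v * (\<i> * cis s))) (at s)" for s
    using has_vector_derivative_cis[of s] by (simp add: has_vector_derivative_def scaleR_conv_of_real)
  have dc2: "((\<lambda>p::real\<times>real. cis (snd p)) has_derivative (\<lambda>v. of_real (snd v) * (\<i> * cis y))) (at (r, y))"
    using has_derivative_compose[OF has_derivative_snd[OF has_derivative_ident], of cis "\<lambda>v. of_real v * (\<i> * cis y)" "(r, y)" UNIV] dc[of y]
    by simp
  have dr: "((\<lambda>p::real\<times>real. rcis (fst p) (snd p)) has_derivative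
      (\<lambda>v. of_real (fst v) * cis y + of_real r * (of_real (snd v) * (\<i> * cis y)))) (at (r, y))"
    unfolding rcis_def
    by (rule derivative_eq_intros dc2 refl | simp add: algebra_simps)+
  have zb: "rcis r y \<in> ball 0 1" using r by simp
  have dh: "((\<lambda>p::real\<times>real. u (rcis (fst p) (snd p))) has_derivative
      (\<lambda>v. deriv u (rcis r y) * (of_real (fst v) * cis y + of_real r * (of_real (snd v) * (\<i> * cis y))))) (at (r, y))"
    if "u holomorphic_on ball 0 1" for u
  proof -
    have "(u has_field_derivative deriv u (rcis r y)) (at (rcis r y))"
      using that zb by (auto intro!: holomorphic_derivI[where S="ball 0 1"])
    then have "(u has_derivative (*) (deriv u (rcis r y))) (at (rcis r y))"
      by (simp add: has_field_derivative_def)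
    from has_derivative_compose[OF dr, of u "(*) (deriv u (rcis r y))"] this show ?thesis by simp
  qed
  have sum: "((\<lambda>p::real\<times>real. h (rcis (fst p) (snd p)) + cnj (g (rcis (fst p) (snd p)))) has_derivative
     (\<lambda>v. deriv h (rcis r y) * (of_real (fst v) * cis y + of_real r * (of_real (snd v) * (\<i> * cis y)))
        + cnj (deriv g (rcis r y) * (of_real (fst v) * cis y + of_real r * (of_real (snd v) * (\<i> * cis y)))))) (at (r, y))"
    by (intro has_derivative_add dh hol_h hol_g has_derivative_cnj)
  show ?thesis
  proof (rule has_derivative_transform_within_open[OF sum])
    show "open ({0<..<1::real} \<times> (UNIV :: real set))" by (intro open_Times) auto
    show "(r, y) \<in> {0<..<1} \<times> UNIV" using r by simp
    fix p :: "real \<times> real" assume "p \<in> {0<..<1} \<times> UNIV"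
    then have "rcis (fst p) (snd p) \<in> ball 0 1" by auto
    then show "h (rcis (fst p) (snd p)) + cnj (g (rcis (fst p) (snd p))) = f (rcis (fst p) (snd p))"
      by (simp add: f_eq)
  qed
qed

lemma has_vector_derivative_radial:
  assumes r: "0 < r" "r < 1"
  shows "((\<lambda>r. f (rcis r y)) has_vector_derivative
     (deriv h (rcis r y) * cis y + cnj (deriv g (rcis r y) * cis y))) (at r)"
proof -
  have "((\<lambda>x. (x, y)) has_derivative (\<lambda>x. (x, 0))) (at r)"
    by (auto intro!: derivative_eq_intros)
  from has_derivative_compose[OF this has_derivative_polar[OF r]] show ?thesis
    unfolding has_vector_derivative_def fst_conv snd_conv
    by (rule has_derivative_eq_rhs) (auto simp: scaleR_conv_of_real algebra_simps)
qed

lemma has_vector_derivative_angular: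
  assumes r: "0 < r" "r < 1"
  shows "((\<lambda>y. f (rcis r y)) has_vector_derivative
     (of_real r * \<i> * (deriv h (rcis r y) * cis y - cnj (deriv g (rcis r y) * cis y)))) (at y)"
proof -
  have "((\<lambda>x. (r, x)) has_derivative (\<lambda>x. (0, x))) (at y)"
    by (auto intro!: derivative_eq_intros)
  from has_derivative_compose[OF this has_derivative_polar[OF r]] show ?thesis
    unfolding has_vector_derivative_def fst_conv snd_conv
    by (rule has_derivative_eq_rhs) (auto simp: scaleR_conv_of_real algebra_simps)
qed

lemma inj_on_polar_box:
  assumes "d \<le> pi"
  shows "inj_on (\<lambda>p. f (rcis (fst p) (snd p))) ({0<..<1} \<times> {y0-d<..<y0+d})"
proof (rule inj_onI)
  fix p q :: "real \<times> real"
  assume p: "p \<in> {0<..<1} \<times> {y0-d<..<y0+d}" and q: "q \<in> {0<..<1} \<times> {y0-d<..<y0+d}"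
    and eq: "f (rcis (fst p) (snd p)) = f (rcis (fst q) (snd q))"
  have "rcis (fst p) (snd p) \<in> ball 0 1" "rcis (fst q) (snd q) \<in> ball 0 1" using p q by auto
  then have e: "rcis (fst p) (snd p) = rcis (fst q) (snd q)" using inj eq by (auto dest: inj_onD)
  then have "cmod (rcis (fst p) (snd p)) = cmod (rcis (fst q) (snd q))" by simp
  then have 1: "fst p = fst q" using p q by auto
  moreover have "snd p = snd q" by (rule rcis_inj[of "fst p"]) (use p q e 1 assms in auto)
  ultimately show "p = q" by (simp add: prod_eq_iff)
qed

text \<open>If the distance \<open>D\<close> were large, then on the part of the polar box with \<open>1 - s d < \<bar>z\<bar>\<close> every radius
  would be mapped to a curve crossing an annulus of width \<open>D / 2\<close> in the disk of radius \<open>D\<close>. The area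
  available there allows this only if \<open>s\<close> is at least a constant multiple of \<open>1 / K\<close>.\<close>

lemma boundary_distance_le:
  assumes op: "open (f ` ball 0 1)"
    and inv: "continuous_on (f ` ball 0 1) f'" "\<And>z. z \<in> ball 0 1 \<Longrightarrow> f' (f z) = z"
    and d: "0 < d" "d \<le> 1/2"
  shows "infdist (f (rcis (1 - d) y0)) (frontier (f ` ball 0 1)) \<le> 16 * exp (384 * K) * d * E (rcis (1 - d) y0)"
proof (rule ccontr)
  define G where "G = f ` ball 0 1"
  define z0 where "z0 = rcis (1 - d) y0"
  define w where "w = f z0"
  define D where "D = infdist w (frontier G)"
  assume "\<not> ?thesis"
  then have D: "16 * exp (384 * K) * d * E z0 < D" by (simp add: D_def w_def z0_def G_def)
  have D0: "D > 0"
  proof -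
    have "0 < 16 * exp (384 * K) * d * E z0" using d E_pos by simp
    with D show ?thesis by linarith
  qed
  have z0b: "z0 \<in> ball 0 1" using d by (simp add: z0_def)
  then have wG: "w \<in> G" by (simp add: w_def G_def)
  \<comment> \<open>The relative width of the strip is chosen so that it contributes
    \<open>8 * K * s * d * D = 8/32 * d * D\<close> at the end. The area term contributes
    \<open>9/32 * d * D\<close>, and \<open>17/32 < 1\<close> is the contradiction.\<close>
  define s where "s = 1 / (32 * K)"
  have s: "0 < s" "s \<le> 1/32" using K by (auto simp: s_def field_simps)
  have sd: "0 < s * d" "s * d \<le> 1/2"
    using s d mult_mono[of s 1 d "1/2"] by auto
  define r0 where "r0 = 1 - s * d"
  have r0: "1/2 \<le> r0" "r0 < 1" using sd by (auto simp: r0_def)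
  define B where "B = 3 * D / 4"
  \<comment> \<open>Here both constants of the statement arise:
    \<open>6 / (1 - r0) * (2 * d) = 12 / s = 384 * K\<close>, and the Lipschitz bound
    \<open>4 * exp (384 * K) * d * E z0\<close> is at most \<open>D / 4\<close> by the assumed lower
    bound on \<open>D\<close>.\<close>
  have start: "cmod (f (rcis r0 y) - w) \<le> D / 4" if y: "\<bar>y - y0\<bar> \<le> d" for y
  proof -
    have sdd: "s * d \<le> d" using s d by (simp add: mult_le_cancel_right1)
    have "cmod (rcis r0 y - z0) \<le> \<bar>r0 - (1 - d)\<bar> + \<bar>1 - d\<bar> * \<bar>y - y0\<bar>"
      unfolding z0_def by (rule norm_rcis_diff_le)
    also have "\<dots> \<le> d + 1 * d"
      using sdd sd d y by (intro add_mono mult_mono) (auto simp: r0_def)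
    finally have d2: "cmod (rcis r0 y - z0) \<le> 2 * d" by simp
    have "cmod (f (rcis r0 y) - f z0) \<le> 2 * exp (384 * K) * E z0 * cmod (rcis r0 y - z0)"
    proof (rule f_Lipschitz[of r0])
      show "cmod z0 \<le> r0" using d sdd by (simp add: z0_def r0_def)
      have "6 / (1 - r0) * cmod (rcis r0 y - z0) \<le> 6 / (1 - r0) * (2 * d)"
        using d2 r0 by (intro mult_left_mono) auto
      also have "\<dots> = 384 * K" using d K s by (simp add: r0_def s_def field_simps)
      finally show "6 / (1 - r0) * cmod (rcis r0 y - z0) \<le> 384 * K" .
    qed (use r0 in auto)
    also have "\<dots> \<le> 2 * exp (384 * K) * E z0 * (2 * d)"
      using d2 E_pos[of z0] by (intro mult_left_mono) auto
    also have "\<dots> \<le> D / 4" using D by (simp add: mult_ac)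
    finally show ?thesis by (simp add: w_def)
  qed
  \<comment> \<open>The closed disk of radius \<open>B < D\<close> lies in the image, so its
    preimage is compact in the unit disk; near the unit circle \<open>f\<close> is outside this
    disk, uniformly in the angle.\<close>
  have far: "\<exists>\<rho><1. \<forall>r. \<rho> < r \<and> r < 1 \<longrightarrow> (\<forall>y. B \<le> cmod (f (rcis r y) - w))"
  proof -
    have "cball w B \<subseteq> ball w D" using D0 by (auto simp: B_def)
    then have cb: "cball w B \<subseteq> G" using ball_infdist_frontier_subset[OF wG] by (auto simp: D_def)
    have "compact (f' ` cball w B)"
      using inv(1) cb by (intro compact_continuous_image continuous_on_subset[OF inv(1)]) (auto simp: G_def)
    moreover have "f' ` cball w B \<subseteq> ball 0 1"
      using cb inv(2) by (force simp: G_def)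
    moreover have "f' ` cball w B \<noteq> {}" using D0 by (auto simp: B_def)
    ultimately obtain m where m: "m \<in> f' ` cball w B" "\<And>x. x \<in> f' ` cball w B \<Longrightarrow> cmod x \<le> cmod m"
      using continuous_attains_sup[of "f' ` cball w B" cmod] by (metis continuous_on_norm_id)
    show ?thesis
    proof (intro exI[of _ "cmod m"] conjI allI impI)
      show "cmod m < 1" using m(1) \<open>f' ` cball w B \<subseteq> ball 0 1\<close> by auto
      fix r y assume r: "cmod m < r \<and> r < 1"
      then have r0: "0 < r" using norm_ge_zero[of m] by linarith
      show "B \<le> cmod (f (rcis r y) - w)"
      proof (rule ccontr)
        assume "\<not> ?thesis"
        then have "f (rcis r y) \<in> cball w B" by (simp add: dist_norm norm_minus_commute)
        then have "f' (f (rcis r y)) \<in> f' ` cball w B" by blast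
        moreover have "f' (f (rcis r y)) = rcis r y" using r r0 by (intro inv) simp
        ultimately have "cmod (rcis r y) \<le> cmod m" using m(2) by metis
        then show False using r r0 by simp
      qed
    qed
  qed
  then obtain \<rho> where \<rho>: "\<rho> < 1" "\<And>r y. \<rho> < r \<Longrightarrow> r < 1 \<Longrightarrow> B \<le> cmod (f (rcis r y) - w)" by blast
  define r1 where "r1 = (max \<rho> r0 + 1) / 2"
  have r1: "r0 < r1" "\<rho> < r1" "r1 < 1" using r0 \<rho> by (auto simp: r1_def)
  define F where "F = (\<lambda>p. f (rcis (fst p) (snd p)))"
  define U where "U = {r0<..<r1} \<times> {y0-d<..<y0+d}"
  define S where "S = {p \<in> U. F p \<in> ball w B}"
  define F' where "F' = (\<lambda>p v. deriv h (rcis (fst p) (snd p)) * (of_real (fst v) * cis (snd p) + of_real (fst p) * (of_real (snd v) * (\<i> * cis (snd p))))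
        + cnj (deriv g (rcis (fst p) (snd p)) * (of_real (fst v) * cis (snd p) + of_real (fst p) * (of_real (snd v) * (\<i> * cis (snd p))))))"
  have U: "0 < fst p" "1/2 \<le> fst p" "fst p < 1" "rcis (fst p) (snd p) \<in> ball 0 1" if "p \<in> U" for p
    using that r0 r1 by (auto simp: U_def)
  have opU: "open U" unfolding U_def by (intro open_Times) auto
  have derF: "(F has_derivative F' p) (at p)" if "p \<in> U" for p
    using has_derivative_polar[of "fst p" "snd p"] U[OF that] unfolding F_def F'_def by simp
  have contF: "continuous_on U F"
    using derF by (meson has_derivative_at_withinI has_derivative_continuous_on)
  have opS: "open S" unfolding S_def
    using continuous_open_preimage[OF contF opU open_ball] by (simp add: vimage_def Int_def)
  have SU: "S \<subseteq> U" by (auto simp: S_def)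
  have injF: "inj_on F S" unfolding F_def
    by (rule inj_on_subset[OF inj_on_polar_box[of d y0]]) (use SU r0 r1 d pi_gt3 in \<open>auto simp: U_def\<close>)
  have FS: "F ` S \<subseteq> cball w B" by (auto simp: S_def)
  have cr: "continuous_on U (\<lambda>p. rcis (fst p) (snd p))"
    unfolding rcis_def by (intro continuous_intros)
  have cd: "continuous_on U (\<lambda>p. deriv u (rcis (fst p) (snd p)))" if "u holomorphic_on ball 0 1" for u
    by (rule continuous_on_deriv_compose[OF that open_ball cr]) (use U in auto)
  have cF': "continuous_on U (\<lambda>p. F' p v)" for v
    unfolding F'_def by (intro continuous_intros cd hol_h hol_g)
  define J where "J = (\<lambda>p. \<bar>Im (cnj (F' p (1,0)) * F' p (0,1))\<bar>)"
  have cJ: "continuous_on U J" unfolding J_def by (intro continuous_intros cF')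
  \<comment> \<open>The radial speed is at most \<open>\<bar>h'\<bar> + \<bar>g'\<bar>\<close>, so
    the dilatation inequality applies. The polar Jacobian has the extra factor
    \<open>fst p \<ge> 1/2\<close>, which costs the 2.\<close>
  have Jeq: "(cmod (F' p (1,0)))\<^sup>2 \<le> 2 * K * J p" if p: "p \<in> U" for p
  proof -
    define a where "a = deriv h (rcis (fst p) (snd p)) * cis (snd p)"
    define b where "b = cnj (deriv g (rcis (fst p) (snd p)) * cis (snd p))"
    have 1: "F' p (1,0) = a + b" by (simp add: F'_def a_def b_def)
    have 2: "F' p (0,1) = of_real (fst p) * \<i> * (a - b)" by (simp add: F'_def a_def b_def algebra_simps)
    have na: "cmod a = cmod (deriv h (rcis (fst p) (snd p)))" and nb: "cmod b = cmod (deriv g (rcis (fst p) (snd p)))"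
      by (simp_all add: a_def b_def norm_mult)
    have "Im (cnj (F' p (1,0)) * F' p (0,1)) = fst p * ((cmod a)\<^sup>2 - (cmod b)\<^sup>2)"
      unfolding 1 2 cmod_power2 by (simp add: algebra_simps power2_eq_square)
    then have J: "J p \<ge> fst p * ((cmod a)\<^sup>2 - (cmod b)\<^sup>2)" by (simp add: J_def)
    have "cmod a \<ge> cmod b" using norm_g'[OF U(4)[OF p]] norm_h'[OF U(4)[OF p]] na nb by simp
    then have ab: "(cmod a)\<^sup>2 - (cmod b)\<^sup>2 \<ge> 0" by (simp add: power_mono)
    have "(cmod (F' p (1,0)))\<^sup>2 \<le> (cmod a + cmod b)\<^sup>2"
      unfolding 1 by (intro power_mono norm_triangle_ineq) auto
    also have "\<dots> \<le> K * ((cmod a)\<^sup>2 - (cmod b)\<^sup>2)" using qc[OF U(4)[OF p]] na nb by simp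
    also have "\<dots> \<le> K * (2 * fst p * ((cmod a)\<^sup>2 - (cmod b)\<^sup>2))"
      using K ab U(2)[OF p] mult_right_mono[of 1 "2 * fst p" "(cmod a)\<^sup>2 - (cmod b)\<^sup>2"] by (intro mult_left_mono) auto
    also have "\<dots> \<le> 2 * K * J p" using J K by simp
    finally show ?thesis .
  qed
  have measJ: "(\<lambda>p. indicator S p * ennreal (J p)) \<in> borel_measurable borel"
  proof -
    have "(\<lambda>p. indicator S p *\<^sub>R J p) \<in> borel_measurable borel"
      using opS cJ SU by (intro borel_measurable_continuous_on_indicator continuous_on_subset[OF cJ]) auto
    then have "(\<lambda>p. ennreal (indicator S p *\<^sub>R J p)) \<in> borel_measurable borel" by simp
    then show ?thesis by (simp add: ennreal_mult' ennreal_indicator)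
  qed
  have measN: "(\<lambda>p. indicator S p * ennreal (cmod (F' p (1,0)))) \<in> borel_measurable borel"
  proof -
    have "(\<lambda>p. indicator S p *\<^sub>R cmod (F' p (1,0))) \<in> borel_measurable borel"
      using opS cF' SU by (intro borel_measurable_continuous_on_indicator continuous_intros continuous_on_subset[OF cF']) auto
    then have "(\<lambda>p. ennreal (indicator S p *\<^sub>R cmod (F' p (1,0)))) \<in> borel_measurable borel" by simp
    then show ?thesis by (simp add: ennreal_mult' ennreal_indicator)
  qed
  have area: "(\<integral>\<^sup>+p. indicator S p * ennreal (J p) \<partial>lborel) \<le> ennreal (4 * B\<^sup>2)"
    unfolding J_def
    by (rule nn_integral_Jacobian_le[OF opS derF injF FS measJ[unfolded J_def]]) (use SU in auto)
  \<comment> \<open>The weight in \<open>x \<le> x^2 / (2 * \<mu>) + \<mu> / 2\<close>, which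
    separates the length integral into an area term and the measure of the box.\<close>
  define \<mu> where "\<mu> = 8 * K * D / d"
  have \<mu>: "\<mu> > 0" using K D0 d by (simp add: \<mu>_def)
  have amgm: "cmod (F' p (1,0)) \<le> K / \<mu> * J p + \<mu> / 2" if p: "p \<in> U" for p
  proof -
    define x where "x = cmod (F' p (1,0))"
    have "0 \<le> (x - \<mu>)\<^sup>2" by simp
    then have "2 * \<mu> * x \<le> x\<^sup>2 + \<mu>\<^sup>2" by (simp add: power2_eq_square algebra_simps)
    also have "\<dots> \<le> 2 * K * J p + \<mu>\<^sup>2" using Jeq[OF p] by (simp add: x_def)
    also have "\<dots> = 2 * \<mu> * (K / \<mu> * J p + \<mu> / 2)" using \<mu> by (simp add: field_simps power2_eq_square)
    finally show ?thesis using \<mu> by (simp add: x_def)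
  qed
  have inner: "indicator {y0-d<..<y0+d} y * ennreal (D / 2) \<le> (\<integral>\<^sup>+r. indicator S (r, y) * ennreal (cmod (F' (r, y) (1,0))) \<partial>lborel)" for y
  proof (cases "y \<in> {y0-d<..<y0+d}")
    case True
    have st: "cmod (f (rcis r0 y) - w) \<le> D / 4" using True by (intro start) auto
    have "ennreal (B - D / 4) \<le> (\<integral>\<^sup>+r. indicator {r. r0 < r \<and> r < r1 \<and> cmod (f (rcis r y) - w) < B} r * ennreal (cmod (F' (r, y) (1,0))) \<partial>lborel)"
    proof (rule nn_integral_speed_until_exit_ge)
      show "((\<lambda>r. f (rcis r y)) has_vector_derivative F' (r, y) (1,0)) (at r)" if "r \<in> {r0..r1}" for r
        using has_vector_derivative_radial[of r y] that r0 r1 by (simp add: F'_def)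
      show "continuous_on {r0..r1} (\<lambda>r. F' (r, y) (1,0))"
      proof -
        have cdr: "continuous_on {r0..r1} (\<lambda>r. deriv u (rcis r y))" if "u holomorphic_on ball 0 1" for u
          using r0 r1 by (intro continuous_on_deriv_compose[OF that open_ball])
            (auto simp: rcis_def norm_mult intro!: continuous_intros)
        show ?thesis unfolding F'_def fst_conv snd_conv by (intro continuous_intros cdr hol_h hol_g)
      qed
      show "B \<le> cmod (f (rcis r1 y) - w)" using \<rho>(2) r1 by blast
    qed (use r1 st D0 in \<open>auto simp: B_def\<close>)
    also have "B - D / 4 = D / 2" by (simp add: B_def)
    also have "(\<integral>\<^sup>+r. indicator {r. r0 < r \<and> r < r1 \<and> cmod (f (rcis r y) - w) < B} r * ennreal (cmod (F' (r, y) (1,0))) \<partial>lborel)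
        = (\<integral>\<^sup>+r. indicator S (r, y) * ennreal (cmod (F' (r, y) (1,0))) \<partial>lborel)"
    proof (rule nn_integral_cong)
      fix r
      have "(r, y) \<in> S \<longleftrightarrow> r \<in> {r. r0 < r \<and> r < r1 \<and> cmod (f (rcis r y) - w) < B}"
        using True by (simp add: S_def U_def F_def dist_norm norm_minus_commute)
      then show "indicator {r. r0 < r \<and> r < r1 \<and> cmod (f (rcis r y) - w) < B} r * ennreal (cmod (F' (r, y) (1,0))) =
          indicator S (r, y) * ennreal (cmod (F' (r, y) (1,0)))"
        unfolding indicator_def by presburger
    qed
    finally show ?thesis using True by simp
  qed simp
  have "ennreal (d * D) = (\<integral>\<^sup>+y. indicator {y0-d<..<y0+d} y * ennreal (D / 2) \<partial>lborel)"
  proof -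
    have "(\<integral>\<^sup>+y. indicator {y0-d<..<y0+d} y * ennreal (D / 2) \<partial>lborel) = emeasure lborel {y0-d<..<y0+d} * ennreal (D / 2)"
      by (subst nn_integral_multc) auto
    also have "\<dots> = ennreal (2 * d) * ennreal (D / 2)" using d by simp
    also have "\<dots> = ennreal (2 * d * (D / 2))" by (rule ennreal_mult[symmetric]) (use d D0 in auto)
    finally show ?thesis by simp
  qed
  also have "\<dots> \<le> (\<integral>\<^sup>+y. (\<integral>\<^sup>+r. indicator S (r, y) * ennreal (cmod (F' (r, y) (1,0))) \<partial>lborel) \<partial>lborel)"
    by (intro nn_integral_mono inner)
  also have "\<dots> = (\<integral>\<^sup>+p. indicator S p * ennreal (cmod (F' p (1,0))) \<partial>(lborel \<Otimes>\<^sub>M lborel))"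
  proof (rule lborel_pair.nn_integral_snd)
    show "(\<lambda>p. indicator S p * ennreal (cmod (F' p (1,0)))) \<in> borel_measurable (lborel \<Otimes>\<^sub>M lborel)"
      unfolding lborel_prod measurable_lborel2 by (rule measN)
  qed
  also have "\<dots> = (\<integral>\<^sup>+p. indicator S p * ennreal (cmod (F' p (1,0))) \<partial>lborel)"
    by (simp add: lborel_prod)
  also have "\<dots> \<le> (\<integral>\<^sup>+p. ennreal (K / \<mu>) * (indicator S p * ennreal (J p)) + ennreal (\<mu> / 2) * indicator U p \<partial>lborel)"
  proof (rule nn_integral_mono)
    fix p
    show "indicator S p * ennreal (cmod (F' p (1,0))) \<le> ennreal (K / \<mu>) * (indicator S p * ennreal (J p)) + ennreal (\<mu> / 2) * indicator U p"
    proof (cases "p \<in> S")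
      case True
      then have pU: "p \<in> U" using SU by auto
      have "ennreal (cmod (F' p (1,0))) \<le> ennreal (K / \<mu> * J p + \<mu> / 2)"
        using amgm[OF pU] by (rule ennreal_leI)
      also have "\<dots> = ennreal (K / \<mu>) * ennreal (J p) + ennreal (\<mu> / 2)"
      proof -
        have J0: "0 \<le> J p" by (simp add: J_def)
        have "ennreal (K / \<mu> * J p + \<mu> / 2) = ennreal (K / \<mu> * J p) + ennreal (\<mu> / 2)"
          by (rule ennreal_plus) (use K \<mu> J0 in auto)
        also have "ennreal (K / \<mu> * J p) = ennreal (K / \<mu>) * ennreal (J p)"
          by (rule ennreal_mult) (use K \<mu> J0 in auto)
        finally show ?thesis .
      qed
      finally show ?thesis using True pU by simp
    qed simp
  qed
  also have "\<dots> = ennreal (K / \<mu>) * (\<integral>\<^sup>+p. indicator S p * ennreal (J p) \<partial>lborel) + ennreal (\<mu> / 2) * emeasure lborel U"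
  proof (subst nn_integral_add)
    show "(\<lambda>p. ennreal (K / \<mu>) * (indicator S p * ennreal (J p))) \<in> borel_measurable lborel"
      unfolding measurable_lborel2 using measJ by (rule borel_measurable_times_ennreal[OF borel_measurable_const])
    show "(\<lambda>p. ennreal (\<mu> / 2) * indicator U p) \<in> borel_measurable lborel" using opU by simp
    show "(\<integral>\<^sup>+p. ennreal (K / \<mu>) * (indicator S p * ennreal (J p)) \<partial>lborel) + (\<integral>\<^sup>+p. ennreal (\<mu> / 2) * indicator U p \<partial>lborel)
        = ennreal (K / \<mu>) * (\<integral>\<^sup>+p. indicator S p * ennreal (J p) \<partial>lborel) + ennreal (\<mu> / 2) * emeasure lborel U"
      using opU measJ by (simp add: nn_integral_cmult nn_integral_cmult_indicator)
  qed
  also have "emeasure lborel U = ennreal ((r1 - r0) * (2 * d))"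
  proof -
    have "emeasure lborel U = emeasure (lborel \<Otimes>\<^sub>M lborel) U" by (simp add: lborel_prod)
    also have "\<dots> = emeasure lborel {r0<..<r1} * emeasure lborel {y0-d<..<y0+d}"
      unfolding U_def by (rule lborel.emeasure_pair_measure_Times) auto
    finally show ?thesis using r1 d by (simp add: ennreal_mult')
  qed
  also have "ennreal (K / \<mu>) * (\<integral>\<^sup>+p. indicator S p * ennreal (J p) \<partial>lborel) + ennreal (\<mu> / 2) * ennreal ((r1 - r0) * (2 * d))
     \<le> ennreal (K / \<mu>) * ennreal (4 * B\<^sup>2) + ennreal (\<mu> / 2) * ennreal (s * d * (2 * d))"
  proof (rule add_mono)
    show "ennreal (K / \<mu>) * (\<integral>\<^sup>+p. indicator S p * ennreal (J p) \<partial>lborel) \<le> ennreal (K / \<mu>) * ennreal (4 * B\<^sup>2)"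
      using area by (rule mult_left_mono) simp
    have "(r1 - r0) * (2 * d) \<le> s * d * (2 * d)"
      using r1 d by (intro mult_right_mono) (auto simp: r0_def)
    then show "ennreal (\<mu> / 2) * ennreal ((r1 - r0) * (2 * d)) \<le> ennreal (\<mu> / 2) * ennreal (s * d * (2 * d))"
      by (intro mult_left_mono ennreal_leI) simp_all
  qed
  also have "\<dots> = ennreal (K / \<mu> * (4 * B\<^sup>2) + \<mu> / 2 * (s * d * (2 * d)))"
  proof -
    have "ennreal (K / \<mu>) * ennreal (4 * B\<^sup>2) = ennreal (K / \<mu> * (4 * B\<^sup>2))"
      by (rule ennreal_mult[symmetric]) (use K \<mu> in auto)
    moreover have "ennreal (\<mu> / 2) * ennreal (s * d * (2 * d)) = ennreal (\<mu> / 2 * (s * d * (2 * d)))"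
      by (rule ennreal_mult[symmetric]) (use \<mu> s d in auto)
    moreover have "0 \<le> K / \<mu> * (4 * B\<^sup>2)" "0 \<le> \<mu> / 2 * (s * d * (2 * d))"
      using K \<mu> s d by auto
    ultimately show ?thesis by (simp only: ennreal_plus)
  qed
  also have "K / \<mu> * (4 * B\<^sup>2) + \<mu> / 2 * (s * d * (2 * d)) = (17/32) * (d * D)"
  proof -
    have "K / \<mu> = d / (8 * D)" using K by (simp add: \<mu>_def)
    then have e1: "K / \<mu> * (4 * B\<^sup>2) = (9/32) * (d * D)"
      using D0 by (simp add: B_def power2_eq_square)
    have ms: "\<mu> * s = D / (4 * d)" using K by (simp add: \<mu>_def s_def)
    have "\<mu> / 2 * (s * d * (2 * d)) = (\<mu> * s) * (d * d)" by simp
    then have e2: "\<mu> / 2 * (s * d * (2 * d)) = (8/32) * (d * D)" unfolding ms using d by simp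
    show ?thesis unfolding e1 e2 by simp
  qed
  finally have "d * D \<le> (17/32) * (d * D)"
    using d D0 by (subst (asm) ennreal_le_iff) auto
  then show False using d D0 by simp
qed

end

subsection \<open>Arcs of circles\<close>

text \<open>As a function of \<open>a\<close> the integral has derivative
  \<open>u (a + p) - u a = 0\<close>. The margins in \<open>lo\<close> and \<open>hi\<close> keep
  all points of interest interior.\<close>

lemma integral_periodic:
  fixes u :: "real \<Rightarrow> real"
  assumes cont: "continuous_on UNIV u" and per: "\<And>x. u (x + p) = u x" and p: "p \<ge> 0"
  shows "integral {a..a+p} u = integral {0..p} u"
proof -
  define lo where "lo = min 0 a - 1"
  define hi where "hi = max 0 a + p + 1"
  obtain G where G: "\<And>x. x \<in> {lo..hi} \<Longrightarrow> (G has_vector_derivative u x) (at x within {lo..hi})"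
    using antiderivative_continuous[of lo hi u] continuous_on_subset[OF cont] by blast
  have Gat: "(G has_real_derivative u x) (at x)" if "lo < x" "x < hi" for x
    using G[of x] that by (simp add: has_real_derivative_iff_has_vector_derivative at_within_Icc_at)
  define \<phi> where "\<phi> = (\<lambda>x. G (x + p) - G x)"
  have int: "integral {x..x+p} u = \<phi> x" if "lo < x" "x + p < hi" for x
    unfolding \<phi>_def
  proof (rule integral_unique, rule fundamental_theorem_of_calculus)
    fix y assume "y \<in> {x..x+p}"
    then show "(G has_vector_derivative u y) (at y within {x..x+p})"
      using Gat[of y] that by (auto simp: has_real_derivative_iff_has_vector_derivative intro: has_vector_derivative_at_within)
  qed (use p in simp)
  have "\<exists>c. \<forall>x\<in>{lo<..<hi-p}. \<phi> x = c"
  proof (rule has_field_derivative_zero_constant)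
    fix x assume x: "x \<in> {lo<..<hi-p}"
    have "((\<lambda>x. G (x + p)) has_real_derivative u (x + p)) (at x)"
      using Gat[of "x + p"] x p by (simp add: DERIV_shift)
    then have "(\<phi> has_real_derivative (u (x + p) - u x)) (at x)"
      unfolding \<phi>_def using Gat[of x] x p by (intro DERIV_diff) auto
    then show "(\<phi> has_real_derivative 0) (at x within {lo<..<hi-p})"
      by (simp add: per has_field_derivative_at_within)
  qed auto
  moreover have "a \<in> {lo<..<hi-p}" "0 \<in> {lo<..<hi-p}" by (auto simp: lo_def hi_def)
  ultimately have "\<phi> a = \<phi> 0" by metis
  then show ?thesis using int[of a] int[of 0] p by (simp add: lo_def hi_def)
qed

text \<open>Adds the geometric hypotheses in the form in which they are used. From the John
  condition only the distance of the endpoints of a subarc is kept. The Pommerenke condition is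
  stated for a given crosscut \<open>A\<close> and with integrals of \<open>E\<close> in place of
  lengths, the comparison constant being absorbed in \<open>M\<close>.\<close>

locale qc_harmonic_John = qc_harmonic +
  fixes f' :: "complex \<Rightarrow> complex" and c M :: real
  assumes open_image: "open (f ` ball 0 1)"
    and bounded_image: "bounded (f ` ball 0 1)"
    and inv: "continuous_on (f ` ball 0 1) f'" "\<And>z. z \<in> ball 0 1 \<Longrightarrow> f' (f z) = z"
    and c: "c \<ge> 0" and M: "M \<ge> 0"
    and John: "\<And>z t. z \<in> ball 0 1 \<Longrightarrow> 0 \<le> t \<Longrightarrow> t \<le> 1 \<Longrightarrow>
       dist (f (of_real t * z)) (f z) \<le> c * infdist (f (of_real t * z)) (frontier (f ` ball 0 1))"
    and Pommerenke: "\<And>r a b A. 1/2 \<le> r \<Longrightarrow> r < 1 \<Longrightarrow> a < b \<Longrightarrow> b < a + 2 * pi \<Longrightarrow> arc A \<Longrightarrow>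
       pathstart A = f (rcis r a) \<Longrightarrow> pathfinish A = f (rcis r b) \<Longrightarrow>
       path_image A - {f (rcis r a), f (rcis r b)} \<subseteq> f ` ball 0 r \<Longrightarrow>
       min (integral {a..b} (\<lambda>y. exp (Re (L (rcis r y))))) (integral {b..a+2*pi} (\<lambda>y. exp (Re (L (rcis r y)))))
         \<le> M * diameter (path_image A)"
begin

text \<open>The first summand pays for the angular move at radius \<open>1 - d\<close>, the second
  for the radial move from there towards the circle. In the latter,
  \<open>16 * exp (384 * K)\<close> comes from \<open>boundary_distance_le\<close>, and
  \<open>exp 12\<close> compares \<open>E\<close> at the two points of radius
  \<open>1 - d\<close>.\<close>

definition box_const :: real where "box_const = 4 * exp 12 + c * 16 * exp (384 * K) * exp 12"

lemma box_const_nonneg: "0 \<le> box_const" using c by (simp add: box_const_def)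

text \<open>First change the angle at radius \<open>1 - d\<close>, where the Lipschitz bound is
  available, then move outwards along the radius. The second move may come arbitrarily close to the
  circle; the John condition controls it by the boundary distance at its inner end.\<close>

lemma f_box_le:
  assumes d: "0 < d" "d \<le> 1/2" and t: "1 - d \<le> t" "t < 1" and y: "\<bar>y - y0\<bar> \<le> d"
  shows "cmod (f (rcis t y) - f (rcis (1 - d) y0)) \<le> box_const * d * E (rcis (1 - d) y0)"
proof -
  let ?z0 = "rcis (1 - d) y0" and ?z1 = "rcis (1 - d) y"
  have "cmod (?z1 - ?z0) \<le> \<bar>(1 - d) - (1 - d)\<bar> + \<bar>1 - d\<bar> * \<bar>y - y0\<bar>"
    by (rule norm_rcis_diff_le)
  also have "\<dots> \<le> 1 * d" using d y by (simp only: diff_self abs_zero add_0) (intro mult_mono, auto)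
  finally have le: "cmod (?z1 - ?z0) \<le> d" by simp
  have A: "6 / (1 - (1 - d)) * cmod (?z1 - ?z0) \<le> 12"
  proof -
    have "6 / d * cmod (?z1 - ?z0) \<le> 6 / d * d" using le d by (intro mult_left_mono) auto
    then show ?thesis using d by simp
  qed
  have Ez1: "E ?z1 \<le> exp 12 * E ?z0"
    by (rule E_le_exp[of "1 - d"]) (use d A in \<open>auto simp: norm_minus_commute\<close>)
  have "cmod (f ?z1 - f ?z0) \<le> 2 * exp 12 * E ?z0 * cmod (?z1 - ?z0)"
    by (rule f_Lipschitz[of "1 - d"]) (use d A in auto)
  also have "\<dots> \<le> 2 * exp 12 * E ?z0 * d"
    using le E_pos[of ?z0] by (intro mult_left_mono) auto
  finally have 1: "cmod (f ?z1 - f ?z0) \<le> 2 * exp 12 * E ?z0 * d" .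
  have t0: "0 < t" using d t by linarith
  have z1: "?z1 = of_real ((1 - d) / t) * rcis t y" using t0 by (simp add: rcis_def)
  have "dist (f ?z1) (f (rcis t y)) \<le> c * infdist (f ?z1) (frontier (f ` ball 0 1))"
    unfolding z1 by (rule John) (use d t t0 in auto)
  also have "\<dots> \<le> c * (16 * exp (384 * K) * d * E ?z1)"
    using boundary_distance_le[OF open_image inv d, of y] c by (intro mult_left_mono) auto
  also have "\<dots> \<le> c * (16 * exp (384 * K) * d * (exp 12 * E ?z0))"
    using Ez1 c d by (intro mult_left_mono) auto
  finally have 2: "cmod (f (rcis t y) - f ?z1) \<le> c * (16 * exp (384 * K) * d * (exp 12 * E ?z0))"
    by (simp add: dist_norm norm_minus_commute)
  have "cmod (f (rcis t y) - f ?z0) \<le> cmod (f (rcis t y) - f ?z1) + cmod (f ?z1 - f ?z0)"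
    using norm_triangle_ineq[of "f (rcis t y) - f ?z1" "f ?z1 - f ?z0"] by simp
  also have "\<dots> \<le> c * (16 * exp (384 * K) * d * (exp 12 * E ?z0)) + 4 * exp 12 * E ?z0 * d"
  proof -
    have "2 * exp 12 * E ?z0 * d \<le> 4 * exp 12 * E ?z0 * d"
      using d E_pos[of ?z0] by (intro mult_right_mono) auto
    with 1 2 show ?thesis by linarith
  qed
  also have "\<dots> = box_const * d * E ?z0" by (simp add: box_const_def algebra_simps)
  finally show ?thesis .
qed

lemma continuous_on_f: "continuous_on (ball 0 1) f"
proof -
  have "continuous_on (ball 0 1) (\<lambda>z. h z + cnj (g z))"
    by (intro continuous_intros holomorphic_on_imp_continuous_on hol_h hol_g)
  then show ?thesis by (rule continuous_on_eq) (simp add: f_eq)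
qed

text \<open>The path dips below the circle by the parabola \<open>4 * \<eta> * x * (1 - x)\<close>,
  so only its endpoints have modulus \<open>r\<close> and its depth is at most \<eta>. An arc is
  then extracted from the image path, which has distinct ends because \<open>f\<close> is
  injective.\<close>

lemma obtain_crosscut:
  assumes r: "0 < \<eta>" "\<eta> < r" "r < 1" and ab: "a < b" "b < a + 2 * pi"
  obtains A where "arc A" "pathstart A = f (rcis r a)" "pathfinish A = f (rcis r b)"
    "path_image A - {f (rcis r a), f (rcis r b)} \<subseteq> f ` ball 0 r"
    "\<And>w. w \<in> path_image A \<Longrightarrow> \<exists>t y. r - \<eta> \<le> t \<and> t \<le> r \<and> a \<le> y \<and> y \<le> b \<and> w = f (rcis t y)"
proof -
  define m where "m = (\<lambda>x. r - \<eta> * (4 * x * (1 - x)))"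
  define q where "q = (\<lambda>x. rcis (m x) (a + x * (b - a)))"
  define p where "p = (\<lambda>x. f (q x))"
  have m: "r - \<eta> \<le> m x" "m x \<le> r" if "x \<in> {0..1}" for x
  proof -
    have "0 \<le> (1 - 2 * x)\<^sup>2" by simp
    then have "4 * x * (1 - x) \<le> 1" by (simp add: power2_eq_square algebra_simps)
    then have "\<eta> * (4 * x * (1 - x)) \<le> \<eta> * 1" using r by (intro mult_left_mono) auto
    then show "r - \<eta> \<le> m x" by (simp add: m_def)
    have "0 \<le> \<eta> * (4 * x * (1 - x))" using that r by auto
    then show "m x \<le> r" by (simp add: m_def)
  qed
  have m': "m x < r" if "0 < x" "x < 1" for x
  proof -
    have "0 < \<eta> * (4 * x * (1 - x))" using that r by simp
    then show ?thesis by (simp add: m_def)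
  qed
  have nq: "cmod (q x) = m x" if "x \<in> {0..1}" for x using m[OF that] r by (simp add: q_def)
  have qb: "q x \<in> ball 0 1" if "x \<in> {0..1}" for x using nq[OF that] m[OF that] r by simp
  have pth: "path p"
    unfolding path_def p_def
  proof (rule continuous_on_compose2[OF continuous_on_f])
    show "continuous_on {0..1} q" unfolding q_def m_def rcis_def by (intro continuous_intros)
  qed (use qb in auto)
  have ends: "pathstart p = f (rcis r a)" "pathfinish p = f (rcis r b)"
    by (simp_all add: pathstart_def pathfinish_def p_def q_def m_def)
  have ne: "f (rcis r a) \<noteq> f (rcis r b)"
    using inj rcis_inj[of r a b] r ab by (auto dest!: inj_onD)
  obtain A where A: "arc A" "path_image A \<subseteq> path_image p" "pathstart A = f (rcis r a)" "pathfinish A = f (rcis r b)"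
    using path_contains_arc[OF pth ends ne] by metis
  show thesis
  proof (rule that[OF A(1,3,4)])
    show "path_image A - {f (rcis r a), f (rcis r b)} \<subseteq> f ` ball 0 r"
    proof
      fix w assume w: "w \<in> path_image A - {f (rcis r a), f (rcis r b)}"
      then obtain x where x: "x \<in> {0..1}" "w = p x" using A(2) by (auto simp: path_image_def)
      have "x \<noteq> 0" "x \<noteq> 1" using w x ends by (auto simp: pathstart_def pathfinish_def)
      then have "q x \<in> ball 0 r" using x nq[OF x(1)] m'[of x] by simp
      then show "w \<in> f ` ball 0 r" using x by (simp add: p_def)
    qed
    fix w assume "w \<in> path_image A"
    then obtain x where x: "x \<in> {0..1}" "w = p x" using A(2) by (auto simp: path_image_def)
    show "\<exists>t y. r - \<eta> \<le> t \<and> t \<le> r \<and> a \<le> y \<and> y \<le> b \<and> w = f (rcis t y)"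
    proof (intro exI conjI)
      show "r - \<eta> \<le> m x" "m x \<le> r" using m x by auto
      show "a \<le> a + x * (b - a)" using x ab by simp
      have "x * (b - a) \<le> 1 * (b - a)" using x ab by (intro mult_right_mono) auto
      then show "a + x * (b - a) \<le> b" by simp
      show "w = f (rcis (m x) (a + x * (b - a)))" using x by (simp add: p_def q_def)
    qed
  qed
qed

lemma rcis_periodic: "rcis r (x + 2 * pi) = rcis r x"
  by (simp add: rcis_def cis_mult[symmetric])

text \<open>By monotonicity of the diameter, any bounded set \<open>W\<close> containing the image
  of the polar region can replace an explicit crosscut.\<close>

lemma Pommerenke_E:
  assumes "1/2 \<le> r" "r < 1" "a < b" "b < a + 2 * pi" "0 < \<eta>" "\<eta> < r"
    and W: "\<And>t y. r - \<eta> \<le> t \<Longrightarrow> t \<le> r \<Longrightarrow> a \<le> y \<Longrightarrow> y \<le> b \<Longrightarrow> f (rcis t y) \<in> W"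
    and diam: "bounded W" "diameter W \<le> d"
  shows "min (arc_int r a b) (arc_int r b (a+2*pi)) \<le> M * d"
proof -
  obtain A where A: "arc A" "pathstart A = f (rcis r a)" "pathfinish A = f (rcis r b)"
    "path_image A - {f (rcis r a), f (rcis r b)} \<subseteq> f ` ball 0 r"
    and pim: "\<And>w. w \<in> path_image A \<Longrightarrow> \<exists>t y. r - \<eta> \<le> t \<and> t \<le> r \<and> a \<le> y \<and> y \<le> b \<and> w = f (rcis t y)"
    using obtain_crosscut[OF assms(5,6,2,3,4)] by metis
  have "path_image A \<subseteq> W" using pim W by blast
  then have "diameter (path_image A) \<le> diameter W" using diam(1) by (intro diameter_subset)
  then have "M * diameter (path_image A) \<le> M * d" using M diam(2) by (intro mult_left_mono) auto
  with Pommerenke[OF assms(1-4) A] show ?thesis unfolding E_def by linarith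
qed

lemma integral_E_split:
  assumes "0 \<le> r" "r < 1" "a \<le> b" "b \<le> a + 2 * pi"
  shows "arc_int r a b + arc_int r b (a+2*pi) = arc_int r 0 (2*pi)"
proof -
  have "arc_int r a b + arc_int r b (a+2*pi) = arc_int r a (a+2*pi)"
    using assms by (intro Henstock_Kurzweil_Integration.integral_combine E_rcis_integrable)
  also have "\<dots> = arc_int r 0 (2*pi)"
    using assms by (intro integral_periodic continuous_on_E_rcis) (auto simp: rcis_periodic)
  finally show ?thesis .
qed

definition length_bound :: real where "length_bound = 2 * (M * diameter (f ` ball 0 1))"

text \<open>Cut the image of the circle into two arcs of equal length: neither is longer than the other, so
  the Pommerenke condition applies to both.\<close>

lemma total_length_le:
  assumes r: "1/2 \<le> r" "r < 1"
  shows "arc_int r 0 (2*pi) \<le> length_bound"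
proof -
  define \<Phi> where "\<Phi> = (\<lambda>x. arc_int r 0 x)"
  define T where "T = \<Phi> (2 * pi)"
  have intg: "(\<lambda>y. E (rcis r y)) integrable_on {x..v}" for x v using r by (intro E_rcis_integrable) auto
  have pos: "0 < T"
  proof -
    have cE: "continuous_on {0..2*pi} (\<lambda>y. E (rcis r y))" using r by (intro continuous_on_E_rcis) auto
    have "T \<noteq> 0"
    proof
      assume "T = 0"
      then have all: "\<forall>x\<in>{0..2*pi}. E (rcis r x) = 0"
        using integral_eq_0_iff[OF cE] E_pos by (auto simp: T_def \<Phi>_def less_imp_le)
      have "E (rcis r 0) = 0" by (rule bspec[OF all]) simp
      then show False using E_pos[of "rcis r 0"] by simp
    qed
    moreover have "T \<ge> 0" unfolding T_def \<Phi>_def by (rule integral_nonneg[OF intg]) (simp add: E_pos less_imp_le)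
    ultimately show ?thesis by simp
  qed
  have "\<exists>b\<ge>0. b \<le> 2 * pi \<and> \<Phi> b = T / 2"
  proof (rule IVT')
    show "continuous_on {0..2*pi} \<Phi>" unfolding \<Phi>_def by (rule indefinite_integral_continuous_1[OF intg])
    show "\<Phi> 0 \<le> T / 2" "T / 2 \<le> \<Phi> (2 * pi)" using pos by (auto simp: \<Phi>_def T_def)
  qed simp
  then obtain b where b: "0 \<le> b" "b \<le> 2 * pi" "\<Phi> b = T / 2" by blast
  have "b \<noteq> 0" "b \<noteq> 2 * pi" using b(3) pos by (auto simp: \<Phi>_def T_def)
  then have b': "0 < b" "b < 0 + 2 * pi" using b by auto
  have "arc_int r 0 b + arc_int r b (0+2*pi) = T"
    unfolding T_def \<Phi>_def using b' r by (intro integral_E_split) auto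
  then have "arc_int r b (0+2*pi) = T / 2" using b(3) by (simp add: \<Phi>_def)
  \<comment> \<open>Any crosscut serves here, since the diameter of the whole image is used as the
    bound.\<close>
  moreover have "min (arc_int r 0 b) (arc_int r b (0+2*pi)) \<le> M * diameter (f ` ball 0 1)"
  proof (rule Pommerenke_E[OF r b'])
    show "0 < r / 2" "r / 2 < r" using r by auto
    fix t y assume "r - r / 2 \<le> t" "t \<le> r"
    then show "f (rcis t y) \<in> f ` ball 0 1" using r by (intro imageI) auto
  qed (use bounded_image in auto)
  ultimately have "T / 2 \<le> M * diameter (f ` ball 0 1)" using b(3) by (simp add: \<Phi>_def)
  then show ?thesis by (simp add: length_bound_def T_def \<Phi>_def)
qed

section \<open>Jensen's inequality and the complement of a short arc\<close>

lemma has_integral_L_circle: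
  assumes r: "0 < r" "r < 1"
  shows "((\<lambda>y. Re (L (rcis r y))) has_integral 2 * pi * Re (L 0)) {0..2*pi}"
proof -
  have sub: "cball 0 r \<subseteq> (ball 0 1 :: complex set)" using r by auto
  have "((\<lambda>u. L u / (u - 0)) has_contour_integral (2 * of_real pi * \<i> * L 0)) (circlepath 0 r)"
    using r sub by (intro Cauchy_integral_circlepath continuous_on_subset[OF holomorphic_on_imp_continuous_on[OF hol_L]]
        holomorphic_on_subset[OF hol_L]) auto
  then have "((\<lambda>t. L (0 + r * cis t) / (0 + r * cis t - 0) * r * \<i> * cis t) has_integral (2 * of_real pi * \<i> * L 0)) {0..2*pi}"
    unfolding circlepath_def by (subst (asm) has_contour_integral_part_circlepath_iff) auto
  then have "((\<lambda>t. \<i> * L (rcis r t)) has_integral (2 * of_real pi * \<i> * L 0)) {0..2*pi}"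
    by (rule has_integral_eq[rotated]) (use r in \<open>simp add: rcis_def\<close>)
  from has_integral_linear[OF this bounded_linear_Im] show ?thesis by (simp add: o_def)
qed

definition arc_lower_bound :: real where "arc_lower_bound = exp (- \<bar>length_bound - 2 * pi * Re (L 0)\<bar>)"

lemma arc_lower_bound_pos: "arc_lower_bound > 0" by (simp add: arc_lower_bound_def)

lemma length_bound_nonneg: "length_bound \<ge> 0"
  using M diameter_ge_0[OF bounded_image] by (simp add: length_bound_def)

text \<open>The mean of \<open>Re L\<close> over the circle is fixed at \<open>Re (L 0)\<close>. On
  the short arc \<open>Re L \<le> E\<close> contributes at most \<open>length_bound\<close>; on the
  rest the tangent line inequality gives \<open>Re L \<le> exp X * E - (X + 1)\<close>. The rest has
  angular length at least 1, so with \<open>X\<close> as chosen the constants leave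
  \<open>1 \<le> exp X\<close> times the integral of \<open>E\<close> over it.\<close>

lemma complementary_arc_ge:
  assumes r: "1/2 \<le> r" "r < 1" and ab: "a \<le> b" "b \<le> a + 1"
  shows "arc_lower_bound \<le> arc_int r b (a+2*pi)"
proof -
  define X where "X = \<bar>length_bound - 2 * pi * Re (L 0)\<bar>"
  have bp: "b \<le> a + 2 * pi" using ab pi_gt3 by linarith
  have iL: "(\<lambda>y. Re (L (rcis r y))) integrable_on {x..v}" for x v
    using r by (intro integrable_continuous_interval continuous_intros continuous_on_L_rcis) auto
  have iE: "(\<lambda>y. E (rcis r y)) integrable_on {x..v}" for x v using r by (intro E_rcis_integrable) auto
  have "2 * pi * Re (L 0) = integral {0..2*pi} (\<lambda>y. Re (L (rcis r y)))"
    using integral_unique[OF has_integral_L_circle[of r]] r by simp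
  also have "\<dots> = integral {a..a+2*pi} (\<lambda>y. Re (L (rcis r y)))"
    using r by (intro integral_periodic[symmetric] continuous_intros continuous_on_L_rcis) (auto simp: rcis_periodic)
  also have "\<dots> = integral {a..b} (\<lambda>y. Re (L (rcis r y))) + integral {b..a+2*pi} (\<lambda>y. Re (L (rcis r y)))"
    using ab bp by (intro Henstock_Kurzweil_Integration.integral_combine[symmetric] iL)
  also have "\<dots> \<le> arc_int r a b + integral {b..a+2*pi} (\<lambda>y. exp X * E (rcis r y) - (X + 1))"
  proof (intro add_mono integral_le iL iE)
    show "(\<lambda>y. exp X * E (rcis r y) - (X + 1)) integrable_on {b..a+2*pi}"
      using r by (intro integrable_continuous_interval continuous_intros continuous_on_E_rcis) auto
    fix y
    show "Re (L (rcis r y)) \<le> E (rcis r y)"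
      using exp_ge_add_one_self[of "Re (L (rcis r y))"] unfolding E_def by linarith
    show "Re (L (rcis r y)) \<le> exp X * E (rcis r y) - (X + 1)"
      using exp_ge_add_one_self[of "X + Re (L (rcis r y))"] by (simp add: E_def exp_add)
  qed
  also have "integral {b..a+2*pi} (\<lambda>y. exp X * E (rcis r y) - (X + 1)) =
      exp X * arc_int r b (a+2*pi) - (a + 2 * pi - b) * (X + 1)"
    using bp by (subst Henstock_Kurzweil_Integration.integral_diff)
      (auto intro!: integrable_on_cmult_left iE integrable_const_ivl)
  also have "arc_int r a b \<le> length_bound"
  proof -
    have "0 \<le> arc_int r b (a+2*pi)"
      by (rule integral_nonneg[OF iE]) (simp add: E_pos less_imp_le)
    then show ?thesis using integral_E_split[of r a b] total_length_le[OF r] r ab bp by simp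
  qed
  finally have "2 * pi * Re (L 0) \<le> length_bound + (exp X * arc_int r b (a+2*pi) - (a + 2 * pi - b) * (X + 1))"
    by simp
  moreover have "X + 1 \<le> (a + 2 * pi - b) * (X + 1)"
    using ab pi_gt3 mult_right_mono[of 1 "a + 2 * pi - b" "X + 1"] by (simp add: X_def)
  moreover have "2 * pi * Re (L 0) - length_bound + X \<ge> 0" by (simp add: X_def)
  ultimately have "1 \<le> exp X * arc_int r b (a+2*pi)" by linarith
  then have "1 / exp X \<le> arc_int r b (a+2*pi)"
    by (simp add: divide_le_eq mult.commute)
  then show ?thesis by (simp add: arc_lower_bound_def X_def[symmetric] exp_minus inverse_eq_divide)
qed

definition arc_const :: real where "arc_const = 2 * M * box_const * (1 + length_bound / arc_lower_bound)"

lemma arc_const_nonneg: "arc_const \<ge> 0"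
  using M box_const_nonneg length_bound_nonneg arc_lower_bound_pos by (simp add: arc_const_def)

text \<open>If the arc about \<open>y0\<close> has the smaller integral, the Pommerenke bound
  applies to it directly. Otherwise it applies to the complement, so
  \<open>arc_lower_bound \<le> 2 * M * R\<close> where \<open>R\<close> is the radius from
  \<open>f_box_le\<close>; the trivial bound \<open>length_bound\<close> is then at most
  \<open>length_bound / arc_lower_bound\<close> times \<open>2 * M * R\<close>.\<close>

lemma arc_integral_le:
  assumes d: "0 < d" "d \<le> 1/2" and r: "1 - d < r" "r < 1"
  shows "arc_int r (y0-d) (y0+d) \<le> arc_const * d * E (rcis (1 - d) y0)"
proof -
  let ?z0 = "rcis (1 - d) y0"
  define S1 where "S1 = arc_int r (y0-d) (y0+d)"
  define S2 where "S2 = arc_int r (y0+d) (y0-d+2*pi)"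
  have r2: "1/2 \<le> r" using d r by linarith
  have lt: "y0 - d < y0 + d" "y0 + d < y0 - d + 2 * pi" using d pi_gt3 by linarith+
  define R where "R = box_const * d * E ?z0"
  have R0: "R \<ge> 0" using box_const_nonneg d E_pos[of ?z0] by (simp add: R_def)
  \<comment> \<open>With depth \<open>r - (1 - d)\<close> the crosscut stays between the radii
    \<open>1 - d\<close> and \<open>r\<close>, that is, in the box treated by
    \<open>f_box_le\<close>.\<close>
  have mn: "min S1 S2 \<le> M * (2 * R)"
    unfolding S1_def S2_def
  proof (rule Pommerenke_E[OF r2 r(2) lt, where W="cball (f ?z0) R" and \<eta>="r - (1 - d)"])
    show "0 < r - (1 - d)" "r - (1 - d) < r" using r d by auto
    show "bounded (cball (f ?z0) R)" by simp
    show "diameter (cball (f ?z0) R) \<le> 2 * R" using R0 by (simp add: diameter_cball)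
    fix t y assume "r - (r - (1 - d)) \<le> t" "t \<le> r" "y0 - d \<le> y" "y \<le> y0 + d"
    then have "cmod (f (rcis t y) - f ?z0) \<le> R"
      unfolding R_def using d r by (intro f_box_le) auto
    then show "f (rcis t y) \<in> cball (f ?z0) R" by (simp add: dist_norm norm_minus_commute)
  qed
  have S2c: "arc_lower_bound \<le> S2" unfolding S2_def using r2 r d by (intro complementary_arc_ge) auto
  have "S1 + S2 \<le> length_bound"
    unfolding S1_def S2_def using integral_E_split[of r "y0 - d" "y0 + d"] lt r r2 total_length_le[OF r2 r(2)] by simp
  then have S1T: "S1 \<le> length_bound" using S2c arc_lower_bound_pos by linarith
  have "S1 \<le> M * (2 * R) * (1 + length_bound / arc_lower_bound)"
  proof (cases "S1 \<le> S2")
    case True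
    then have "S1 \<le> M * (2 * R)" using mn by simp
    also have "\<dots> \<le> M * (2 * R) * (1 + length_bound / arc_lower_bound)"
    proof -
      have "1 \<le> 1 + length_bound / arc_lower_bound" using length_bound_nonneg arc_lower_bound_pos by simp
      moreover have "0 \<le> M * (2 * R)" using M R0 by simp
      ultimately have "M * (2 * R) * 1 \<le> M * (2 * R) * (1 + length_bound / arc_lower_bound)" by (rule mult_left_mono)
      then show ?thesis by simp
    qed
    finally show ?thesis .
  next
    case False
    then have s2: "S2 \<le> M * (2 * R)" using mn by simp
    have "S1 \<le> length_bound / arc_lower_bound * arc_lower_bound" using S1T arc_lower_bound_pos by simp
    also have "\<dots> \<le> length_bound / arc_lower_bound * (M * (2 * R))"
      using S2c s2 length_bound_nonneg arc_lower_bound_pos by (intro mult_left_mono) auto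
    also have "\<dots> \<le> M * (2 * R) * (1 + length_bound / arc_lower_bound)"
      using M R0 by (simp add: algebra_simps)
    finally show ?thesis .
  qed
  also have "\<dots> = arc_const * d * E ?z0" by (simp add: arc_const_def R_def)
  finally show ?thesis by (simp add: S1_def)
qed

end

subsection \<open>Poisson averages\<close>

text \<open>From \<open>\<bar>sin x - x\<bar> \<le> \<bar>x\<bar>^3 / 6\<close> and
  \<open>x^2 \<le> 4\<close>. The range includes half of any angle up to \<open>pi\<close>.\<close>

lemma abs_sin_ge_third:
  fixes x :: real
  assumes "\<bar>x\<bar> \<le> 2"
  shows "\<bar>x\<bar> / 3 \<le> \<bar>sin x\<bar>"
proof -
  have "(\<Sum>m<3. sin_coeff m * x ^ m) = x" by (simp add: eval_nat_numeral sin_coeff_def)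
  then have "\<bar>sin x - x\<bar> \<le> \<bar>x\<bar> ^ 3 / 6"
    using Maclaurin_sin_bound[of x 3] by (simp add: eval_nat_numeral)
  moreover have "\<bar>x\<bar> ^ 3 \<le> 4 * \<bar>x\<bar>"
  proof -
    have "\<bar>x\<bar> ^ 2 \<le> 2 ^ 2" using assms by (intro power_mono) auto
    then have "\<bar>x\<bar> * \<bar>x\<bar> ^ 2 \<le> \<bar>x\<bar> * 4" by (intro mult_left_mono) auto
    then show ?thesis by (simp add: eval_nat_numeral)
  qed
  moreover have "\<bar>x\<bar> \<le> \<bar>sin x\<bar> + \<bar>sin x - x\<bar>" by linarith
  ultimately show ?thesis by simp
qed

definition Poisson_kernel :: "complex \<Rightarrow> complex \<Rightarrow> real" where
  "Poisson_kernel \<zeta> \<xi> = (1 - (cmod \<zeta>)\<^sup>2) / (cmod (\<xi> - \<zeta>))\<^sup>2"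

lemma Poisson_kernel_nonneg: "cmod \<zeta> \<le> 1 \<Longrightarrow> 0 \<le> Poisson_kernel \<zeta> \<xi>"
  by (simp add: Poisson_kernel_def power_le_one)

text \<open>The numerator is at most \<open>2 * d\<close>. The denominator is at least
  \<open>d^2\<close>, and away from \<open>y0\<close> at least \<open>2 * (x / 6)^2\<close>, by the
  half-angle form of the distance and \<open>abs_sin_ge_third\<close>; this gives the 36.\<close>

lemma Poisson_kernel_le:
  assumes d: "0 < d" "d \<le> 1"
  shows "Poisson_kernel (rcis (1 - d) y0) (cis y) \<le> 2 / d"
    and "d \<le> 1/2 \<Longrightarrow> \<bar>y - y0\<bar> \<le> pi \<Longrightarrow> x > 0 \<Longrightarrow> x \<le> \<bar>y - y0\<bar> \<Longrightarrow> Poisson_kernel (rcis (1 - d) y0) (cis y) \<le> 36 * d / x\<^sup>2"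
proof -
  let ?N = "(cmod (cis y - rcis (1 - d) y0))\<^sup>2"
  have N: "?N = d\<^sup>2 + 4 * (1 - d) * (sin ((y - y0) / 2))\<^sup>2"
    using norm_cis_minus_scaled_cis[of y "1 - d" y0] by simp
  have num: "1 - (cmod (rcis (1 - d) y0))\<^sup>2 \<le> 2 * d"
    using d by (simp add: power2_eq_square algebra_simps)
  have num0: "0 \<le> 1 - (cmod (rcis (1 - d) y0))\<^sup>2"
    using d by (simp add: power_le_one)
  have "?N \<ge> d\<^sup>2" unfolding N using d by simp
  then have "Poisson_kernel (rcis (1 - d) y0) (cis y) \<le> 2 * d / d\<^sup>2"
    unfolding Poisson_kernel_def using num num0 d by (intro frac_le) auto
  then show "Poisson_kernel (rcis (1 - d) y0) (cis y) \<le> 2 / d"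
    using d by (simp add: power2_eq_square)
  assume d2: "d \<le> 1/2" and pi: "\<bar>y - y0\<bar> \<le> pi" and x: "x > 0" "x \<le> \<bar>y - y0\<bar>"
  have "x / 6 \<le> \<bar>(y - y0) / 2\<bar> / 3" using x by simp
  also have "\<dots> \<le> \<bar>sin ((y - y0) / 2)\<bar>" using pi pi_less_4 by (intro abs_sin_ge_third) auto
  finally have "(x / 6)\<^sup>2 \<le> \<bar>sin ((y - y0) / 2)\<bar>\<^sup>2" using x by (intro power_mono) auto
  then have "2 * (x / 6)\<^sup>2 \<le> 2 * (sin ((y - y0) / 2))\<^sup>2" by simp
  also have "\<dots> \<le> 4 * (1 - d) * (sin ((y - y0) / 2))\<^sup>2"
    using d2 by (intro mult_right_mono) auto
  also have "\<dots> \<le> ?N" unfolding N by simp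
  finally have "2 * (x / 6)\<^sup>2 \<le> ?N" .
  then have "Poisson_kernel (rcis (1 - d) y0) (cis y) \<le> 2 * d / (2 * (x / 6)\<^sup>2)"
    unfolding Poisson_kernel_def using num num0 d x by (intro frac_le) auto
  then show "Poisson_kernel (rcis (1 - d) y0) (cis y) \<le> 36 * d / x\<^sup>2"
    by (simp add: power_divide)
qed

lemma finite_dyadic_scales: "d > 0 \<Longrightarrow> finite {j::nat. 2 ^ j * d \<le> (1/2::real)}"
proof -
  assume d: "d > 0"
  obtain n :: nat where n: "1 / (2 * d) < 2 ^ n" using real_arch_pow[of 2 "1 / (2 * d)"] by auto
  have "{j::nat. 2 ^ j * d \<le> (1/2::real)} \<subseteq> {..n}"
  proof
    fix j assume "j \<in> {j::nat. 2 ^ j * d \<le> (1/2::real)}"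
    then have "(2::real) ^ j \<le> 1 / (2 * d)" using d by (simp add: field_simps)
    then have "(2::real) ^ j < 2 ^ n" using n by linarith
    then show "j \<in> {..n}" by simp
  qed
  then show ?thesis by (rule finite_subset) simp
qed

text \<open>A single summand suffices, the one for the least \<open>j\<close> with
  \<open>\<bar>y - y0\<bar> \<le> 2^j * d\<close>: minimality bounds the angle below by
  \<open>2^(j - 1) * d\<close>, and \<open>144 = 36 * 4\<close>. Only scales up to
  \<open>1/2\<close> are allowed, as \<open>arc_integral_le\<close> demands; angles up to
  \<open>1/4\<close> need no larger ones. For larger angles
  \<open>36 * d / (1/4)^2 = 576 * d\<close> takes over, and this term also covers
  \<open>d > 1/2\<close>, where the sum is empty.\<close>

lemma Poisson_kernel_dyadic_le:
  assumes d: "0 < d" "d \<le> 1" and y: "\<bar>y - y0\<bar> \<le> pi"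
  shows "Poisson_kernel (rcis (1 - d) y0) (cis y) \<le>
     (\<Sum>j\<in>{j::nat. 2 ^ j * d \<le> 1/2}. 144 * (1/4) ^ j / d * (if y \<in> {y0 - 2 ^ j * d..y0 + 2 ^ j * d} then 1 else 0)) + 576 * d"
    (is "?P \<le> sum ?t ?J + _")
proof -
  have fin: "finite ?J" using finite_dyadic_scales[OF d(1)] .
  have nn: "0 \<le> ?t j" for j using d by auto
  have sn: "0 \<le> sum ?t ?J" by (intro sum_nonneg nn)
  show ?thesis
  proof (cases "d \<le> 1/2")
    case False
    have "?P \<le> 2 / d" by (rule Poisson_kernel_le(1)[OF d])
    also have "\<dots> \<le> 576 * d"
    proof -
      have "1/2 * (1/2) \<le> d * d" using False by (intro mult_mono) auto
      then show ?thesis using d by (simp add: field_simps)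
    qed
    finally show ?thesis using sn by linarith
  next
    case d2: True
    show ?thesis
    proof (cases "\<bar>y - y0\<bar> \<le> 1/4")
      case False
      have "?P \<le> 36 * d / (1/4)\<^sup>2" using False by (intro Poisson_kernel_le(2)[OF d d2 y]) auto
      also have "\<dots> = 576 * d" by (simp add: power2_eq_square)
      finally show ?thesis using sn by linarith
    next
      case True
      define j where "j = (LEAST j::nat. \<bar>y - y0\<bar> \<le> 2 ^ j * d)"
      have ex: "\<exists>j::nat. \<bar>y - y0\<bar> \<le> 2 ^ j * d"
      proof -
        obtain n :: nat where "\<bar>y - y0\<bar> / d < 2 ^ n" using real_arch_pow[of 2 "\<bar>y - y0\<bar> / d"] by auto
        then show ?thesis using d by (intro exI[of _ n]) (simp add: field_simps)
      qed
      have j: "\<bar>y - y0\<bar> \<le> 2 ^ j * d" unfolding j_def by (rule LeastI_ex[OF ex])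
      have tj: "j \<in> ?J \<and> ?P \<le> 144 * (1/4) ^ j / d"
      proof (cases j)
        case 0
        have "?P \<le> 2 / d" by (rule Poisson_kernel_le(1)[OF d])
        also have "\<dots> \<le> 144 / d" using d by (simp add: divide_right_mono)
        finally show ?thesis using 0 d2 by simp
      next
        case (Suc i)
        have gt: "2 ^ i * d < \<bar>y - y0\<bar>"
          using not_less_Least[of i "\<lambda>j. \<bar>y - y0\<bar> \<le> 2 ^ j * d"] Suc by (simp add: j_def[symmetric])
        have "?P \<le> 36 * d / (2 ^ i * d)\<^sup>2" using gt d by (intro Poisson_kernel_le(2)[OF d d2 y]) auto
        also have "\<dots> = 144 * (1/4) ^ j / d"
          using d by (simp add: Suc power2_eq_square power_divide power_mult_distrib[symmetric] field_simps)
        finally show ?thesis using gt True Suc by simp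
      qed
      have "?P \<le> ?t j" using tj j by auto
      also have "\<dots> \<le> sum ?t ?J" using tj fin nn by (intro member_le_sum) auto
      finally show ?thesis using d by linarith
    qed
  qed
qed

context qc_harmonic_John
begin

text \<open>The first summand is the geometric series over dyadic arcs, with 144 from the kernel and
  8 from \<open>E_radial_growth\<close>. The second pays for the remainder \<open>576 * d\<close>,
  through \<open>d \<le> 8 * E \<zeta> / E 0\<close>.\<close>

definition Poisson_const :: real where "Poisson_const = 144 * 8 * arc_const / (1 - 2 powr (\<alpha> - 2)) + 576 * length_bound * 8 / E 0"

lemma Poisson_integral_E_le:
  assumes d: "0 < d" "d \<le> 1" and r: "1/2 \<le> r" "1 - d < r" "r < 1"
  shows "integral {0..2*pi} (\<lambda>y. E (rcis r y) * Poisson_kernel (rcis (1 - d) y0) (cis y)) \<le> Poisson_const * E (rcis (1 - d) y0)"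
proof -
  define \<zeta> where "\<zeta> = rcis (1 - d) y0"
  define J where "J = {j::nat. 2 ^ j * d \<le> 1/2}"
  have finJ: "finite J" unfolding J_def by (rule finite_dyadic_scales[OF d(1)])
  define I where "I = (\<lambda>j::nat. {y0 - 2 ^ j * d..y0 + 2 ^ j * d})"
  \<comment> \<open>A period centred at \<open>y0\<close>, so that all angles differ from
    \<open>y0\<close> by at most \<open>pi\<close>.\<close>
  define a where "a = y0 - pi"
  have neq: "cis y \<noteq> \<zeta>" for y
  proof
    assume "cis y = \<zeta>"
    then have "cmod (cis y) = cmod \<zeta>" by simp
    then show False using d by (simp add: \<zeta>_def)
  qed
  have contP: "continuous_on A (\<lambda>y. Poisson_kernel \<zeta> (cis y))" for A
    unfolding Poisson_kernel_def using neq by (intro continuous_intros) auto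
  have contE: "continuous_on A (\<lambda>y. E (rcis r y))" for A
    using r by (intro continuous_on_E_rcis) auto
  have intE: "(\<lambda>y. E (rcis r y)) integrable_on {x..v}" for x v
    using r by (intro E_rcis_integrable) auto
  have Isub: "I j \<subseteq> {a..a+2*pi}" if "j \<in> J" for j
    using that pi_gt3 by (auto simp: I_def J_def a_def)
  have hI: "((\<lambda>y. if y \<in> I j then E (rcis r y) else 0) has_integral integral (I j) (\<lambda>y. E (rcis r y))) {a..a+2*pi}" if "j \<in> J" for j
    unfolding has_integral_restrict[OF Isub[OF that]] unfolding I_def by (intro integrable_integral intE)
  define w where "w = (\<lambda>j. 144 * (1/4) ^ j / d)"
  have hB: "((\<lambda>y. (\<Sum>j\<in>J. w j * (if y \<in> I j then E (rcis r y) else 0)) + 576 * d * E (rcis r y)) has_integral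
     (\<Sum>j\<in>J. w j * integral (I j) (\<lambda>y. E (rcis r y))) + 576 * d * arc_int r a (a+2*pi)) {a..a+2*pi}"
    by (intro has_integral_add has_integral_sum finJ has_integral_mult_right hI integrable_integral intE)
  have per: "arc_int r a (a+2*pi) = arc_int r 0 (2*pi)"
    by (intro integral_periodic contE) (auto simp: rcis_periodic)
  have \<xi>: "cmod (cis y0) = 1" by simp
  have growth: "E (of_real r1 * cis y0) \<le> 8 * ((1 - r1) / d) powr (\<alpha> - 1) * E \<zeta>" if "0 \<le> r1" "r1 \<le> 1 - d" for r1
    using E_radial_growth[OF \<xi> that] d by (simp add: \<zeta>_def rcis_def)
  have arc: "integral (I j) (\<lambda>y. E (rcis r y)) \<le> arc_const * (2 ^ j * d) * (8 * (2 ^ j) powr (\<alpha> - 1) * E \<zeta>)" if j: "j \<in> J" for j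
  proof -
    have j2: "2 ^ j * d \<le> 1/2" using j by (simp add: J_def)
    have "1 * d \<le> 2 ^ j * d" using d by (intro mult_right_mono) auto
    then have jd: "d \<le> 2 ^ j * d" by simp
    have I1: "integral (I j) (\<lambda>y. E (rcis r y)) \<le> arc_const * (2 ^ j * d) * E (rcis (1 - 2 ^ j * d) y0)"
      unfolding I_def
    proof (rule arc_integral_le)
      show "1 - 2 ^ j * d < r" using jd r(2) by linarith
    qed (use d j2 r in auto)
    have "E (rcis (1 - 2 ^ j * d) y0) \<le> 8 * ((1 - (1 - 2 ^ j * d)) / d) powr (\<alpha> - 1) * E \<zeta>"
      unfolding rcis_def using j2 jd by (intro growth) auto
    also have "(1 - (1 - 2 ^ j * d)) / d = 2 ^ j" using d by simp
    finally have "E (rcis (1 - 2 ^ j * d) y0) \<le> 8 * (2 ^ j) powr (\<alpha> - 1) * E \<zeta>" .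
    then have "arc_const * (2 ^ j * d) * E (rcis (1 - 2 ^ j * d) y0) \<le> arc_const * (2 ^ j * d) * (8 * (2 ^ j) powr (\<alpha> - 1) * E \<zeta>)"
      using arc_const_nonneg d by (intro mult_left_mono) auto
    with I1 show ?thesis by linarith
  qed
  have "integral {0..2*pi} (\<lambda>y. E (rcis r y) * Poisson_kernel \<zeta> (cis y)) =
        integral {a..a+2*pi} (\<lambda>y. E (rcis r y) * Poisson_kernel \<zeta> (cis y))"
  proof (rule integral_periodic[symmetric])
    show "E (rcis r (x + 2 * pi)) * Poisson_kernel \<zeta> (cis (x + 2 * pi)) = E (rcis r x) * Poisson_kernel \<zeta> (cis x)" for x
      unfolding rcis_periodic by (simp add: cis_mult[symmetric])
  qed (auto intro!: continuous_intros contE contP)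
  also have "\<dots> \<le> integral {a..a+2*pi} (\<lambda>y. (\<Sum>j\<in>J. w j * (if y \<in> I j then E (rcis r y) else 0)) + 576 * d * E (rcis r y))"
  proof (rule integral_le)
    show "(\<lambda>y. E (rcis r y) * Poisson_kernel \<zeta> (cis y)) integrable_on {a..a+2*pi}"
      by (intro integrable_continuous_interval continuous_intros contE contP)
    show "(\<lambda>y. (\<Sum>j\<in>J. w j * (if y \<in> I j then E (rcis r y) else 0)) + 576 * d * E (rcis r y)) integrable_on {a..a+2*pi}"
      using hB by blast
    fix y assume "y \<in> {a..a+2*pi}"
    then have "\<bar>y - y0\<bar> \<le> pi" by (auto simp: a_def)
    then have "Poisson_kernel \<zeta> (cis y) \<le> (\<Sum>j\<in>J. w j * (if y \<in> I j then 1 else 0)) + 576 * d"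
      unfolding \<zeta>_def J_def w_def I_def by (rule Poisson_kernel_dyadic_le[OF d])
    then have "E (rcis r y) * Poisson_kernel \<zeta> (cis y) \<le> E (rcis r y) * ((\<Sum>j\<in>J. w j * (if y \<in> I j then 1 else 0)) + 576 * d)"
      by (intro mult_left_mono) (simp_all add: E_pos less_imp_le)
    also have "\<dots> = (\<Sum>j\<in>J. w j * (if y \<in> I j then E (rcis r y) else 0)) + 576 * d * E (rcis r y)"
      by (simp add: distrib_left sum_distrib_left mult_ac if_distrib cong: if_cong)
    finally show "E (rcis r y) * Poisson_kernel \<zeta> (cis y) \<le> (\<Sum>j\<in>J. w j * (if y \<in> I j then E (rcis r y) else 0)) + 576 * d * E (rcis r y)" .
  qed
  also have "\<dots> = (\<Sum>j\<in>J. w j * integral (I j) (\<lambda>y. E (rcis r y))) + 576 * d * arc_int r 0 (2*pi)"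
    using integral_unique[OF hB] per by simp
  also have "\<dots> \<le> (\<Sum>j\<in>J. w j * (arc_const * (2 ^ j * d) * (8 * (2 ^ j) powr (\<alpha> - 1) * E \<zeta>))) + 576 * d * length_bound"
    using d by (intro add_mono sum_mono mult_left_mono arc total_length_le[OF r(1,3)]) (auto simp: w_def)
  \<comment> \<open>The factor \<open>d\<close> cancels, and \<open>4^(-j) * 2^j * 2^(j * (\<alpha>
    - 1)) = 2^(j * (\<alpha> - 2))\<close> is a geometric term with ratio below 1.\<close>
  also have "(\<Sum>j\<in>J. w j * (arc_const * (2 ^ j * d) * (8 * (2 ^ j) powr (\<alpha> - 1) * E \<zeta>))) = 144 * 8 * arc_const * E \<zeta> * (\<Sum>j\<in>J. (2 powr (\<alpha> - 2)) ^ j)"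
    unfolding sum_distrib_left
  proof (rule sum.cong[OF refl])
    fix j :: nat
    have "(2 powr (\<alpha> - 2)) ^ j = (2 ^ j) powr (\<alpha> - 2)"
      by (simp add: powr_powr powr_realpow[symmetric] mult.commute)
    also have "\<dots> = (2 ^ j) powr (\<alpha> - 1) / 2 ^ j"
      using powr_diff[of "2 ^ j" "\<alpha> - 1" 1] by simp
    finally have e: "(2 powr (\<alpha> - 2)) ^ j = (2 ^ j) powr (\<alpha> - 1) / (2::real) ^ j" .
    have f: "(1/4::real) ^ j * 2 ^ j = 1 / 2 ^ j"
      by (simp add: power_mult_distrib[symmetric] power_divide[symmetric]) (simp add: power_divide)
    have "w j * (arc_const * (2 ^ j * d) * (8 * (2 ^ j) powr (\<alpha> - 1) * E \<zeta>)) =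
       144 * 8 * arc_const * E \<zeta> * (((1/4) ^ j * 2 ^ j) * (2 ^ j) powr (\<alpha> - 1))"
      using d by (simp add: w_def)
    then show "w j * (arc_const * (2 ^ j * d) * (8 * (2 ^ j) powr (\<alpha> - 1) * E \<zeta>)) = 144 * 8 * arc_const * E \<zeta> * (2 powr (\<alpha> - 2)) ^ j"
      unfolding e f by simp
  qed
  also have "144 * 8 * arc_const * E \<zeta> * (\<Sum>j\<in>J. (2 powr (\<alpha> - 2)) ^ j) \<le> 144 * 8 * arc_const * E \<zeta> * (1 / (1 - 2 powr (\<alpha> - 2)))"
  proof (rule mult_left_mono)
    have "2 powr (\<alpha> - 2) < 2 powr 0" using \<alpha> by (intro powr_less_mono) auto
    then have q: "norm (2 powr (\<alpha> - 2)) < 1" by simp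
    have "(\<Sum>j\<in>J. (2 powr (\<alpha> - 2)) ^ j) \<le> (\<Sum>j. (2 powr (\<alpha> - 2)) ^ j)"
      by (rule sum_le_suminf[OF summable_geometric[OF q] finJ]) simp
    then show "(\<Sum>j\<in>J. (2 powr (\<alpha> - 2)) ^ j) \<le> 1 / (1 - 2 powr (\<alpha> - 2))"
      using suminf_geometric[OF q] by simp
    show "0 \<le> 144 * 8 * arc_const * E \<zeta>" using arc_const_nonneg E_pos[of \<zeta>] by simp
  qed
  \<comment> \<open>Radial growth from the origin gives
    \<open>d * E 0 \<le> 8 * d powr (2 - \<alpha>) * E \<zeta>\<close>, and the power of
    \<open>d\<close> is at most 1.\<close>
  also have "576 * d * length_bound \<le> 576 * length_bound * 8 / E 0 * E \<zeta>"
  proof -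
    have "E 0 \<le> 8 * (1 / d) powr (\<alpha> - 1) * E \<zeta>" using growth[of 0] d by simp
    then have "d * E 0 \<le> d * (8 * (1 / d) powr (\<alpha> - 1) * E \<zeta>)" using d by (intro mult_left_mono) auto
    also have "\<dots> = 8 * (d * (1 / d) powr (\<alpha> - 1)) * E \<zeta>" by simp
    also have "d * (1 / d) powr (\<alpha> - 1) = d powr (2 - \<alpha>)"
    proof -
      have 1: "(1 / d) powr (\<alpha> - 1) = d powr (1 - \<alpha>)"
        using d by (simp add: powr_divide powr_minus_divide[symmetric])
      have "d powr 1 * d powr (1 - \<alpha>) = d powr (1 + (1 - \<alpha>))" by (rule powr_add[symmetric])
      moreover have "d powr 1 = d" using d by simp
      ultimately show ?thesis unfolding 1 by simp
    qed
    also have "8 * d powr (2 - \<alpha>) * E \<zeta> \<le> 8 * 1 * E \<zeta>"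
      using d \<alpha> E_pos[of \<zeta>] by (intro mult_right_mono mult_left_mono powr_le1) auto
    finally have "d \<le> 8 * E \<zeta> / E 0" using E_pos[of 0] by (simp add: field_simps)
    then have "576 * length_bound * d \<le> 576 * length_bound * (8 * E \<zeta> / E 0)" using length_bound_nonneg by (intro mult_left_mono) auto
    then show ?thesis by (simp add: mult_ac)
  qed
  finally show ?thesis by (simp add: Poisson_const_def \<zeta>_def algebra_simps)
qed

end

subsection \<open>Lengths of curves\<close>

lemma curve_length_ge_dist:
  assumes "a \<le> s" "s \<le> t" "t \<le> b"
  shows "ennreal (dist (u s) (u t)) \<le> curve_length u a b"
  unfolding curve_length_def
  by (rule SUP_upper2[of "[s, t]"]) (use assms in auto)

text \<open>On a uniform partition so fine that \<open>u'\<close> varies by at most \<epsilon>, each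
  chord is at least \<open>k * norm (u' (p i)) - \<epsilon> * k\<close>, while the integral over the
  piece is at most \<open>k * norm (u' (p i)) + \<epsilon> * k\<close>. The total loss is
  \<open>2 * \<epsilon> * (b - a) = e\<close>.\<close>

lemma curve_length_ge_integral:
  fixes u u' :: "real \<Rightarrow> complex"
  assumes der: "\<And>t. (u has_vector_derivative u' t) (at t)" and cont: "continuous_on {a..b} u'" and ab: "a < b"
  shows "ennreal (integral {a..b} (\<lambda>t. norm (u' t))) \<le> curve_length u a b"
proof (rule ennreal_le_epsilon)
  fix e :: real assume e: "e > 0"
  define \<epsilon> where "\<epsilon> = e / (2 * (b - a))"
  have \<epsilon>: "\<epsilon> > 0" using e ab by (simp add: \<epsilon>_def)
  have "uniformly_continuous_on {a..b} u'"
    using cont by (simp add: compact_uniformly_continuous)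
  then obtain d where d: "d > 0" "\<And>s t. s \<in> {a..b} \<Longrightarrow> t \<in> {a..b} \<Longrightarrow> dist t s < d \<Longrightarrow> dist (u' t) (u' s) < \<epsilon>"
    using \<epsilon> unfolding uniformly_continuous_on_def by metis
  obtain n :: nat where n: "(b - a) / d < real n" using reals_Archimedean2 by blast
  have n0: "n > 0"
  proof -
    have "0 < (b - a) / d" using ab d by simp
    then have "0 < real n" using n by linarith
    then show ?thesis by simp
  qed
  define k where "k = (b - a) / n"
  have k: "0 < k" "k < d" using n n0 ab d by (auto simp: k_def field_simps)
  define p where "p = (\<lambda>i::nat. a + i * k)"
  have p: "p i \<in> {a..b}" if "i \<le> n" for i
  proof -
    have "real i * k \<le> real n * k" using that k by (intro mult_right_mono) auto
    also have "\<dots> = b - a" using n0 by (simp add: k_def)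
    finally show ?thesis using k by (simp add: p_def)
  qed
  have pS: "p (Suc i) = p i + k" for i by (simp add: p_def algebra_simps)
  have pn: "p n = b" "p 0 = a" using n0 by (simp_all add: p_def k_def)
  have intg: "(\<lambda>t. norm (u' t)) integrable_on {x..y}" if "a \<le> x" "y \<le> b" for x y
    using that by (intro integrable_continuous_interval continuous_intros continuous_on_subset[OF cont]) auto
  have piece: "integral {p i..p (Suc i)} (\<lambda>t. norm (u' t)) \<le> dist (u (p i)) (u (p (Suc i))) + 2 * \<epsilon> * k" if i: "i < n" for i
  proof -
    have ii: "p i \<in> {a..b}" "p (Suc i) \<in> {a..b}" using p[of i] p[of "Suc i"] i by auto
    have le: "p i \<le> p (Suc i)" using pS k by simp
    have near: "norm (u' t - u' (p i)) \<le> \<epsilon>" if "t \<in> {p i..p (Suc i)}" for t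
    proof -
      have "dist t (p i) < d" using that pS[of i] k by (auto simp: dist_real_def)
      then have "dist (u' t) (u' (p i)) < \<epsilon>" using d(2)[of "p i" t] ii that by auto
      then show ?thesis by (simp add: dist_norm)
    qed
    have cont': "continuous_on {p i..p (Suc i)} u'" using ii by (intro continuous_on_subset[OF cont]) auto
    have ftc: "(u' has_integral u (p (Suc i)) - u (p i)) {p i..p (Suc i)}"
      using le by (intro fundamental_theorem_of_calculus has_vector_derivative_at_within[OF der])
    have cst: "((\<lambda>t. u' (p i)) has_integral k *\<^sub>R u' (p i)) {p i..p (Suc i)}"
      using has_integral_const_real[of "u' (p i)" "p i" "p (Suc i)"] k by (simp add: pS)
    have "norm ((u (p (Suc i)) - u (p i)) - k *\<^sub>R u' (p i)) \<le> \<epsilon> * k"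
    proof -
      have h: "((\<lambda>t. u' t - u' (p i)) has_integral (u (p (Suc i)) - u (p i)) - k *\<^sub>R u' (p i)) {p i..p (Suc i)}"
        by (rule has_integral_diff[OF ftc cst])
      have "norm ((u (p (Suc i)) - u (p i)) - k *\<^sub>R u' (p i)) \<le> \<epsilon> * Sigma_Algebra.measure lborel (cbox (p i) (p (Suc i)))"
        by (rule has_integral_bound[where f="\<lambda>t. u' t - u' (p i)"]) (use \<epsilon> h near in auto)
      then show ?thesis using k by (simp add: pS)
    qed
    moreover have "norm (k *\<^sub>R u' (p i)) = k * norm (u' (p i))" using k by simp
    moreover have "norm (k *\<^sub>R u' (p i)) \<le> norm (u (p (Suc i)) - u (p i)) + norm ((u (p (Suc i)) - u (p i)) - k *\<^sub>R u' (p i))"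
      by (metis norm_triangle_sub norm_minus_commute)
    moreover have "dist (u (p i)) (u (p (Suc i))) = norm (u (p (Suc i)) - u (p i))"
      by (simp add: dist_norm norm_minus_commute)
    ultimately have 1: "k * norm (u' (p i)) \<le> dist (u (p i)) (u (p (Suc i))) + \<epsilon> * k"
      by linarith
    have "integral {p i..p (Suc i)} (\<lambda>t. norm (u' t)) \<le> integral {p i..p (Suc i)} (\<lambda>t. norm (u' (p i)) + \<epsilon>)"
    proof (rule integral_le)
      show "(\<lambda>t. norm (u' t)) integrable_on {p i..p (Suc i)}" using ii by (intro intg) auto
      show "(\<lambda>t. norm (u' (p i)) + \<epsilon>) integrable_on {p i..p (Suc i)}" by (rule integrable_const_ivl)
      fix t assume "t \<in> {p i..p (Suc i)}"
      then show "norm (u' t) \<le> norm (u' (p i)) + \<epsilon>"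
        using near[of t] norm_triangle_ineq2[of "u' t" "u' (p i)"] by linarith
    qed
    also have "\<dots> = k * norm (u' (p i)) + \<epsilon> * k" using k by (simp add: pS algebra_simps)
    finally show ?thesis using 1 by linarith
  qed
  have sum: "integral {a..p m} (\<lambda>t. norm (u' t)) \<le> (\<Sum>i<m. dist (u (p i)) (u (p (Suc i)))) + m * (2 * \<epsilon> * k)" if "m \<le> n" for m
    using that
  proof (induction m)
    case 0
    then show ?case by (simp add: pn)
  next
    case (Suc m)
    have "integral {a..p (Suc m)} (\<lambda>t. norm (u' t)) = integral {a..p m} (\<lambda>t. norm (u' t)) + integral {p m..p (Suc m)} (\<lambda>t. norm (u' t))"
      using Suc.prems p[of m] p[of "Suc m"] pS[of m] k
      by (intro Henstock_Kurzweil_Integration.integral_combine[symmetric] intg) auto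
    then show ?case using Suc piece[of m] by (simp add: algebra_simps)
  qed
  define ts where "ts = map p [0..<Suc n]"
  have len: "length ts = Suc n" by (simp add: ts_def)
  have nth: "ts ! i = p i" if "i \<le> n" for i using that by (simp add: ts_def del: upt_Suc)
  have "sorted ts"
    unfolding sorted_iff_nth_mono len using nth k by (auto simp: p_def mult_right_mono)
  moreover have "set ts \<subseteq> {a..b}" using p by (auto simp: ts_def simp del: upt_Suc)
  ultimately have "ennreal (\<Sum>i<length ts - 1. dist (u (ts ! i)) (u (ts ! Suc i))) \<le> curve_length u a b"
    unfolding curve_length_def by (intro SUP_upper) auto
  also have "(\<Sum>i<length ts - 1. dist (u (ts ! i)) (u (ts ! Suc i))) = (\<Sum>i<n. dist (u (p i)) (u (p (Suc i))))"
    unfolding len by (intro sum.cong) (auto simp: nth)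
  finally have cl: "ennreal (\<Sum>i<n. dist (u (p i)) (u (p (Suc i)))) \<le> curve_length u a b" .
  have "real n * k = b - a" using n0 by (simp add: k_def)
  then have "real n * (2 * \<epsilon> * k) = 2 * \<epsilon> * (b - a)" by simp
  also have "\<dots> = e"
  proof -
    have "2 * (e / (2 * D)) * D = e" if "D \<noteq> 0" for D :: real using that by simp
    from this[of "b - a"] show ?thesis unfolding \<epsilon>_def using ab by simp
  qed
  finally have "real n * (2 * \<epsilon> * k) = e" .
  then have "integral {a..b} (\<lambda>t. norm (u' t)) \<le> (\<Sum>i<n. dist (u (p i)) (u (p (Suc i)))) + e"
    using sum[of n] pn by simp
  then have "ennreal (integral {a..b} (\<lambda>t. norm (u' t))) \<le> ennreal ((\<Sum>i<n. dist (u (p i)) (u (p (Suc i)))) + e)"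
    by (rule ennreal_leI)
  also have "\<dots> = ennreal (\<Sum>i<n. dist (u (p i)) (u (p (Suc i)))) + ennreal e"
    using e by (intro ennreal_plus sum_nonneg) auto
  also have "\<dots> \<le> curve_length u a b + ennreal e" using cl by (rule add_right_mono)
  finally show "ennreal (integral {a..b} (\<lambda>t. norm (u' t))) \<le> curve_length u a b + ennreal e" .
qed

lemma wirtinger_harmonic:
  assumes hol: "h holomorphic_on ball 0 1" "g holomorphic_on ball 0 1"
    and f: "\<And>z. z \<in> ball 0 1 \<Longrightarrow> f z = h z + cnj (g z)" and z: "z \<in> ball 0 1"
  shows "wirtinger f z = deriv h z" "wirtinger_bar f z = cnj (deriv g z)"
proof -
  have h: "(h has_field_derivative deriv h z) (at z)" and g: "(g has_field_derivative deriv g z) (at z)"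
    using hol z by (auto intro!: holomorphic_derivI[where S="ball 0 1"])
  have hd: "(h has_derivative (*) (deriv h z)) (at z)" and gd: "(g has_derivative (*) (deriv g z)) (at z)"
    using h g by (simp_all add: has_field_derivative_def)
  have "((\<lambda>z. h z + cnj (g z)) has_derivative (\<lambda>v. deriv h z * v + cnj (deriv g z * v))) (at z)"
    by (intro has_derivative_add has_derivative_cnj hd gd)
  then have fd: "(f has_derivative (\<lambda>v. deriv h z * v + cnj (deriv g z * v))) (at z)"
    by (rule has_derivative_transform_within_open[OF _ open_ball z]) (simp add: f)
  have "frechet_derivative f (at z) = (\<lambda>v. deriv h z * v + cnj (deriv g z * v))"
    by (rule frechet_derivative_at[OF fd, symmetric])
  then show "wirtinger f z = deriv h z" "wirtinger_bar f z = cnj (deriv g z)"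
    by (simp_all add: wirtinger_def wirtinger_bar_def algebra_simps)
qed

text \<open>Injectivity determines \<open>s\<close> and \<open>t\<close> modulo
  \<open>2 * pi\<close> up to exchange, and \<open>0 \<le> t - s \<le> 2 * pi\<close> then leaves
  only the translates of \<open>(a, b)\<close> and \<open>(b, a + 2 * pi)\<close>, which the last
  two hypotheses cover.\<close>

lemma shorter_subarc_length_ge:
  assumes ab: "a < b" "b < a + 2 * pi" and inj: "inj_on f (ball 0 1)" and r: "0 < r" "r < 1"
    and per: "\<And>(k::int). ennreal x \<le> curve_length (\<lambda>y. f (rcis r y)) (a + 2 * pi * k) (b + 2 * pi * k)"
    and per': "\<And>(k::int). ennreal x \<le> curve_length (\<lambda>y. f (rcis r y)) (b + 2 * pi * k) (a + 2 * pi + 2 * pi * k)"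
  shows "ennreal x \<le> shorter_subarc_length f r (f (rcis r a)) (f (rcis r b))"
  unfolding shorter_subarc_length_def
proof (rule INF_greatest, clarify)
  fix s t assume st: "s \<le> t" "t \<le> s + 2 * pi" and eq: "{f (rcis r s), f (rcis r t)} = {f (rcis r a), f (rcis r b)}"
  have cong: "\<exists>k::int. x = v + 2 * pi * k" if "f (rcis r x) = f (rcis r v)" for x v
  proof -
    have "rcis r x = rcis r v" using that inj r by (auto dest: inj_onD)
    then show ?thesis by (rule rcis_eq_imp[OF r(1)])
  qed
  have int1: "j = 0" if "-(2*pi) < 2 * pi * of_int j" "2 * pi * of_int j < 2 * pi" for j :: int
  proof -
    have A: "2 * pi * real_of_int j \<le> 2 * pi * (-1)" if "j \<le> -1"
      using that by (intro mult_left_mono) auto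
    have B: "2 * pi * 1 \<le> 2 * pi * real_of_int j" if "j \<ge> 1"
      using that by (intro mult_left_mono) auto
    consider "j \<le> -1" | "j = 0" | "j \<ge> 1" by linarith
    then show ?thesis using A B that by cases auto
  qed
  from eq consider "f (rcis r s) = f (rcis r a)" "f (rcis r t) = f (rcis r b)" | "f (rcis r s) = f (rcis r b)" "f (rcis r t) = f (rcis r a)"
    by (auto simp: doubleton_eq_iff)
  then show "ennreal x \<le> curve_length (\<lambda>y. f (rcis r y)) s t"
  proof cases
    case 1
    obtain k l :: int where kl: "s = a + 2 * pi * k" "t = b + 2 * pi * l" using cong[OF 1(1)] cong[OF 1(2)] by blast
    have e: "2 * pi * real_of_int (l - k) = t - s - (b - a)" by (simp add: kl algebra_simps)
    have "l - k = 0" by (rule int1; unfold e; use st ab in linarith)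
    then show ?thesis using per[of k] kl by simp
  next
    case 2
    obtain k l :: int where kl: "s = b + 2 * pi * k" "t = a + 2 * pi * l" using cong[OF 2(1)] cong[OF 2(2)] by blast
    have e: "2 * pi * real_of_int (l - k - 1) = t - s + (b - a) - 2 * pi" by (simp add: kl algebra_simps)
    have "l - k - 1 = 0" by (rule int1; unfold e; use st ab in linarith)
    then have "l = k + 1" by simp
    then show ?thesis using per'[of k] kl by (simp add: algebra_simps)
  qed
qed

subsection \<open>Boundary values\<close>

text \<open>For \<open>d = 0\<close> a finite quotient forces \<open>x = 0\<close>, since any other
  \<open>x\<close> divided by 0 is infinite. An infinite \<open>d\<close> is excluded because it
  makes the quotient 0.\<close>

lemma ennreal_le_mult_of_divide_le:
  fixes x d m :: ennreal
  assumes "x / d \<le> m" "d < \<infinity>" "m < \<infinity>"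
  shows "x \<le> m * d"
proof (cases "d = 0")
  case True
  then have "x = 0" using assms by (cases "x = 0") (auto simp: ennreal_divide_zero top_unique)
  then show ?thesis by simp
next
  case False
  have "x = x / d * d" using False assms(2) by (simp add: ennreal_divide_times ennreal_divide_self)
  also have "\<dots> \<le> m * d" using assms(1) by (rule mult_right_mono) simp
  finally show ?thesis .
qed

section \<open>From lengths of image arcs to integrals of \<open>E\<close>\<close>

context qc_harmonic
begin

lemma normD_eq: "z \<in> ball 0 1 \<Longrightarrow> normD f z = E z + cmod (deriv g z)"
  using wirtinger_harmonic[OF hol_h hol_g f_eq] by (simp add: normD_def norm_h')

lemma normD_bounds:
  assumes "z \<in> ball 0 1" shows "E z \<le> normD f z" "normD f z \<le> 2 * E z"
  using normD_eq[OF assms] norm_g'[OF assms] by auto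

text \<open>The angular speed is at least \<open>r * (\<bar>h'\<bar> - \<bar>g'\<bar>)\<close>; the
  factor \<open>1 / (2 * K)\<close> combines \<open>r \<ge> 1/2\<close> with
  \<open>norm_diff_le\<close>.\<close>

lemma circle_curve_length_ge:
  assumes r: "1/2 \<le> r" "r < 1" and ab: "a < b"
  shows "ennreal (arc_int r a b / (2 * K)) \<le> curve_length (\<lambda>y. f (rcis r y)) a b"
proof -
  define u' where "u' = (\<lambda>y. of_real r * \<i> * (deriv h (rcis r y) * cis y - cnj (deriv g (rcis r y) * cis y)))"
  have rb: "rcis r y \<in> ball 0 1" for y using r by simp
  have cr: "continuous_on A (\<lambda>y. deriv u (rcis r y))" if "u holomorphic_on ball 0 1" for u A
    using r by (intro continuous_on_deriv_compose[OF that open_ball])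
      (auto simp: rcis_def norm_mult intro!: continuous_intros)
  have cont: "continuous_on A u'" for A
    unfolding u'_def by (intro continuous_intros cr hol_h hol_g)
  have ge: "E (rcis r y) / (2 * K) \<le> cmod (u' y)" for y
  proof -
    have "E (rcis r y) / K \<le> E (rcis r y) - cmod (deriv g (rcis r y))"
      using norm_diff_le[OF rb, of y] K by (simp add: divide_le_eq mult.commute)
    also have "\<dots> = cmod (deriv h (rcis r y) * cis y) - cmod (cnj (deriv g (rcis r y) * cis y))"
      using norm_h'[OF rb] by (simp add: norm_mult)
    also have "\<dots> \<le> cmod (deriv h (rcis r y) * cis y - cnj (deriv g (rcis r y) * cis y))"
      by (rule norm_triangle_ineq2)
    finally have 1: "E (rcis r y) / K \<le> cmod (deriv h (rcis r y) * cis y - cnj (deriv g (rcis r y) * cis y))" .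
    have "E (rcis r y) / (2 * K) = 1/2 * (E (rcis r y) / K)" by simp
    also have "\<dots> \<le> r * (E (rcis r y) / K)"
      using r K E_pos[of "rcis r y"] by (intro mult_right_mono) (auto simp: less_imp_le)
    also have "\<dots> \<le> r * cmod (deriv h (rcis r y) * cis y - cnj (deriv g (rcis r y) * cis y))"
      using 1 r by (intro mult_left_mono) auto
    also have "\<dots> = cmod (u' y)" using r by (simp add: u'_def norm_mult)
    finally show ?thesis .
  qed
  have "arc_int r a b / (2 * K) = integral {a..b} (\<lambda>y. E (rcis r y) / (2 * K))"
    by simp
  also have "\<dots> \<le> integral {a..b} (\<lambda>y. cmod (u' y))"
    using K r by (intro integral_le integrable_continuous_interval continuous_intros continuous_on_E_rcis cont ge) auto
  finally have "ennreal (arc_int r a b / (2 * K)) \<le> ennreal (integral {a..b} (\<lambda>y. cmod (u' y)))"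
    by (rule ennreal_leI)
  also have "\<dots> \<le> curve_length (\<lambda>y. f (rcis r y)) a b"
  proof (rule curve_length_ge_integral[OF _ cont ab])
    show "((\<lambda>y. f (rcis r y)) has_vector_derivative u' y) (at y)" for y
      unfolding u'_def using r by (intro has_vector_derivative_angular) auto
  qed
  finally show ?thesis .
qed

lemma integral_E_shift:
  "arc_int r (a + 2 * pi * of_int k) (b + 2 * pi * of_int k) = arc_int r a b"
proof -
  have "arc_int r (a + 2 * pi * of_int k) (b + 2 * pi * of_int k) =
        integral {a..b} ((\<lambda>y. E (rcis r y)) \<circ> (+) (2 * pi * of_int k))"
    by (rule integral_shift_Icc_real[symmetric])
  also have "(\<lambda>y. E (rcis r y)) \<circ> (+) (2 * pi * of_int k) = (\<lambda>y. E (rcis r y))"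
  proof
    fix x :: real
    have "cis (2 * pi * of_int k) = 1" by (rule cis_multiple_2pi) simp
    then have "rcis r (2 * pi * of_int k + x) = rcis r x" by (simp add: rcis_def cis_mult[symmetric])
    then show "((\<lambda>y. E (rcis r y)) \<circ> (+) (2 * pi * of_int k)) x = E (rcis r x)" by simp
  qed
  finally show ?thesis .
qed

text \<open>Specialise the supremum to the two endpoints, bound \<open>diam_dist\<close> by the
  diameter of the given crosscut, and bound the shorter image arc below by the smaller of the two
  integrals of \<open>E\<close>, divided by \<open>2 * K\<close>.\<close>

lemma Pommerenke_integral_le:
  assumes r: "1/2 \<le> r" "r < 1" and ab: "a < b" "b < a + 2 * pi"
    and A: "arc A" "pathstart A = f (rcis r a)" "pathfinish A = f (rcis r b)"
      "path_image A - {f (rcis r a), f (rcis r b)} \<subseteq> f ` ball 0 r"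
    and m: "m \<ge> 0" and P: "(SUP r\<in>{0<..<1}. SUP w1\<in>f ` sphere 0 r. SUP w2\<in>f ` sphere 0 r - {w1}.
        shorter_subarc_length f r w1 w2 / diam_dist (f ` ball 0 r) w1 w2) \<le> ennreal m"
  shows "min (arc_int r a b) (arc_int r b (a+2*pi))
         \<le> 2 * K * m * diameter (path_image A)"
proof -
  define x where "x = min (arc_int r a b) (arc_int r b (a+2*pi)) / (2 * K)"
  let ?w1 = "f (rcis r a)" and ?w2 = "f (rcis r b)"
  have ne: "?w1 \<noteq> ?w2" using arc_distinct_ends[OF A(1)] A by metis
  have sph: "rcis r y \<in> sphere 0 r" for y using r by simp
  have K2: "0 < 2 * K" using K by simp
  have "shorter_subarc_length f r ?w1 ?w2 / diam_dist (f ` ball 0 r) ?w1 ?w2 \<le>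
     (SUP w2\<in>f ` sphere 0 r - {?w1}. shorter_subarc_length f r ?w1 w2 / diam_dist (f ` ball 0 r) ?w1 w2)"
    by (rule SUP_upper) (use ne sph in auto)
  also have "\<dots> \<le> (SUP w1\<in>f ` sphere 0 r. SUP w2\<in>f ` sphere 0 r - {w1}. shorter_subarc_length f r w1 w2 / diam_dist (f ` ball 0 r) w1 w2)"
    by (rule SUP_upper2[of ?w1]) (use sph in auto)
  also have "\<dots> \<le> (SUP r\<in>{0<..<1}. SUP w1\<in>f ` sphere 0 r. SUP w2\<in>f ` sphere 0 r - {w1}.
        shorter_subarc_length f r w1 w2 / diam_dist (f ` ball 0 r) w1 w2)"
    by (rule SUP_upper2[of r]) (use r in auto)
  also have "\<dots> \<le> ennreal m" by (rule P)
  finally have q: "shorter_subarc_length f r ?w1 ?w2 / diam_dist (f ` ball 0 r) ?w1 ?w2 \<le> ennreal m" .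
  have dd: "diam_dist (f ` ball 0 r) ?w1 ?w2 \<le> ennreal (diameter (path_image A))"
    unfolding diam_dist_def by (rule INF_lower) (use A in simp)
  then have ddf: "diam_dist (f ` ball 0 r) ?w1 ?w2 < \<infinity>"
    by (rule le_less_trans) simp
  have xl: "ennreal x \<le> shorter_subarc_length f r ?w1 ?w2"
  proof (rule shorter_subarc_length_ge[OF ab inj])
    fix k :: int
    have "x \<le> arc_int r (a + 2 * pi * of_int k) (b + 2 * pi * of_int k) / (2 * K)"
      unfolding x_def using K2 by (subst integral_E_shift) (auto intro: divide_right_mono)
    then have "ennreal x \<le> ennreal (arc_int r (a + 2 * pi * of_int k) (b + 2 * pi * of_int k) / (2 * K))"
      by (rule ennreal_leI)
    also have "\<dots> \<le> curve_length (\<lambda>y. f (rcis r y)) (a + 2 * pi * of_int k) (b + 2 * pi * of_int k)"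
      using r ab by (intro circle_curve_length_ge) auto
    finally show "ennreal x \<le> curve_length (\<lambda>y. f (rcis r y)) (a + 2 * pi * of_int k) (b + 2 * pi * of_int k)" .
    have "x \<le> arc_int r (b + 2 * pi * of_int k) (a + 2 * pi + 2 * pi * of_int k) / (2 * K)"
      unfolding x_def using K2 by (subst integral_E_shift) (auto intro: divide_right_mono)
    then have "ennreal x \<le> ennreal (arc_int r (b + 2 * pi * of_int k) (a + 2 * pi + 2 * pi * of_int k) / (2 * K))"
      by (rule ennreal_leI)
    also have "\<dots> \<le> curve_length (\<lambda>y. f (rcis r y)) (b + 2 * pi * of_int k) (a + 2 * pi + 2 * pi * of_int k)"
      using r ab by (intro circle_curve_length_ge) auto
    finally show "ennreal x \<le> curve_length (\<lambda>y. f (rcis r y)) (b + 2 * pi * of_int k) (a + 2 * pi + 2 * pi * of_int k)" .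
  qed (use r in auto)
  also have "shorter_subarc_length f r ?w1 ?w2 \<le> ennreal m * diam_dist (f ` ball 0 r) ?w1 ?w2"
    by (rule ennreal_le_mult_of_divide_le[OF q ddf]) simp
  also have "\<dots> \<le> ennreal m * ennreal (diameter (path_image A))"
    using dd by (rule mult_left_mono) simp
  also have "\<dots> = ennreal (m * diameter (path_image A))"
    using m by (simp add: ennreal_mult')
  finally have "ennreal x \<le> ennreal (m * diameter (path_image A))" .
  moreover have "0 \<le> m * diameter (path_image A)"
    using m compact_imp_bounded[OF compact_arc_image[OF A(1)]] by (intro mult_nonneg_nonneg diameter_ge_0)
  ultimately have "x \<le> m * diameter (path_image A)" by (simp add: ennreal_le_iff)
  then show ?thesis unfolding x_def using K2 by (simp add: divide_le_eq mult_ac)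
qed

end

section \<open>Radial limits and passage to the boundary\<close>

context qc_harmonic_John
begin

text \<open>For \<open>r < 1/2\<close> the Harnack inequality on the disk of radius
  \<open>1/2\<close> applies, with exponent \<open>6 / (1/2) * (1/2) = 6\<close>.\<close>

lemma mean_E_bounded: "\<exists>C. \<forall>r. 0 < r \<and> r < 1 \<longrightarrow> arc_int r 0 (2*pi) \<le> C"
proof (intro exI[of _ "max length_bound (2 * pi * (exp 6 * E 0))"] allI impI)
  fix r :: real assume r: "0 < r \<and> r < 1"
  show "arc_int r 0 (2*pi) \<le> max length_bound (2 * pi * (exp 6 * E 0))"
  proof (cases "1/2 \<le> r")
    case True
    then show ?thesis using total_length_le[of r] r by simp
  next
    case False
    have "arc_int r 0 (2*pi) \<le> integral {0..2*pi} (\<lambda>y. exp 6 * E 0)"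
    proof (rule integral_le)
      show "(\<lambda>y. E (rcis r y)) integrable_on {0..2*pi}" using r by (intro E_rcis_integrable) auto
      show "(\<lambda>y. exp 6 * E 0) integrable_on {0..2*pi}" by (rule integrable_const_ivl)
      show "E (rcis r y) \<le> exp 6 * E 0" for y
        by (rule E_le_exp[of "1/2"]) (use False r in auto)
    qed
    also have "\<dots> = 2 * pi * (exp 6 * E 0)" by simp
    finally show ?thesis by simp
  qed
qed

text \<open>With \<open>A = exp (L / 2)\<close> and \<open>B = g' / A\<close> one has
  \<open>normD f = \<bar>A\<bar>^2 + \<bar>B\<bar> * \<bar>A\<bar>\<close>, and
  \<open>\<bar>g'\<bar> < E\<close> makes \<open>\<bar>B\<bar>^2 \<le> E\<close> as well. Both
  functions thus inherit the bounded circle means of \<open>E\<close>.\<close>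

lemma normD_radial_limit_AE:
  "AE t in lborel. t \<in> {0..2*pi} \<longrightarrow> (\<exists>l. ((\<lambda>r. normD f (of_real r * cis t)) \<longlongrightarrow> l) (at_left 1))"
proof -
  obtain C where C: "\<And>r. 0 < r \<Longrightarrow> r < 1 \<Longrightarrow> arc_int r 0 (2*pi) \<le> C"
    using mean_E_bounded by blast
  define A where "A = (\<lambda>z. exp (L z / 2))"
  define B where "B = (\<lambda>z. deriv g z / A z)"
  have holA: "A holomorphic_on ball 0 1" unfolding A_def by (intro holomorphic_intros hol_L) auto
  have holB: "B holomorphic_on ball 0 1" unfolding B_def
    by (intro holomorphic_intros holA holomorphic_deriv hol_g) (auto simp: A_def)
  have nA: "(cmod (A z))\<^sup>2 = E z" for z
    by (simp add: A_def E_def power2_eq_square exp_add[symmetric])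
  have nB: "(cmod (B z))\<^sup>2 \<le> E z" if "z \<in> ball 0 1" for z
  proof -
    have "(cmod (B z))\<^sup>2 = (cmod (deriv g z))\<^sup>2 / E z" by (simp add: B_def norm_divide power_divide nA)
    also have "\<dots> \<le> (E z)\<^sup>2 / E z" using norm_g'[OF that] E_pos[of z] by (intro divide_right_mono power_mono) auto
    also have "\<dots> = E z" by (simp add: power2_eq_square)
    finally show ?thesis .
  qed
  have limA: "AE t in lborel. t \<in> {0..2*pi} \<longrightarrow> (\<exists>l. ((\<lambda>r. A (of_real r * cis t)) \<longlongrightarrow> l) (at_left 1))"
    by (rule H2_radial_limits_AE[OF holA, of C]) (use C in \<open>simp add: nA\<close>)
  have limB: "AE t in lborel. t \<in> {0..2*pi} \<longrightarrow> (\<exists>l. ((\<lambda>r. B (of_real r * cis t)) \<longlongrightarrow> l) (at_left 1))"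
  proof (rule H2_radial_limits_AE[OF holB, of C])
    fix r :: real assume r: "0 < r" "r < 1"
    have "continuous_on {0..2*pi} (\<lambda>t. B (rcis r t))"
      by (rule continuous_on_compose2[OF holomorphic_on_imp_continuous_on[OF holB]])
         (use r in \<open>auto simp: rcis_def norm_mult intro!: continuous_intros\<close>)
    then have "integral {0..2*pi} (\<lambda>t. (cmod (B (rcis r t)))\<^sup>2) \<le> integral {0..2*pi} (\<lambda>t. E (rcis r t))"
      using r by (intro integral_le E_rcis_integrable nB integrable_continuous_interval continuous_intros) auto
    also have "\<dots> \<le> C" by (rule C[OF r])
    finally show "integral {0..2*pi} (\<lambda>t. (cmod (B (rcis r t)))\<^sup>2) \<le> C" .
  qed
  from limA limB show ?thesis
  proof eventually_elim
    case (elim t)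
    show ?case
    proof
      assume t: "t \<in> {0..2*pi}"
      obtain l1 l2 where l: "((\<lambda>r. A (of_real r * cis t)) \<longlongrightarrow> l1) (at_left 1)" "((\<lambda>r. B (of_real r * cis t)) \<longlongrightarrow> l2) (at_left 1)"
        using elim t by blast
      have "((\<lambda>r. (cmod (A (of_real r * cis t)))\<^sup>2 + cmod (B (of_real r * cis t)) * cmod (A (of_real r * cis t))) \<longlongrightarrow> (cmod l1)\<^sup>2 + cmod l2 * cmod l1) (at_left 1)"
        by (intro tendsto_intros l)
      moreover have "eventually (\<lambda>r. (cmod (A (of_real r * cis t)))\<^sup>2 + cmod (B (of_real r * cis t)) * cmod (A (of_real r * cis t)) = normD f (of_real r * cis t)) (at_left 1)"
      proof (rule eventually_at_leftI[of 0])
        fix r :: real assume r: "r \<in> {0<..<1}"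
        then have zb: "of_real r * cis t \<in> ball 0 1" by (simp add: norm_mult)
        show "(cmod (A (of_real r * cis t)))\<^sup>2 + cmod (B (of_real r * cis t)) * cmod (A (of_real r * cis t)) = normD f (of_real r * cis t)"
          unfolding normD_eq[OF zb] nA by (simp add: B_def norm_divide A_def)
      qed simp
      ultimately have "((\<lambda>r. normD f (of_real r * cis t)) \<longlongrightarrow> (cmod l1)\<^sup>2 + cmod l2 * cmod l1) (at_left 1)"
        by (rule Lim_transform_eventually)
      then show "\<exists>l. ((\<lambda>r. normD f (of_real r * cis t)) \<longlongrightarrow> l) (at_left 1)" by blast
    qed
  qed
qed

text \<open>Fatou's lemma along radii tending to 1. The 2 is the cost of replacing
  \<open>normD f\<close> by \<open>E\<close>: at most \<open>2 * E\<close> in the numerator, at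
  least \<open>E\<close> in the denominator.\<close>

lemma Poisson_normD_boundary_le:
  assumes \<zeta>: "\<zeta> \<in> ball 0 1"
  shows "(\<integral>\<^sup>+ t\<in>{0..2 * pi}. ennreal (normD_boundary f (cis t) / normD f \<zeta> *
            ((1 - (cmod \<zeta>)\<^sup>2) / (cmod (cis t - \<zeta>))\<^sup>2)) \<partial>lborel) \<le> ennreal (2 * Poisson_const)"
proof -
  define d where "d = 1 - cmod \<zeta>"
  define y0 where "y0 = Arg \<zeta>"
  have d: "0 < d" "d \<le> 1" using \<zeta> by (auto simp: d_def)
  have \<zeta>eq: "\<zeta> = rcis (1 - d) y0" by (simp add: d_def y0_def rcis_cmod_Arg)
  \<comment> \<open>The shift by 2 starts the sequence at \<open>1/2\<close>, the smallest radius
    allowed in \<open>Poisson_integral_E_le\<close>.\<close>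
  define r where "r = (\<lambda>n::nat. 1 - 1 / real (n + 2))"
  have r: "1/2 \<le> r n" "r n < 1" for n by (auto simp: r_def field_simps)
  have rlim: "r \<longlonglongrightarrow> 1"
    using tendsto_diff[OF tendsto_const LIMSEQ_ignore_initial_segment[OF lim_inverse_n', of 2], of 1]
    by (simp add: r_def)
  have rleft: "filterlim r (at_left 1) sequentially"
    unfolding filterlim_at using rlim r by (auto simp: less_imp_neq)
  define P where "P = (\<lambda>t. Poisson_kernel \<zeta> (cis t))"
  have P0: "0 \<le> P t" for t unfolding P_def using \<zeta> by (intro Poisson_kernel_nonneg) auto
  have N0: "0 < normD f \<zeta>" using normD_bounds(1)[OF \<zeta>] E_pos[of \<zeta>] by linarith
  have neq: "cis t \<noteq> \<zeta>" for t
  proof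
    assume "cis t = \<zeta>"
    then have "cmod (cis t) = cmod \<zeta>" by simp
    then show False using \<zeta> by simp
  qed
  have contP: "continuous_on S P" for S
    unfolding P_def Poisson_kernel_def using neq by (intro continuous_intros) auto
  define u where "u = (\<lambda>n t. normD f (of_real (r n) * cis t) / normD f \<zeta> * P t)"
  have zb: "of_real (r n) * cis t \<in> ball 0 1" for n t
    using r[of n] by (simp add: norm_mult)
  have contN: "continuous_on S (\<lambda>t. normD f (of_real (r n) * cis t))" for S n
  proof -
    have cr: "continuous_on S (\<lambda>t. v (of_real (r n) * cis t))" if "v holomorphic_on ball 0 1" for v
      by (rule continuous_on_compose2[OF holomorphic_on_imp_continuous_on[OF that]])
         (use zb in \<open>auto intro!: continuous_intros\<close>)
    have "continuous_on S (\<lambda>t. E (of_real (r n) * cis t) + cmod (deriv g (of_real (r n) * cis t)))"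
      unfolding E_def by (intro continuous_intros cr hol_L holomorphic_deriv hol_g) auto
    then show ?thesis using normD_eq[OF zb] by simp
  qed
  have contu: "continuous_on S (u n)" for S n
    unfolding u_def using N0 by (intro continuous_intros contN contP) auto
  have u_le: "(\<integral>\<^sup>+ t. ennreal (indicator {0..2*pi} t * u n t) \<partial>lborel) \<le> ennreal (2 * Poisson_const)" if n: "1 - d < r n" for n
  proof -
    have u0: "0 \<le> u n t" for t
      unfolding u_def using N0 P0[of t] normD_bounds(1)[OF zb, of n t] E_pos[of "of_real (r n) * cis t"] by simp
    have "(\<integral>\<^sup>+ t. ennreal (indicator {0..2*pi} t * u n t) \<partial>lborel) = ennreal (integral {0..2*pi} (u n))"
      by (rule nn_integral_has_integral_lebesgue[OF u0 integrable_integral[OF integrable_continuous_interval[OF contu]]])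
    also have "integral {0..2*pi} (u n) \<le> integral {0..2*pi} (\<lambda>t. 2 / E \<zeta> * (E (rcis (r n) t) * P t))"
    proof (rule integral_le)
      show "u n integrable_on {0..2*pi}" by (intro integrable_continuous_interval contu)
      show "(\<lambda>t. 2 / E \<zeta> * (E (rcis (r n) t) * P t)) integrable_on {0..2*pi}"
        using r[of n] by (intro integrable_continuous_interval continuous_intros continuous_on_E_rcis contP) auto
      fix t
      have "normD f (of_real (r n) * cis t) / normD f \<zeta> \<le> 2 * E (rcis (r n) t) / E \<zeta>"
        using normD_bounds(2)[OF zb, of n t] normD_bounds(1)[OF \<zeta>] E_pos[of \<zeta>] E_pos[of "rcis (r n) t"]
        by (intro frac_le) (auto simp: rcis_def)
      then have "u n t \<le> 2 * E (rcis (r n) t) / E \<zeta> * P t"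
        unfolding u_def using P0 by (rule mult_right_mono)
      then show "u n t \<le> 2 / E \<zeta> * (E (rcis (r n) t) * P t)" by simp
    qed
    also have "\<dots> = 2 / E \<zeta> * integral {0..2*pi} (\<lambda>t. E (rcis (r n) t) * P t)" by simp
    also have "\<dots> \<le> 2 / E \<zeta> * (Poisson_const * E \<zeta>)"
      unfolding P_def \<zeta>eq using E_pos[of \<zeta>] n r[of n] d \<zeta>eq
      by (intro mult_left_mono Poisson_integral_E_le) (auto simp: less_imp_le)
    also have "\<dots> = 2 * Poisson_const" using E_pos[of \<zeta>] by simp
    finally show ?thesis by (simp add: ennreal_leI)
  qed
  have "(\<integral>\<^sup>+ t\<in>{0..2 * pi}. ennreal (normD_boundary f (cis t) / normD f \<zeta> *
            ((1 - (cmod \<zeta>)\<^sup>2) / (cmod (cis t - \<zeta>))\<^sup>2)) \<partial>lborel) =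
        (\<integral>\<^sup>+ t. liminf (\<lambda>n. ennreal (indicator {0..2*pi} t * u n t)) \<partial>lborel)"
  \<comment> \<open>Replaces the boundary function, a \<open>Lim\<close> with unspecified values on
    a null set, by a lower limit of continuous functions, for which measurability is clear.\<close>
  proof (rule nn_integral_cong_AE)
    show "AE t in lborel. ennreal (normD_boundary f (cis t) / normD f \<zeta> *
            ((1 - (cmod \<zeta>)\<^sup>2) / (cmod (cis t - \<zeta>))\<^sup>2)) * indicator {0..2 * pi} t =
          liminf (\<lambda>n. ennreal (indicator {0..2*pi} t * u n t))"
      using normD_radial_limit_AE
    proof eventually_elim
      case (elim t)
      show ?case
      proof (cases "t \<in> {0..2*pi}")
        case True
        then obtain l where l: "((\<lambda>r. normD f (of_real r * cis t)) \<longlongrightarrow> l) (at_left 1)" using elim by blast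
        have "normD_boundary f (cis t) = l"
          unfolding normD_boundary_def by (rule tendsto_Lim[OF _ l]) simp
        moreover have "(\<lambda>n. u n t) \<longlonglongrightarrow> l / normD f \<zeta> * P t"
          unfolding u_def using N0 by (intro tendsto_intros filterlim_compose[OF l rleft]) auto
        then have "(\<lambda>n. ennreal (u n t)) \<longlonglongrightarrow> ennreal (l / normD f \<zeta> * P t)" by (rule tendsto_ennrealI)
        then have "liminf (\<lambda>n. ennreal (u n t)) = ennreal (l / normD f \<zeta> * P t)"
          by (rule lim_imp_Liminf[OF sequentially_bot])
        ultimately show ?thesis using True by (simp add: P_def Poisson_kernel_def)
      next
        case False
        then show ?thesis by (simp add: Liminf_const[OF sequentially_bot])
      qed
    qed
  qed
  also have "\<dots> \<le> liminf (\<lambda>n. \<integral>\<^sup>+ t. ennreal (indicator {0..2*pi} t * u n t) \<partial>lborel)"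
  proof (rule nn_integral_liminf)
    fix n
    have "u n \<in> borel_measurable borel" using contu by (intro borel_measurable_continuous_onI)
    then show "(\<lambda>t. ennreal (indicator {0..2*pi} t * u n t)) \<in> borel_measurable lborel" by simp
  qed
  also have "\<dots> \<le> ennreal (2 * Poisson_const)"
  proof (rule Liminf_le)
    have "eventually (\<lambda>n. 1 - d < r n) sequentially"
      by (rule order_tendstoD[OF rlim]) (use d in simp)
    then show "eventually (\<lambda>n. (\<integral>\<^sup>+ t. ennreal (indicator {0..2*pi} t * u n t) \<partial>lborel) \<le> ennreal (2 * Poisson_const)) sequentially"
      by eventually_elim (rule u_le)
  qed (rule sequentially_bot)
  finally show ?thesis .
qed

end

text \<open>The existence of the radial limits is part of the claim because
  \<open>normD_boundary\<close> is a \<open>Lim\<close>, which says nothing where no limit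
  exists.\<close>

theorem corollary1:
  fixes K :: real and f :: "complex \<Rightarrow> complex" and G :: "complex set"
  assumes "K \<ge> 1"
    and "f \<in> S_H2 \<inter> S_H0"
    and "quasiconformal K (ball 0 1) f"
    and "f ` ball 0 1 = G"
    and "bounded_Pommerenke_interior_domain f G"
    and "radial_John_disk f G"
  shows "(AE t in lborel. t \<in> {0..2 * pi} \<longrightarrow>
            (\<exists>l. ((\<lambda>r. normD f (of_real r * cis t)) \<longlongrightarrow> l) (at_left 1))) \<and>
         (SUP \<zeta>\<in>ball 0 1. ennreal (1 / (2 * pi)) *
            (\<integral>\<^sup>+ t\<in>{0..2 * pi}.
               ennreal (normD_boundary f (cis t) / normD f \<zeta> *
                        ((1 - (cmod \<zeta>)\<^sup>2) / (cmod (cis t - \<zeta>))\<^sup>2)) \<partial>lborel)) < \<infinity>"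
proof -
  have inj: "inj_on f (ball 0 1)" and jac: "\<And>z. z \<in> ball 0 1 \<Longrightarrow> jacobian f z > 0"
    using assms(2) by (auto simp: S_H2_def S_H_def)
  obtain h g where dec: "harmonic_decomposition f h g" and sup:
     "(SUP z\<in>ball 0 1. ennreal (cmod (of_real (1 - (cmod z)\<^sup>2) * (deriv (deriv h) z / deriv h z) - 2 * cnj z))) < 4"
    using assms(2) by (auto simp: S_H2_def)
  have hol_h: "h holomorphic_on ball 0 1" and hol_g: "g holomorphic_on ball 0 1"
    and f_eq: "\<And>z. z \<in> ball 0 1 \<Longrightarrow> f z = h z + cnj (g z)"
    using dec by (auto simp: harmonic_decomposition_def)
  have wirt: "wirtinger f z = deriv h z" "wirtinger_bar f z = cnj (deriv g z)" if "z \<in> ball 0 1" for z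
    by (rule wirtinger_harmonic[OF hol_h hol_g _ that]; erule f_eq)+
  have jac_eq: "jacobian f z = (cmod (deriv h z))\<^sup>2 - (cmod (deriv g z))\<^sup>2" if "z \<in> ball 0 1" for z
    using wirt[OF that] by (simp add: jacobian_def)
  have normD_eq: "normD f z = cmod (deriv h z) + cmod (deriv g z)" if "z \<in> ball 0 1" for z
    using wirt[OF that] by (simp add: normD_def)
  \<comment> \<open>Zeros of \<open>h'\<close> are excluded by the positive Jacobian, which yields
    the logarithm \<open>L\<close> on the contractible disk.\<close>
  have h'ne: "deriv h z \<noteq> 0" if "z \<in> ball 0 1" for z
    using jac[OF that] jac_eq[OF that] by auto
  have hol_h': "deriv h holomorphic_on ball 0 1" and hol_g': "deriv g holomorphic_on ball 0 1"
    using hol_h hol_g by (auto intro: holomorphic_deriv)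
  have ctr: "contractible (ball 0 1 :: complex set)" by (intro convex_imp_contractible convex_ball)
  obtain L where hol_L: "L holomorphic_on ball 0 1" and L: "\<And>z. z \<in> ball 0 1 \<Longrightarrow> deriv h z = exp (L z)"
    using contractible_imp_holomorphic_log[OF hol_h' ctr] h'ne by blast
  have L': "deriv L z = deriv (deriv h) z / deriv h z" if z: "z \<in> ball 0 1" for z
  proof -
    have "(L has_field_derivative deriv L z) (at z)"
      using hol_L z by (auto intro!: holomorphic_derivI[where S="ball 0 1"])
    then have "((\<lambda>z. exp (L z)) has_field_derivative exp (L z) * deriv L z) (at z)"
      by (auto intro!: derivative_eq_intros)
    then have "(deriv h has_field_derivative exp (L z) * deriv L z) (at z)"
      by (rule has_field_derivative_transform_within_open[OF _ open_ball z]) (simp add: L)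
    then have "deriv (deriv h) z = exp (L z) * deriv L z" by (rule DERIV_imp_deriv)
    then show ?thesis using L[OF z] by simp
  qed
  define s where "s = (SUP z\<in>ball 0 1. ennreal (cmod (of_real (1 - (cmod z)\<^sup>2) * (deriv (deriv h) z / deriv h z) - 2 * cnj z)))"
  have sfin: "s < \<infinity>" using sup unfolding s_def by (rule less_trans) simp
  \<comment> \<open>Taking the supremum itself keeps the inequality \<open>\<alpha> < 2\<close>
    strict and uniform; pointwise bounds below 4 would not give this.\<close>
  define \<alpha> where "\<alpha> = enn2real s / 2"
  have \<alpha>: "0 \<le> \<alpha>" "\<alpha> < 2"
  proof -
    show "0 \<le> \<alpha>" by (simp add: \<alpha>_def)
    have "s < 4" using sup unfolding s_def .
    then have "ennreal (enn2real s) < ennreal 4" using sfin by simp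
    then have "enn2real s < 4" by (simp add: ennreal_less_iff)
    then show "\<alpha> < 2" by (simp add: \<alpha>_def)
  qed
  have pre: "cmod (of_real (1 - (cmod z)\<^sup>2) * deriv L z - 2 * cnj z) \<le> 2 * \<alpha>" if z: "z \<in> ball 0 1" for z
  proof -
    have "ennreal (cmod (of_real (1 - (cmod z)\<^sup>2) * (deriv (deriv h) z / deriv h z) - 2 * cnj z)) \<le> s"
      unfolding s_def by (rule SUP_upper[OF z])
    also have "s = ennreal (2 * \<alpha>)" using sfin by (simp add: \<alpha>_def)
    finally show ?thesis unfolding L'[OF z] using \<alpha> by (simp add: ennreal_le_iff)
  qed
  have qc: "(cmod (deriv h z) + cmod (deriv g z))\<^sup>2 \<le> K * ((cmod (deriv h z))\<^sup>2 - (cmod (deriv g z))\<^sup>2)" if z: "z \<in> ball 0 1" for z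
  proof (rule AE_lborel_imp_everywhere[OF open_ball _ _ _ z])
    show "continuous_on (ball 0 1) (\<lambda>z. (cmod (deriv h z) + cmod (deriv g z))\<^sup>2)"
      "continuous_on (ball 0 1) (\<lambda>z. K * ((cmod (deriv h z))\<^sup>2 - (cmod (deriv g z))\<^sup>2))"
      by (intro continuous_intros holomorphic_on_imp_continuous_on hol_h' hol_g')+
    have "AE z in lborel. z \<in> ball 0 1 \<longrightarrow> f differentiable (at z) \<and> (normD f z)\<^sup>2 \<le> K * \<bar>jacobian f z\<bar>"
      using assms(3) by (simp add: quasiconformal_def)
    then show "AE z in lborel. z \<in> ball 0 1 \<longrightarrow> (cmod (deriv h z) + cmod (deriv g z))\<^sup>2 \<le> K * ((cmod (deriv h z))\<^sup>2 - (cmod (deriv g z))\<^sup>2)"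
    proof eventually_elim
      case (elim z)
      show ?case
      proof
        assume z: "z \<in> ball 0 1"
        have "\<bar>jacobian f z\<bar> = (cmod (deriv h z))\<^sup>2 - (cmod (deriv g z))\<^sup>2" using jac[OF z] jac_eq[OF z] by simp
        then show "(cmod (deriv h z) + cmod (deriv g z))\<^sup>2 \<le> K * ((cmod (deriv h z))\<^sup>2 - (cmod (deriv g z))\<^sup>2)"
          using elim z normD_eq[OF z] by simp
      qed
    qed
  qed
  interpret Q: qc_harmonic f h g L K \<alpha>
    by (rule qc_harmonic.intro[OF hol_h hol_g hol_L f_eq L assms(1) qc \<alpha> pre inj])
  obtain f' where hom: "homeomorphism (ball 0 1) (f ` ball 0 1) f f'"
    using assms(3) by (auto simp: quasiconformal_def sense_preserving_homeomorphism_def)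
  obtain c where c: "radial_c_John_disk c f G" using assms(6) by (auto simp: radial_John_disk_def)
  define S where "S = (SUP r\<in>{0<..<1}. SUP w1\<in>f ` sphere 0 r. SUP w2\<in>f ` sphere 0 r - {w1}.
        shorter_subarc_length f r w1 w2 / diam_dist (f ` ball 0 r) w1 w2)"
  have "S < \<infinity>"
    using assms(5) unfolding bounded_Pommerenke_interior_domain_def Pommerenke_interior_domain_def S_def by blast
  then have S: "S = ennreal (enn2real S)" by simp
  define m where "m = enn2real S"
  have m: "0 \<le> m" "S \<le> ennreal m" using S by (simp_all add: m_def)
  have op: "open (f ` ball 0 1)" using assms(3) by (simp add: quasiconformal_def)
  have bd: "bounded (f ` ball 0 1)" using assms(4,5) by (simp add: bounded_Pommerenke_interior_domain_def)
  have inv1: "continuous_on (f ` ball 0 1) f'" using hom by (simp add: homeomorphism_def)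
  have inv2: "f' (f z) = z" if "z \<in> ball 0 1" for z using hom that by (simp add: homeomorphism_def)
  have c0: "0 \<le> c" using c by (simp add: radial_c_John_disk_def)
  have m0: "0 \<le> 2 * K * m" using m(1) assms(1) by simp
  have John: "dist (f (of_real t * z)) (f z) \<le> c * infdist (f (of_real t * z)) (frontier (f ` ball 0 1))"
    if z: "z \<in> ball 0 1" and t: "0 \<le> t" "t \<le> 1" for z t
  proof -
    have "ennreal (dist (f (of_real t * z)) (f (of_real 1 * z))) \<le> curve_length (\<lambda>t. f (of_real t * z)) t 1"
      by (rule curve_length_ge_dist) (use t in auto)
    also have "\<dots> \<le> ennreal (c * infdist (f (of_real t * z)) (frontier G))"
    proof -
      have "\<forall>t\<in>{0..1}. curve_length (\<lambda>t. f (of_real t * z)) t 1 \<le> ennreal (c * infdist (f (of_real t * z)) (frontier G))"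
        using c z unfolding radial_c_John_disk_def by blast
      then show ?thesis using t by simp
    qed
    finally have "ennreal (dist (f (of_real t * z)) (f (of_real 1 * z))) \<le> ennreal (c * infdist (f (of_real t * z)) (frontier G))" .
    then have "dist (f (of_real t * z)) (f (of_real 1 * z)) \<le> c * infdist (f (of_real t * z)) (frontier G)"
      using c0 by (subst (asm) ennreal_le_iff) (simp_all add: infdist_nonneg)
    then show ?thesis unfolding assms(4) by simp
  qed
  note pom = Q.Pommerenke_integral_le[OF _ _ _ _ _ _ _ _ m(1) m(2)[unfolded S_def], unfolded Q.E_def]
  interpret J: qc_harmonic_John f h g L K \<alpha> f' c "2 * K * m"
    by (intro_locales, rule qc_harmonic_John_axioms.intro[OF op bd inv1 inv2 c0 m0 John pom])
  have "(SUP \<zeta>\<in>ball 0 1. ennreal (1 / (2 * pi)) *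
            (\<integral>\<^sup>+ t\<in>{0..2 * pi}.
               ennreal (normD_boundary f (cis t) / normD f \<zeta> *
                        ((1 - (cmod \<zeta>)\<^sup>2) / (cmod (cis t - \<zeta>))\<^sup>2)) \<partial>lborel)) \<le> ennreal (1 / (2 * pi)) * ennreal (2 * J.Poisson_const)"
    by (intro SUP_least mult_left_mono J.Poisson_normD_boundary_le) auto
  also have "\<dots> < \<infinity>" by (simp add: ennreal_mult_less_top)
  finally show ?thesis using J.normD_radial_limit_AE by blast
qed

end
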